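(* Let $\lambda$ be a partition into no more than $n$ parts, let $\delta=(n,n-1,\ldots,1)$, and let $m=\lambda_1+n$. Then $$D_{sp(2n)}(x;t)\; sp_\lambda(x;t)=\sum_{CM\in\mathcal{CM}^{\lambda+\delta}(2n)} t^{\mathrm{ne}_o(CM)+\mathrm{se}_e(CM)+\mathrm{wgt}_e(CM)}\,(1+t)^{\mathrm{ns}(CM)}\,x^{\mathrm{wgt}(CM)},$$ where the summation is taken over all $2n\times m$ U-turn square ice configuration matrices $CM$ whose top-most element in each column is either NW or NS if the column number is a part of $\mu=\lambda+\delta$ and is SW or WE otherwise.
   Context: Here $n\ge1$, $x=(x_1,\ldots,x_n)$ and $t$ are indeterminates, $\lambda$ is padded with zeros to length $n$, and $\lambda+\delta=(\lambda_1+n,\lambda_2+n-1,\ldots,\lambda_n+1)$. $\displaystyle D_{sp(2n)}(x;t)=\prod_{i=1}^n x_i^{n-i+1}\prod_{i=1}^n(1+tx_i^{-2})\prod_{1\le i<j\le n}(1+tx_i^{-1}x_j)(1+tx_i^{-1}x_j^{-1})$. Symplectic tableaux: let $[n,\overline n]=\{1,\ldots,n\}\cup\{\overline1,\ldots,\overline n\}$ be ordered by $\overline1<1<\overline2<2<\cdots<\overline n<n$. $\mathcal T^\lambda(sp(2n))$ is the set of fillings $T$ of the Young diagram of $\lambda$ (left-adjusted rows of lengths $\lambda_i$) with entries in $[n,\overline n]$ that are weakly increasing from left to right along rows, strictly increasing down columns, and whose first-column entry in row $i$ is $\ge\overline i$ for each $i$. If $m_k(T)$, $m_{\overline k}(T)$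 are the numbers of entries $k$, $\overline k$ in $T$, then $x^{\mathrm{wgt}(T)}=\prod_{k=1}^n x_k^{m_k(T)-m_{\overline k}(T)}$, $\mathrm{bar}(T)=\sum_{k=1}^n m_{\overline k}(T)$, and $sp_\lambda(x;t)=\sum_{T\in\mathcal T^\lambda(sp(2n))}t^{2\,\mathrm{bar}(T)}x^{\mathrm{wgt}(T)}$. Square ice configuration matrices: let $\mu$ be a partition with $n$ distinct positive parts and $m=\mu_1$. Consider the $2n\times m$ grid of internal vertices (rows numbered from the top, columns from the left). Each internal vertex has four edges (up, down, left, right), shared with the neighbouring vertex or, at the border of the grid, a boundary edge. Orient all edges so that each internal vertex has exactly two incoming and two outgoing edges, and so that: every right boundary edge is incoming (points into the grid); every bottom boundary edge is outgoing; for each $1\le i\le n$, exactly one of the left boundary edges of rows $2i-1$ and $2i$ is incoming and the other is outgoing (a U-turn); the top boundary edge of column $q$ is outgoing if $q$ is a part of $\mu$ and incoming otherwise. To each such orientation associate the $2n\times m$ matrix $CM$ whose element at each vertex is: WE if the incoming edges are the left and right ones; NS if the incoming edges are the upper and lower ones; and otherwise NE, SW, NW or SE according as the two outgoing edges are up and right, down and left, up and left, or down and right, respectively. $\mathcal{CM}^\mu(2n)$ is the set of all matrices $CM$ so obtained. Statistics: $\mathrm{ns}(CM)$ is the number of elements NS; $\mathrm{ne}_o(CM)$ the number of elements NE in odd-numbered rows; $\mathrm{se}_e(CM)$ the number of elements SE in even-numbered rows; $\mathrm{wgt}_e(CM)$ the total number of elements NE, SE and WE in even-numbered rows. With $m_k(CM)$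 and $m_{\overline k}(CM)$ the total numbers of elements NE, SE, WE in row $2n+1-2k$ and row $2n+2-2k$ respectively, $x^{\mathrm{wgt}(CM)}=\prod_{k=1}^n x_k^{m_k(CM)-m_{\overline k}(CM)}$.
   Formalization: The closing clause on top-most elements (NW/NS, SW/WE) is dropped: it contradicts the definition of CM^{λ+δ}(2n) and makes the identity false (n=1, λ=0). The sum runs over CM^{λ+δ}(2n) as defined, with the top edge outgoing iff the column is a part of μ. *)

theory Defs
  imports
    "HOL-Library.Poly_Mapping"
    "HOL-Library.FuncSet"
    "HOL-Computational_Algebra.Polynomial"
begin

(* Laurent polynomials in indeterminates x_1, x_2, ... with coefficients in the integer polynomials
   in t: the convolution product of the outer type is that of the monoid algebra over the additive
   group of finitely supported integer exponent vectors. *)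
type_synonym laurent = "(nat \<Rightarrow>\<^sub>0 int) \<Rightarrow>\<^sub>0 int poly"

(* X i e is the power x_i^e; the exponent e may be negative. *)
definition X :: "nat \<Rightarrow> int \<Rightarrow> laurent" where
  "X i e = Poly_Mapping.single (Poly_Mapping.single i e) 1"

definition tt :: laurent where
  "tt = Poly_Mapping.single 0 [:0, 1:]"

definition D_sp :: "nat \<Rightarrow> laurent" where
  "D_sp n = (\<Prod>i=1..n. X i (int (n - i + 1)))
          * (\<Prod>i=1..n. 1 + tt * X i (-2))
          * (\<Prod>i=1..n. \<Prod>j=i+1..n. (1 + tt * X i (-1) * X j 1) * (1 + tt * X i (-1) * X j (-1)))"

(* A partition is the sequence lam 1, lam 2, ... padded with zeros; lam 0 is never used. *)
definition partition_at_most :: "nat \<Rightarrow> (nat \<Rightarrow> nat) \<Rightarrow> bool" where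
  "partition_at_most n lam \<longleftrightarrow> (\<forall>i\<ge>1. lam (i + 1) \<le> lam i) \<and> (\<forall>i>n. lam i = 0)"

definition add_delta :: "nat \<Rightarrow> (nat \<Rightarrow> nat) \<Rightarrow> nat \<Rightarrow> nat" where
  "add_delta n lam i = (if 1 \<le> i \<and> i \<le> n then lam i + (n + 1 - i) else 0)"


section \<open>Symplectic tableaux\<close>

datatype sp_letter = Bar nat | Unbar nat

fun letter_rank :: "sp_letter \<Rightarrow> nat" where
  "letter_rank (Bar k) = 2 * k"
| "letter_rank (Unbar k) = 2 * k + 1"

lemma letter_rank_inject: "letter_rank a = letter_rank b \<Longrightarrow> a = b"
  by (cases a; cases b) (auto, presburger+)

instantiation sp_letter :: linorder
begin

definition less_eq_sp_letter :: "sp_letter \<Rightarrow> sp_letter \<Rightarrow> bool" where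
  "less_eq_sp_letter a b \<longleftrightarrow> letter_rank a \<le> letter_rank b"

definition less_sp_letter :: "sp_letter \<Rightarrow> sp_letter \<Rightarrow> bool" where
  "less_sp_letter a b \<longleftrightarrow> letter_rank a < letter_rank b"

instance
  by standard
    (auto simp: less_eq_sp_letter_def less_sp_letter_def intro: letter_rank_inject)

end

definition sp_letters :: "nat \<Rightarrow> sp_letter set" where
  "sp_letters n = Bar ` {1..n} \<union> Unbar ` {1..n}"

definition young_diagram :: "(nat \<Rightarrow> nat) \<Rightarrow> (nat \<times> nat) set" where
  "young_diagram lam = {(i, j). 1 \<le> i \<and> 1 \<le> j \<and> j \<le> lam i}"

definition sp_tableaux :: "nat \<Rightarrow> (nat \<Rightarrow> nat) \<Rightarrow> (nat \<times> nat \<Rightarrow> sp_letter) set" where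
  "sp_tableaux n lam =
    {T \<in> young_diagram lam \<rightarrow>\<^sub>E sp_letters n.
      (\<forall>i j j'. (i, j) \<in> young_diagram lam \<longrightarrow> (i, j') \<in> young_diagram lam \<longrightarrow> j < j'
          \<longrightarrow> T (i, j) \<le> T (i, j')) \<and>
      (\<forall>i i' j. (i, j) \<in> young_diagram lam \<longrightarrow> (i', j) \<in> young_diagram lam \<longrightarrow> i < i'
          \<longrightarrow> T (i, j) < T (i', j)) \<and>
      (\<forall>i. (i, 1) \<in> young_diagram lam \<longrightarrow> Bar i \<le> T (i, 1))}"

definition letter_count :: "(nat \<Rightarrow> nat) \<Rightarrow> (nat \<times> nat \<Rightarrow> sp_letter) \<Rightarrow> sp_letter \<Rightarrow> nat" where
  "letter_count lam T a = card {c \<in> young_diagram lam. T c = a}"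

definition tableau_wgt :: "nat \<Rightarrow> (nat \<Rightarrow> nat) \<Rightarrow> (nat \<times> nat \<Rightarrow> sp_letter) \<Rightarrow> laurent" where
  "tableau_wgt n lam T =
    (\<Prod>k=1..n. X k (int (letter_count lam T (Unbar k)) - int (letter_count lam T (Bar k))))"

definition bar_count :: "nat \<Rightarrow> (nat \<Rightarrow> nat) \<Rightarrow> (nat \<times> nat \<Rightarrow> sp_letter) \<Rightarrow> nat" where
  "bar_count n lam T = (\<Sum>k=1..n. letter_count lam T (Bar k))"

definition sp_char :: "nat \<Rightarrow> (nat \<Rightarrow> nat) \<Rightarrow> laurent" where
  "sp_char n lam = (\<Sum>T\<in>sp_tableaux n lam. tt ^ (2 * bar_count n lam T) * tableau_wgt n lam T)"


section \<open>U-turn square ice\<close>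

datatype hdir = Leftward | Rightward
datatype vdir = Upward | Downward
datatype side = Up | Down | Left | Right
datatype ice = WE | NS | NE | SW | NW | SE

(* An orientation of the edges of a grid with rows 1, 2, ... and columns 1, ..., m is a pair (h, v).
   h i j is the direction of the horizontal edge of row i between columns j and j+1, so that h i 0
   and h i m are the left and right boundary edges; v i j is the direction of the vertical edge of
   column j between rows i and i+1, so that v 0 j is the top boundary edge. *)
definition incoming :: "(nat \<Rightarrow> nat \<Rightarrow> hdir) \<Rightarrow> (nat \<Rightarrow> nat \<Rightarrow> vdir) \<Rightarrow> nat \<Rightarrow> nat \<Rightarrow> side set" where
  "incoming h v i j =
    {s. case s of Up \<Rightarrow> v (i - 1) j = Downward
                | Down \<Rightarrow> v i j = Upward
                | Left \<Rightarrow> h i (j - 1) = Rightward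
                | Right \<Rightarrow> h i j = Leftward}"

(* The argument is the set of incoming sides, its complement the set of outgoing sides; only
   two-element sets occur, so the last case is that of outgoing edges down and right. *)
definition ice_elem :: "side set \<Rightarrow> ice" where
  "ice_elem I =
    (if I = {Left, Right} then WE
     else if I = {Up, Down} then NS
     else if - I = {Up, Right} then NE
     else if - I = {Down, Left} then SW
     else if - I = {Up, Left} then NW
     else SE)"

(* mu 1, ..., mu n are the parts of the partition mu; there are 2n rows and m columns. *)
definition ice_orientation ::
  "nat \<Rightarrow> nat \<Rightarrow> (nat \<Rightarrow> nat) \<Rightarrow> (nat \<Rightarrow> nat \<Rightarrow> hdir) \<Rightarrow> (nat \<Rightarrow> nat \<Rightarrow> vdir) \<Rightarrow> bool" where
  "ice_orientation n m mu h v \<longleftrightarrow>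
    (\<forall>i\<in>{1..2*n}. \<forall>j\<in>{1..m}. card (incoming h v i j) = 2) \<and>
    (\<forall>i\<in>{1..2*n}. h i m = Leftward) \<and>
    (\<forall>j\<in>{1..m}. v (2*n) j = Downward) \<and>
    (\<forall>i\<in>{1..n}. h (2*i - 1) 0 \<noteq> h (2*i) 0) \<and>
    (\<forall>q\<in>{1..m}. v 0 q = (if q \<in> mu ` {1..n} then Upward else Downward))"

type_synonym ice_matrix = "nat \<times> nat \<Rightarrow> ice"

definition CM_set :: "nat \<Rightarrow> (nat \<Rightarrow> nat) \<Rightarrow> ice_matrix set" where
  "CM_set n mu =
    {CM. \<exists>h v. ice_orientation n (mu 1) mu h v \<and>
      CM = restrict (\<lambda>(i, j). ice_elem (incoming h v i j)) ({1..2*n} \<times> {1..mu 1})}"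

definition row_count :: "nat \<Rightarrow> ice_matrix \<Rightarrow> ice set \<Rightarrow> nat \<Rightarrow> nat" where
  "row_count m CM S i = card {j \<in> {1..m}. CM (i, j) \<in> S}"

definition ns_count :: "nat \<Rightarrow> nat \<Rightarrow> ice_matrix \<Rightarrow> nat" where
  "ns_count n m CM = (\<Sum>i=1..2*n. row_count m CM {NS} i)"

definition ne_odd :: "nat \<Rightarrow> nat \<Rightarrow> ice_matrix \<Rightarrow> nat" where
  "ne_odd n m CM = (\<Sum>i | i \<in> {1..2*n} \<and> odd i. row_count m CM {NE} i)"

definition se_even :: "nat \<Rightarrow> nat \<Rightarrow> ice_matrix \<Rightarrow> nat" where
  "se_even n m CM = (\<Sum>i | i \<in> {1..2*n} \<and> even i. row_count m CM {SE} i)"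

definition wgt_even :: "nat \<Rightarrow> nat \<Rightarrow> ice_matrix \<Rightarrow> nat" where
  "wgt_even n m CM = (\<Sum>i | i \<in> {1..2*n} \<and> even i. row_count m CM {NE, SE, WE} i)"

definition ice_wgt :: "nat \<Rightarrow> nat \<Rightarrow> ice_matrix \<Rightarrow> laurent" where
  "ice_wgt n m CM =
    (\<Prod>k=1..n. X k (int (row_count m CM {NE, SE, WE} (2*n + 1 - 2*k))
                 - int (row_count m CM {NE, SE, WE} (2*n + 2 - 2*k))))"

end

theory Submission
  imports Defs "Jordan_Normal_Form.Determinant"
begin

text \<open>Put $u_i = t^2/x_i$, $s_i = x_i + u_i$, and let $W_n(\mu) = \det(h_{\mu_j - 1}(x_i, u_i))$ with complete
  homogeneous $h$. Both sides of the identity are determined by branching rules that remove one variable: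
  two consecutive rows of ice, or the letters $n$ and $\overline n$. A row of either kind sums over interlacing
  sequences with weights that factor over the intervals, so by multilinearity it sends $\det(f_i(\mu_j))$ to
  $\det((S f_i)(\mu_j))$ for a first-order difference operator $S$; the particle that is lost contributes one
  further row. Two such operators act on $h(x_i, u_i)$ as division by $s_i - s_n$, up to an explicit factor and
  a multiple of the new row. Hence by induction, with $A_n = \prod_{i<j}(s_i - s_j)$, the tableau sum times $A_n$
  is $W_n(\lambda + \delta)$, the ice sum times $A_n$ is $D_{sp(2n)}\,W_n(\lambda + \delta)$, and $A_n$ cancels.\<close>

section \<open>Determinants of tables\<close>

text \<open>The ring has no division, and this shapes the statements: \<open>hsum\<close> replaces
  \<open>(x^a - u^a) / (x - u)\<close>, rows are multiplied by \<open>s_i - s_n\<close> rather than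
  divided, and \<open>vander\<close> stays on the left until a final cancellation. What makes this
  division possible is that \<open>x_i * u_i = t^2\<close> for every \<open>i\<close>: the sequences
  \<open>h(x_i, u_i)\<close> satisfy second-order recurrences that differ only in the middle
  coefficient \<open>s_i\<close>. For \<open>t = 1\<close> the determinant is the numerator of
  Weyl's formula for \<open>Sp(2n)\<close> with row \<open>i\<close> divided by
  \<open>x_i - 1/x_i\<close>. On the tableau side the staircase turns the ranges into disjoint
  half-open intervals. An ice row merges both kinds of half-open interval; an inner position
  receives both weights, and this is where \<open>1 + t\<close> comes from. The positions in an ice
  row must be distinct, whereas multilinearity asks for the full product of the closed intervals;
  the tuples added to fill it contribute zero, having equal columns or a part 0, where
  \<open>h\<close> vanishes. What remains is the left border, where a lost particle meets no vertex;
  a single factor \<open>t\<close> repairs that.\<close>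

abbreviation detf :: "nat \<Rightarrow> (nat \<Rightarrow> nat \<Rightarrow> 'a::comm_ring_1) \<Rightarrow> 'a" where
  "detf n M \<equiv> det (mat n n (\<lambda>(i, j). M i j))"

(* Finite sequences are zero-padded functions: position j < n of a tuple is the (j+1)-st part. *)
definition tuples :: "nat \<Rightarrow> (nat \<Rightarrow> nat set) \<Rightarrow> (nat \<Rightarrow> nat) set" where
  "tuples n I = {b. (\<forall>j<n. b j \<in> I j) \<and> (\<forall>j\<ge>n. b j = 0)}"

lemma tuples_cong: "(\<And>j. j < n \<Longrightarrow> I j = J j) \<Longrightarrow> tuples n I = tuples n J"
  by (auto simp: tuples_def)

lemma bij_betw_tuples:
  "bij_betw (\<lambda>b j. if j < n then b j else 0) (PiE {..<n} I) (tuples n I)"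
  by (rule bij_betw_byWitness[where f' = "\<lambda>b. restrict b {..<n}"])
    (auto simp: tuples_def PiE_def extensional_def fun_eq_iff)

lemma finite_tuples: "(\<And>j. j < n \<Longrightarrow> finite (I j)) \<Longrightarrow> finite (tuples n I)"
  using bij_betw_finite[OF bij_betw_tuples, of n I] finite_PiE[of "{..<n}" I] by auto

text \<open>Beyond \<open>K\<close> the upper bound \<open>a j = 0\<close> already forces the
  padding, so the finite product range and the condition at all indices agree.\<close>

lemma tuples_interlacing:
  assumes "\<And>j. K \<le> j \<Longrightarrow> a j = 0"
  shows "b \<in> tuples K (\<lambda>j. {a (Suc j)..a j}) \<longleftrightarrow> (\<forall>j. a (Suc j) \<le> b j \<and> b j \<le> a j)"
proof
  assume b: "b \<in> tuples K (\<lambda>j. {a (Suc j)..a j})"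
  have "a (Suc j) \<le> b j \<and> b j \<le> a j" for j
    using b assms[of "Suc j"] by (cases "j < K") (auto simp: tuples_def)
  then show "\<forall>j. a (Suc j) \<le> b j \<and> b j \<le> a j" by blast
next
  assume b: "\<forall>j. a (Suc j) \<le> b j \<and> b j \<le> a j"
  then have "b j = 0" if "K \<le> j" for j using assms[OF that] by (metis le_zero_eq)
  then show "b \<in> tuples K (\<lambda>j. {a (Suc j)..a j})" using b by (auto simp: tuples_def)
qed

lemma detf_cong: "(\<And>i j. i < n \<Longrightarrow> j < n \<Longrightarrow> M i j = N i j) \<Longrightarrow> detf n M = detf n N"
  by (rule arg_cong[of _ _ det]) (auto intro!: eq_matI)

text \<open>Each summation variable \<open>b j\<close> occurs in one column only, and in the Leibniz
  expansion every permutation term is a product over columns, so its sum over the product range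
  factors. This turns the sum over one row of a configuration back into a single
  determinant.\<close>

lemma detf_sum_columns:
  assumes fin: "\<And>j. j < n \<Longrightarrow> finite (I j)"
  shows "(\<Sum>b\<in>tuples n I. (\<Prod>j<n. w j (b j)) * detf n (\<lambda>i j. f i (b j)))
    = detf n (\<lambda>i j. \<Sum>y\<in>I j. w j y * f i y)"
proof -
  let ?P = "{p. p permutes {0..<n}}"
  have exp: "detf n M = (\<Sum>p\<in>?P. signof p * (\<Prod>j<n. M (p j) j))" for M :: "nat \<Rightarrow> nat \<Rightarrow> 'a"
  proof -
    have "(\<Prod>j<n. mat n n (\<lambda>(i, j). M i j) $$ (p j, j)) = (\<Prod>j<n. M (p j) j)"
      if p: "p permutes {0..<n}" for p
    proof (rule prod.cong)
      fix j assume "j \<in> {..<n}"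
      moreover from this have "p j < n" using permutes_in_image[OF p, of j] by simp
      ultimately show "mat n n (\<lambda>(i, j). M i j) $$ (p j, j) = M (p j) j" by simp
    qed simp
    then show ?thesis
      by (subst det_col[OF mat_carrier]) (rule sum.cong, simp_all only: mem_Collect_eq)
  qed
  let ?F = "\<lambda>b. (\<Prod>j<n. w j (b j)) * detf n (\<lambda>i j. f i (b j))"
  have "(\<Sum>b\<in>tuples n I. ?F b) = (\<Sum>b\<in>PiE {..<n} I. ?F (\<lambda>j. if j < n then b j else 0))"
    by (rule sum.reindex_bij_betw[OF bij_betw_tuples, symmetric])
  also have "\<dots> = (\<Sum>b\<in>PiE {..<n} I. ?F b)"
  proof (rule sum.cong[OF refl])
    fix b
    have "detf n (\<lambda>i j. f i (if j < n then b j else 0)) = detf n (\<lambda>i j. f i (b j))"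
      by (rule detf_cong) simp
    then show "?F (\<lambda>j. if j < n then b j else 0) = ?F b" by simp
  qed
  also have "\<dots> = (\<Sum>b\<in>PiE {..<n} I. \<Sum>p\<in>?P. signof p * (\<Prod>j<n. w j (b j) * f (p j) (b j)))"
    by (simp add: exp sum_distrib_left prod.distrib mult_ac)
  also have "\<dots> = (\<Sum>p\<in>?P. signof p * (\<Sum>b\<in>PiE {..<n} I. \<Prod>j<n. w j (b j) * f (p j) (b j)))"
    by (subst sum.swap) (simp add: sum_distrib_left)
  also have "\<dots> = (\<Sum>p\<in>?P. signof p * (\<Prod>j<n. \<Sum>y\<in>I j. w j y * f (p j) y))"
    using fin by (subst prod_sum_PiE) auto
  also have "\<dots> = detf n (\<lambda>i j. \<Sum>y\<in>I j. w j y * f i y)"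
    by (simp add: exp)
  finally show ?thesis .
qed

lemma detf_equal_columns:
  assumes "j < n" "k < n" "j \<noteq> k" "\<And>i. i < n \<Longrightarrow> M i j = M i k"
  shows "detf n M = 0"
  by (rule det_identical_columns[of _ n j k]) (use assms in \<open>auto intro!: eq_vecI\<close>)

lemma detf_zero_column:
  assumes "k < n" "\<And>i. i < n \<Longrightarrow> M i k = 0"
  shows "detf n M = 0"
  by (subst laplace_expansion_column[of _ n k]) (use assms in auto)

lemma detf_expand_row:
  assumes "\<And>j. j < n \<Longrightarrow> M n j = 0"
  shows "detf (Suc n) M = detf n M * M n n"
proof -
  have "mat_delete (mat (Suc n) (Suc n) (\<lambda>(i, j). M i j)) n n = mat n n (\<lambda>(i, j). M i j)"
    by (auto intro!: eq_matI simp: mat_delete_def)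
  then show ?thesis
    using assms by (subst laplace_expansion_row[of _ "Suc n" n]) (auto simp: cofactor_def)
qed

lemma prod_list_diag_detf: "prod_list (diag_mat (mat n n (\<lambda>(i, j). M i j))) = (\<Prod>i<n. M i i)"
  by (simp add: prod_list_diag_prod atLeast0LessThan)

lemma detf_mult: "detf n M * detf n N = detf n (\<lambda>i j. \<Sum>k<n. M i k * N k j)"
proof -
  have "mat n n (\<lambda>(i, j). M i j) * mat n n (\<lambda>(i, j). N i j) = mat n n (\<lambda>(i, j). \<Sum>k<n. M i k * N k j)"
    by (auto intro!: eq_matI sum.cong simp: scalar_prod_def)
  then show ?thesis by (metis det_mult mat_carrier)
qed

text \<open>Right multiplication by a unit lower bidiagonal matrix: every column is altered at once
  by its original right neighbour.\<close>

lemma detf_column_ops: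
  "detf n (\<lambda>i j. M i j - (if Suc j < n then c j * M i (Suc j) else 0)) = detf n M"
proof -
  define U where "U k j = (if k = j then 1 else if k = Suc j then - c j else 0)" for k j
  have "detf n U = (\<Prod>i<n. U i i)"
    by (subst det_lower_triangular[of n]) (auto simp: U_def prod_list_diag_detf)
  then have "detf n U = 1" by (simp add: U_def)
  then have "detf n M = detf n (\<lambda>i j. \<Sum>k<n. M i k * U k j)"
    using detf_mult[of n M U] by simp
  also have "\<dots> = detf n (\<lambda>i j. M i j - (if Suc j < n then c j * M i (Suc j) else 0))"
  proof (rule detf_cong)
    fix i j assume "i < n" "j < n"
    have "(\<Sum>k<n. M i k * U k j)
        = (\<Sum>k<n. (if k = j then M i j else 0) - (if k = Suc j then c j * M i (Suc j) else 0))"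
      by (rule sum.cong) (auto simp: U_def)
    then show "(\<Sum>k<n. M i k * U k j) = M i j - (if Suc j < n then c j * M i (Suc j) else 0)"
      using \<open>j < n\<close> by (simp add: sum_subtractf)
  qed
  finally show ?thesis by simp
qed

text \<open>Left multiplication by a triangular matrix that differs from a diagonal one in the last
  column only. With \<open>d = 0\<close> it scales rows, with general \<open>d\<close> it discards
  multiples of the last row; the two uses together stand in for a division.\<close>

lemma detf_row_ops:
  "detf (Suc n) (\<lambda>i j. if i < n then c i * M i j + d i * M n j else M n j)
    = (\<Prod>i<n. c i) * detf (Suc n) M"
proof -
  define L where "L i k = (if i = k then if i < n then c i else 1 else if k = n \<and> i < n then d i else 0)" for i k
  have "detf (Suc n) L = (\<Prod>i<Suc n. L i i)"
    by (subst det_upper_triangular[of _ "Suc n"]) (auto simp: L_def prod_list_diag_detf upper_triangular_def)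
  then have "(\<Prod>i<n. c i) * detf (Suc n) M = detf (Suc n) (\<lambda>i j. \<Sum>k<Suc n. L i k * M k j)"
    using detf_mult[of "Suc n" L M] by (simp add: L_def)
  also have "\<dots> = detf (Suc n) (\<lambda>i j. if i < n then c i * M i j + d i * M n j else M n j)"
  proof (rule detf_cong)
    fix i j assume "i < Suc n" "j < Suc n"
    have "(\<Sum>k<n. L i k * M k j) = (\<Sum>k<n. if k = i then c i * M i j else 0)"
      by (rule sum.cong) (auto simp: L_def)
    then show "(\<Sum>k<Suc n. L i k * M k j) = (if i < n then c i * M i j + d i * M n j else M n j)"
      using \<open>i < Suc n\<close> by (auto simp: L_def less_Suc_eq)
  qed
  finally show ?thesis by simp
qed

text \<open>Read from right to left: \<open>n + 1\<close> parts give a matrix with one more column,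
  and the same column operations that form the differences clear the new row up to its last entry.
  So the particle lost in a row of ice, or the row of cells lost with a barred letter, reappears as
  a row of the determinant.\<close>

lemma detf_append_geometric_row:
  assumes "\<And>j. j < n \<Longrightarrow> h j = c j * h (Suc j)"
  shows "detf n (\<lambda>i j. G i j - c j * G i (Suc j)) * h n
    = detf (Suc n) (\<lambda>i j. if i < n then G i j else h j)"
proof -
  let ?M = "\<lambda>i j. if i < n then G i j else h j"
  have "detf (Suc n) ?M
      = detf (Suc n) (\<lambda>i j. ?M i j - (if Suc j < Suc n then c j * ?M i (Suc j) else 0))"
    by (rule detf_column_ops[symmetric])
  also have "\<dots> = detf n (\<lambda>i j. ?M i j - (if Suc j < Suc n then c j * ?M i (Suc j) else 0)) * h n"
    by (subst detf_expand_row) (use assms in auto)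
  also have "detf n (\<lambda>i j. ?M i j - (if Suc j < Suc n then c j * ?M i (Suc j) else 0))
      = detf n (\<lambda>i j. G i j - c j * G i (Suc j))"
    by (rule detf_cong) auto
  finally show ?thesis by simp
qed

text \<open>The case without loss: the column beyond the last part vanishes, so the differences are
  plain column operations.\<close>

lemma detf_row_last_zero:
  assumes "\<And>i. i < n \<Longrightarrow> G i n = 0"
  shows "detf n (\<lambda>i j. G i j - c j * G i (Suc j)) = detf n G"
proof -
  have "detf n (\<lambda>i j. G i j - c j * G i (Suc j))
      = detf n (\<lambda>i j. G i j - (if Suc j < n then c j * G i (Suc j) else 0))"
  proof (rule detf_cong)
    fix i j assume "i < n" "j < n"
    then show "G i j - c j * G i (Suc j) = G i j - (if Suc j < n then c j * G i (Suc j) else 0)"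
      using assms[of i] by (cases "Suc j = n") auto
  qed
  then show ?thesis by (simp add: detf_column_ops)
qed


section \<open>Row operators\<close>

(* (row_op z \<beta> \<alpha> f)(a) = \<Sum>y\<le>a. \<beta> z^(a-y) f(y) + \<Sum>y<a. \<alpha> z^(a-1-y) f(y), except that f(0) is left out of the first
   sum. The differences below are the column sums produced by one row of ice or one letter. *)
fun row_op :: "'a::comm_ring_1 \<Rightarrow> 'a \<Rightarrow> 'a \<Rightarrow> (nat \<Rightarrow> 'a) \<Rightarrow> nat \<Rightarrow> 'a" where
  "row_op z \<beta> \<alpha> f 0 = 0"
| "row_op z \<beta> \<alpha> f (Suc y) = z * row_op z \<beta> \<alpha> f y + \<beta> * f (Suc y) + \<alpha> * f y"

text \<open>The sum over an interval is a difference of two prefix sums, the second one scaled by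
  \<open>z ^ (a - b)\<close>. When \<open>a\<close> and \<open>b\<close> are neighbouring parts this
  is a column difference, which the determinant absorbs.\<close>

lemma sum_row_op_right:
  assumes "b \<le> a"
  shows "(\<Sum>y\<in>{b<..a}. z ^ (a - y) * f y) = row_op z 1 0 f a - z ^ (a - b) * row_op z 1 0 f b"
  using assms
proof (induction a rule: dec_induct)
  case (step m)
  have "{b<..Suc m} = insert (Suc m) {b<..m}" using step.hyps by auto
  then have "(\<Sum>y\<in>{b<..Suc m}. z ^ (Suc m - y) * f y) = f (Suc m) + (\<Sum>y\<in>{b<..m}. z ^ (Suc m - y) * f y)"
    by simp
  also have "(\<Sum>y\<in>{b<..m}. z ^ (Suc m - y) * f y) = z * (\<Sum>y\<in>{b<..m}. z ^ (m - y) * f y)"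
    unfolding sum_distrib_left by (rule sum.cong) (auto simp: Suc_diff_le)
  finally show ?case unfolding step.IH
    using step.hyps by (simp add: Suc_diff_le algebra_simps)
qed simp

lemma sum_row_op_left:
  assumes "b \<le> a"
  shows "(\<Sum>y\<in>{b..<a}. z ^ (a - 1 - y) * f y) = row_op z 0 1 f a - z ^ (a - b) * row_op z 0 1 f b"
  using assms
proof (induction a rule: dec_induct)
  case (step m)
  have "(\<Sum>y\<in>{b..<Suc m}. z ^ (Suc m - 1 - y) * f y) = f m + (\<Sum>y\<in>{b..<m}. z ^ (m - y) * f y)"
    using step.hyps by simp
  also have "(\<Sum>y\<in>{b..<m}. z ^ (m - y) * f y) = z * (\<Sum>y\<in>{b..<m}. z ^ (m - 1 - y) * f y)"
    unfolding sum_distrib_left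
  proof (rule sum.cong)
    fix y assume "y \<in> {b..<m}"
    then have "m - y = Suc (m - 1 - y)" by auto
    then show "z ^ (m - y) * f y = z * (z ^ (m - 1 - y) * f y)" by simp
  qed simp
  finally show ?case unfolding step.IH
    using step.hyps by (simp add: Suc_diff_le algebra_simps)
qed simp

text \<open>The weight of a particle that moves from \<open>a\<close> to \<open>y\<close>, the next
  particle to its left having stood at \<open>b\<close>. Odd rows have \<open>z = x\<close> and
  \<open>\<alpha> = t * x\<close>, even rows \<open>z = t^2 / x\<close> and
  \<open>\<alpha> = t / x\<close>; in both cases \<open>z + \<alpha>\<close> contains the factor
  \<open>1 + t\<close> of an NS vertex.\<close>

definition ice_step_wgt :: "'a::comm_ring_1 \<Rightarrow> 'a \<Rightarrow> nat \<Rightarrow> nat \<Rightarrow> nat \<Rightarrow> 'a" where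
  "ice_step_wgt z \<alpha> a b y = (if y = a then 1 else z ^ (a - 1 - y) * (if y = b then \<alpha> else z + \<alpha>))"

text \<open>The weight is \<open>z ^ (a - y)\<close> on \<open>{b<..a}\<close> plus
  \<open>\<alpha> * z ^ (a - 1 - y)\<close> on \<open>{b..<a}\<close>; the overlap of the two ranges
  yields \<open>z + \<alpha>\<close>.\<close>

lemma sum_row_op_ice:
  assumes "b < a"
  shows "(\<Sum>y\<in>{b..a}. ice_step_wgt z \<alpha> a b y * f y)
    = row_op z 1 \<alpha> f a - z ^ (a - b) * row_op z 1 \<alpha> f b"
proof -
  have "Suc b \<le> a" using assms by simp
  then show ?thesis
  proof (induction a rule: dec_induct)
    case base
    have "{b..Suc b} = {b, Suc b}" by auto
    then show ?case by (simp add: ice_step_wgt_def algebra_simps)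
  next
    case (step m)
    \<comment> \<open>Growing the interval turns its former right end \<open>m\<close> into an inner
      point, so that point is split off; all lower points merely gain a factor
      \<open>z\<close>.\<close>
    have "(\<Sum>y\<in>{b..Suc m}. ice_step_wgt z \<alpha> (Suc m) b y * f y)
        = f (Suc m) + (z + \<alpha>) * f m + (\<Sum>y\<in>{b..<m}. ice_step_wgt z \<alpha> (Suc m) b y * f y)"
      using step.hyps by (simp add: ice_step_wgt_def flip: atLeastLessThanSuc_atLeastAtMost)
    also have "(\<Sum>y\<in>{b..<m}. ice_step_wgt z \<alpha> (Suc m) b y * f y)
        = z * (\<Sum>y\<in>{b..<m}. ice_step_wgt z \<alpha> m b y * f y)"
      unfolding sum_distrib_left
    proof (rule sum.cong)
      fix y assume y: "y \<in> {b..<m}"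
      then have "m - y = Suc (m - 1 - y)" by auto
      then have "z ^ (m - y) = z * z ^ (m - 1 - y)" by simp
      then show "ice_step_wgt z \<alpha> (Suc m) b y * f y = z * (ice_step_wgt z \<alpha> m b y * f y)"
        using y by (auto simp: ice_step_wgt_def mult_ac)
    qed simp
    also have "(\<Sum>y\<in>{b..<m}. ice_step_wgt z \<alpha> m b y * f y)
        = (\<Sum>y\<in>{b..m}. ice_step_wgt z \<alpha> m b y * f y) - f m"
      using step.hyps by (simp add: ice_step_wgt_def flip: atLeastLessThanSuc_atLeastAtMost)
    finally have "(\<Sum>y\<in>{b..Suc m}. ice_step_wgt z \<alpha> (Suc m) b y * f y)
        = f (Suc m) + (z + \<alpha>) * f m
          + z * (row_op z 1 \<alpha> f m - z ^ (m - b) * row_op z 1 \<alpha> f b - f m)"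
      by (simp only: step.IH)
    then show ?case using step.hyps by (simp add: Suc_diff_le algebra_simps)
  qed
qed

text \<open>Shift minus \<open>z\<close> undoes \<open>row_op z\<close> up to the terms in
  \<open>\<beta>\<close> and \<open>\<alpha>\<close>. Doing this for both operators leaves a
  recurrence with characteristic roots \<open>x\<close> and \<open>u\<close>, forced by three
  consecutive values of \<open>f\<close>.\<close>

lemma row_op_twice:
  "row_op x \<beta>\<^sub>1 \<alpha>\<^sub>1 (row_op u \<beta>\<^sub>2 \<alpha>\<^sub>2 f) (Suc (Suc a))
    = (x + u) * row_op x \<beta>\<^sub>1 \<alpha>\<^sub>1 (row_op u \<beta>\<^sub>2 \<alpha>\<^sub>2 f) (Suc a)
      - x * u * row_op x \<beta>\<^sub>1 \<alpha>\<^sub>1 (row_op u \<beta>\<^sub>2 \<alpha>\<^sub>2 f) a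
      + \<beta>\<^sub>1 * \<beta>\<^sub>2 * f (Suc (Suc a)) + (\<beta>\<^sub>1 * \<alpha>\<^sub>2 + \<alpha>\<^sub>1 * \<beta>\<^sub>2) * f (Suc a) + \<alpha>\<^sub>1 * \<alpha>\<^sub>2 * f a"
  by (simp add: algebra_simps)

(* (p^a - q^a) / (p - q), the complete homogeneous polynomial of degree a - 1. *)
fun hsum :: "'a::comm_ring_1 \<Rightarrow> 'a \<Rightarrow> nat \<Rightarrow> 'a" where
  "hsum p q 0 = 0"
| "hsum p q (Suc a) = p * hsum p q a + q ^ a"

lemma hsum_rec: "hsum p q (Suc (Suc a)) = (p + q) * hsum p q (Suc a) - p * q * hsum p q a"
  by (simp add: algebra_simps)

text \<open>Because \<open>p * q = x * u\<close>, the recurrence with roots \<open>x\<close>,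
  \<open>u\<close> applied to \<open>hsum p q\<close> leaves exactly
  \<open>(p + q) - (x + u)\<close> times its middle value. Hence \<open>\<kappa> * hsum p q\<close>
  is a particular solution for the scaled \<open>Q\<close>; what is left solves the homogeneous
  recurrence and vanishes at 0, so it is a multiple of \<open>hsum x u\<close>.\<close>

lemma resolvent_hsum:
  assumes "Q 0 = 0"
    and rec: "\<And>a. Q (Suc (Suc a)) = (x + u) * Q (Suc a) - x * u * Q a + \<kappa> * hsum p q (Suc a)"
    and pq: "p * q = x * u"
  shows "\<exists>d. \<forall>a. ((p + q) - (x + u)) * Q a = \<kappa> * hsum p q a + d * hsum x u a"
proof
  \<comment> \<open>Forced by the value at 1, where both \<open>hsum p q\<close> and
    \<open>hsum x u\<close> are 1.\<close>
  define d where "d = ((p + q) - (x + u)) * Q 1 - \<kappa>"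
  show "\<forall>a. ((p + q) - (x + u)) * Q a = \<kappa> * hsum p q a + d * hsum x u a"
  proof
    fix a
    have "((p + q) - (x + u)) * Q a = \<kappa> * hsum p q a + d * hsum x u a \<and>
      ((p + q) - (x + u)) * Q (Suc a) = \<kappa> * hsum p q (Suc a) + d * hsum x u (Suc a)"
    proof (induction a)
      case 0
      show ?case using assms(1) by (simp add: d_def)
    next
      case (Suc a)
      have "((p + q) - (x + u)) * Q (Suc (Suc a))
        = (x + u) * (((p + q) - (x + u)) * Q (Suc a)) - x * u * (((p + q) - (x + u)) * Q a)
          + ((p + q) - (x + u)) * (\<kappa> * hsum p q (Suc a))"
        by (simp only: rec) (simp add: algebra_simps)
      also have "\<dots> = (x + u) * (\<kappa> * hsum p q (Suc a) + d * hsum x u (Suc a))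
          - x * u * (\<kappa> * hsum p q a + d * hsum x u a)
          + ((p + q) - (x + u)) * (\<kappa> * hsum p q (Suc a))"
        using Suc by simp
      also have "\<dots> = \<kappa> * ((p + q) * hsum p q (Suc a) - x * u * hsum p q a)
          + d * ((x + u) * hsum x u (Suc a) - x * u * hsum x u a)"
        by (simp add: algebra_simps)
      also have "\<dots> = \<kappa> * hsum p q (Suc (Suc a)) + d * hsum x u (Suc (Suc a))"
        by (simp only: hsum_rec pq)
      finally show ?case using Suc by blast
    qed
    then show "((p + q) - (x + u)) * Q a = \<kappa> * hsum p q a + d * hsum x u a" by blast
  qed
qed

text \<open>The unknown multiples \<open>d i\<close> of \<open>hsum (x k) (u k)\<close> are
  multiples of the last row and disappear, so nothing about them beyond existence enters the
  result.\<close>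

lemma detf_resolvent:
  assumes Q0: "\<And>i. i < k \<Longrightarrow> Q i 0 = 0"
    and rec: "\<And>i a. i < k \<Longrightarrow>
      Q i (Suc (Suc a)) = (x k + u k) * Q i (Suc a) - x k * u k * Q i a + \<kappa> i * hsum (x i) (u i) (Suc a)"
    and xu: "\<And>i. i < k \<Longrightarrow> x i * u i = x k * u k"
  shows "(\<Prod>i<k. (x i + u i) - (x k + u k))
      * detf (Suc k) (\<lambda>i j. if i < k then Q i (a j) else hsum (x k) (u k) (a j))
    = (\<Prod>i<k. \<kappa> i) * detf (Suc k) (\<lambda>i j. hsum (x i) (u i) (a j))"
proof -
  have "\<forall>i\<in>{..<k}. \<exists>d. \<forall>a. ((x i + u i) - (x k + u k)) * Q i a
      = \<kappa> i * hsum (x i) (u i) a + d * hsum (x k) (u k) a"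
    using Q0 rec xu by (auto intro!: resolvent_hsum)
  from bchoice[OF this] obtain d where d: "\<And>i a. i < k \<Longrightarrow> ((x i + u i) - (x k + u k)) * Q i a
      = \<kappa> i * hsum (x i) (u i) a + d i * hsum (x k) (u k) a"
    by auto
  let ?M = "\<lambda>i j. if i < k then Q i (a j) else hsum (x k) (u k) (a j)"
  let ?N = "\<lambda>i j. hsum (x i) (u i) (a j)"
  have "(\<Prod>i<k. (x i + u i) - (x k + u k)) * detf (Suc k) ?M
      = detf (Suc k) (\<lambda>i j. if i < k then ((x i + u i) - (x k + u k)) * ?M i j + 0 * ?M k j else ?M k j)"
    by (rule detf_row_ops[symmetric])
  also have "\<dots> = detf (Suc k) (\<lambda>i j. if i < k then \<kappa> i * ?N i j + d i * ?N k j else ?N k j)"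
    by (rule detf_cong) (simp add: d)
  also have "\<dots> = (\<Prod>i<k. \<kappa> i) * detf (Suc k) ?N"
    by (rule detf_row_ops)
  finally show ?thesis .
qed

section \<open>One branching step of each model, on the level of determinants\<close>

lemma hsum_rec_pair:
  "hsum p q (Suc (Suc a)) + p * q * hsum p q a = (p + q) * hsum p q (Suc a)"
  by (simp add: algebra_simps)

text \<open>This closes the induction: the second operator turns the appended geometric row with
  ratio \<open>u\<close> into \<open>hsum x u\<close>, the row that belongs to the new variable. The
  truncated exponent at \<open>y = 0\<close> is harmless, since there the value is multiplied by
  0.\<close>

lemma row_op_geometric_shift: "row_op x 1 0 (\<lambda>y. u ^ (y - 1)) a = hsum x u a"
  by (induction a) auto

lemma row_op_geometric: "row_op x 1 \<alpha> (\<lambda>y. u ^ y) a = (u + \<alpha>) * hsum x u a"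
  by (induction a) (auto simp: algebra_simps)

text \<open>The outer sum belongs to the unbarred letter, the inner one to the barred letter, and
  \<open>u k ^ (b k - 1)\<close> is the last row of cells, removed with the barred letter. Of the
  forcing terms in \<open>row_op_twice\<close> only the middle one survives, with coefficient 1, so
  \<open>\<kappa> = 1\<close>.\<close>

lemma tableau_det_step:
  fixes x u :: "nat \<Rightarrow> 'a::comm_ring_1"
  assumes xu: "\<And>i. i < k \<Longrightarrow> x i * u i = x k * u k"
    and a: "\<And>j. j \<le> k \<Longrightarrow> a (Suc j) < a j" "a (Suc k) = 0"
  shows "(\<Prod>i<k. (x i + u i) - (x k + u k)) *
      (\<Sum>b\<in>tuples (Suc k) (\<lambda>j. {a (Suc j)<..a j}). (\<Prod>j<Suc k. x k ^ (a j - b j)) *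
        (u k ^ (b k - 1) *
          (\<Sum>c\<in>tuples k (\<lambda>j. {b (Suc j)..<b j}). (\<Prod>j<k. u k ^ (b j - 1 - c j)) *
            detf k (\<lambda>i j. hsum (x i) (u i) (c j)))))
    = detf (Suc k) (\<lambda>i j. hsum (x i) (u i) (a j))"
proof -
  define G where "G i = row_op (u k) 0 1 (hsum (x i) (u i))" for i
  \<comment> \<open>With the geometric row included, the inner sum is one determinant in
    \<open>b\<close>, and multilinearity applies a second time.\<close>
  define f where "f i = (if i < k then G i else (\<lambda>y. u k ^ (y - 1)))" for i
  have inner: "u k ^ (b k - 1) * (\<Sum>c\<in>tuples k (\<lambda>j. {b (Suc j)..<b j}). (\<Prod>j<k. u k ^ (b j - 1 - c j)) *
            detf k (\<lambda>i j. hsum (x i) (u i) (c j))) = detf (Suc k) (\<lambda>i j. f i (b j))"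
    if b: "b \<in> tuples (Suc k) (\<lambda>j. {a (Suc j)<..a j})" for b
  proof -
    have pos: "1 \<le> b j" if "j \<le> k" for j
      using b that by (force simp: tuples_def less_Suc_eq_le)
    have dec: "b (Suc j) \<le> b j" if "j < k" for j
    proof -
      have "b (Suc j) \<le> a (Suc j)" "a (Suc j) < b j" using b that by (auto simp: tuples_def)
      then show ?thesis by simp
    qed
    have "(\<Sum>c\<in>tuples k (\<lambda>j. {b (Suc j)..<b j}). (\<Prod>j<k. u k ^ (b j - 1 - c j)) *
            detf k (\<lambda>i j. hsum (x i) (u i) (c j)))
        = detf k (\<lambda>i j. \<Sum>y\<in>{b (Suc j)..<b j}. u k ^ (b j - 1 - y) * hsum (x i) (u i) y)"
      by (rule detf_sum_columns) simp
    also have "\<dots> = detf k (\<lambda>i j. G i (b j) - u k ^ (b j - b (Suc j)) * G i (b (Suc j)))"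
      by (rule detf_cong) (simp only: G_def sum_row_op_left[OF dec])
    finally have sum_eq: "(\<Sum>c\<in>tuples k (\<lambda>j. {b (Suc j)..<b j}). (\<Prod>j<k. u k ^ (b j - 1 - c j)) *
            detf k (\<lambda>i j. hsum (x i) (u i) (c j)))
        = detf k (\<lambda>i j. G i (b j) - u k ^ (b j - b (Suc j)) * G i (b (Suc j)))" .
    have "detf k (\<lambda>i j. G i (b j) - u k ^ (b j - b (Suc j)) * G i (b (Suc j))) * u k ^ (b k - 1) = detf (Suc k) (\<lambda>i j. if i < k then G i (b j) else u k ^ (b j - 1))"
    proof (rule detf_append_geometric_row[where h = "\<lambda>j. u k ^ (b j - 1)"])
      fix j assume "j < k"
      \<comment> \<open>Positivity of \<open>b (Suc j)\<close> keeps the truncated subtraction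
        exact.\<close>
      then have "b j - 1 = (b j - b (Suc j)) + (b (Suc j) - 1)" using pos[of "Suc j"] dec[of j] by simp
      then show "u k ^ (b j - 1) = u k ^ (b j - b (Suc j)) * u k ^ (b (Suc j) - 1)"
        by (simp only: power_add)
    qed
    also have "\<dots> = detf (Suc k) (\<lambda>i j. f i (b j))" by (rule detf_cong) (simp add: f_def)
    finally show ?thesis unfolding sum_eq by (simp only: mult.commute)
  qed
  have "(\<Sum>b\<in>tuples (Suc k) (\<lambda>j. {a (Suc j)<..a j}). (\<Prod>j<Suc k. x k ^ (a j - b j)) *
        detf (Suc k) (\<lambda>i j. f i (b j)))
      = detf (Suc k) (\<lambda>i j. \<Sum>y\<in>{a (Suc j)<..a j}. x k ^ (a j - y) * f i y)"
    by (rule detf_sum_columns) simp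
  also have "\<dots> = detf (Suc k) (\<lambda>i j. row_op (x k) 1 0 (f i) (a j)
      - x k ^ (a j - a (Suc j)) * row_op (x k) 1 0 (f i) (a (Suc j)))"
    by (rule detf_cong) (simp only: sum_row_op_right a less_imp_le less_Suc_eq_le)
  also have "\<dots> = detf (Suc k) (\<lambda>i j. row_op (x k) 1 0 (f i) (a j))"
    by (rule detf_row_last_zero) (simp add: a)
  also have "\<dots> = detf (Suc k) (\<lambda>i j. if i < k then row_op (x k) 1 0 (G i) (a j) else hsum (x k) (u k) (a j))"
  proof (rule detf_cong)
    fix i j
    show "row_op (x k) 1 0 (f i) (a j) = (if i < k then row_op (x k) 1 0 (G i) (a j) else hsum (x k) (u k) (a j))"
      unfolding f_def by (cases "i < k") (simp_all only: if_True if_False row_op_geometric_shift)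
  qed
  finally have outer: "(\<Sum>b\<in>tuples (Suc k) (\<lambda>j. {a (Suc j)<..a j}). (\<Prod>j<Suc k. x k ^ (a j - b j)) *
        detf (Suc k) (\<lambda>i j. f i (b j)))
      = detf (Suc k) (\<lambda>i j. if i < k then row_op (x k) 1 0 (G i) (a j) else hsum (x k) (u k) (a j))" .
  have "(\<Prod>i<k. (x i + u i) - (x k + u k)) *
      detf (Suc k) (\<lambda>i j. if i < k then row_op (x k) 1 0 (G i) (a j) else hsum (x k) (u k) (a j))
      = (\<Prod>i<k. 1) * detf (Suc k) (\<lambda>i j. hsum (x i) (u i) (a j))"
    using xu by (intro detf_resolvent)
      (simp_all add: G_def row_op_twice del: row_op.simps(2) hsum.simps(2))
  then show ?thesis unfolding outer[symmetric] by (simp only: inner prod.neutral_const mult_1 cong: sum.cong)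
qed

(* The value b k = 0 is allowed in the outer sum and encodes a particle lost in the odd row; the
   inner sum over c may be extended to all interlacing tuples because a repeated or zero part
   makes the determinant vanish. *)
lemma ice_det_step:
  fixes x xi u :: "nat \<Rightarrow> 'a::comm_ring_1"
  assumes xxi: "\<And>i. i \<le> k \<Longrightarrow> x i * xi i = 1"
    and u: "\<And>i. i \<le> k \<Longrightarrow> u i = t\<^sup>2 * xi i"
    and a: "\<And>j. j \<le> k \<Longrightarrow> a (Suc j) < a j" "a (Suc k) = 0"
  shows "(\<Prod>i<k. (x i + u i) - (x k + u k)) *
      (\<Sum>b\<in>{b\<in>tuples (Suc k) (\<lambda>j. {a (Suc j)..a j}). \<forall>j<k. b (Suc j) < b j}.
        (\<Prod>j<Suc k. ice_step_wgt (x k) (t * x k) (a j) (a (Suc j)) (b j)) *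
        (u k ^ b k *
          (\<Sum>c\<in>{c\<in>tuples k (\<lambda>j. {b (Suc j)..b j}). \<forall>j<k. c (Suc j) < c j}.
            (\<Prod>j<k. ice_step_wgt (u k) (t * xi k) (b j) (b (Suc j)) (c j)) *
            detf k (\<lambda>i j. hsum (x i) (u i) (c j)))))
    = (u k + t * x k) * (\<Prod>i<k. x i + u i + t * (x k + xi k))
      * detf (Suc k) (\<lambda>i j. hsum (x i) (u i) (a j))"
proof -
  define G where "G i = row_op (u k) 1 (t * xi k) (hsum (x i) (u i))" for i
  define f where "f i = (if i < k then G i else (\<lambda>y. u k ^ y))" for i
  have fin: "finite (tuples n (\<lambda>j. {b (Suc j)..b j}))" for n and b :: "nat \<Rightarrow> nat"
    by (rule finite_tuples) simp
  have inner: "u k ^ b k * (\<Sum>c\<in>{c\<in>tuples k (\<lambda>j. {b (Suc j)..b j}). \<forall>j<k. c (Suc j) < c j}.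
            (\<Prod>j<k. ice_step_wgt (u k) (t * xi k) (b j) (b (Suc j)) (c j)) *
            detf k (\<lambda>i j. hsum (x i) (u i) (c j))) = detf (Suc k) (\<lambda>i j. f i (b j))"
    if dec: "\<And>j. j < k \<Longrightarrow> b (Suc j) < b j" for b
  proof -
    have "(\<Sum>c\<in>{c\<in>tuples k (\<lambda>j. {b (Suc j)..b j}). \<forall>j<k. c (Suc j) < c j}.
            (\<Prod>j<k. ice_step_wgt (u k) (t * xi k) (b j) (b (Suc j)) (c j)) *
            detf k (\<lambda>i j. hsum (x i) (u i) (c j)))
        = (\<Sum>c\<in>tuples k (\<lambda>j. {b (Suc j)..b j}).
            (\<Prod>j<k. ice_step_wgt (u k) (t * xi k) (b j) (b (Suc j)) (c j)) *
            detf k (\<lambda>i j. hsum (x i) (u i) (c j)))"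
    proof (rule sum.mono_neutral_left[OF fin])
      show "\<forall>c\<in>tuples k (\<lambda>j. {b (Suc j)..b j}) - {c\<in>tuples k (\<lambda>j. {b (Suc j)..b j}). \<forall>j<k. c (Suc j) < c j}.
        (\<Prod>j<k. ice_step_wgt (u k) (t * xi k) (b j) (b (Suc j)) (c j)) *
            detf k (\<lambda>i j. hsum (x i) (u i) (c j)) = 0"
      proof
        fix c assume "c \<in> tuples k (\<lambda>j. {b (Suc j)..b j}) - {c\<in>tuples k (\<lambda>j. {b (Suc j)..b j}). \<forall>j<k. c (Suc j) < c j}"
        then have c: "c \<in> tuples k (\<lambda>j. {b (Suc j)..b j})" and "\<exists>j<k. c j \<le> c (Suc j)"
          by (auto simp: not_less)
        then obtain j where j: "j < k" "c j \<le> c (Suc j)" by blast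
        have "detf k (\<lambda>i j. hsum (x i) (u i) (c j)) = 0"
        proof (cases "Suc j < k")
          case True
          have "c (Suc j) \<le> b (Suc j)" "b (Suc j) \<le> c j" using c j True by (auto simp: tuples_def)
          then have "c j = c (Suc j)" using j by simp
          then show ?thesis using j True by (intro detf_equal_columns[of j _ "Suc j"]) auto
        next
          case False
          then have "c (Suc j) = 0" using c by (auto simp: tuples_def)
          then show ?thesis using j by (intro detf_zero_column[of j]) auto
        qed
        then show "(\<Prod>j<k. ice_step_wgt (u k) (t * xi k) (b j) (b (Suc j)) (c j)) *
            detf k (\<lambda>i j. hsum (x i) (u i) (c j)) = 0" by simp
      qed
    qed auto
    also have "\<dots> = detf k (\<lambda>i j. \<Sum>y\<in>{b (Suc j)..b j}.
        ice_step_wgt (u k) (t * xi k) (b j) (b (Suc j)) y * hsum (x i) (u i) y)"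
      by (rule detf_sum_columns) simp
    also have "\<dots> = detf k (\<lambda>i j. G i (b j) - u k ^ (b j - b (Suc j)) * G i (b (Suc j)))"
      by (rule detf_cong) (simp only: G_def sum_row_op_ice[OF dec])
    finally have sum_eq: "(\<Sum>c\<in>{c\<in>tuples k (\<lambda>j. {b (Suc j)..b j}). \<forall>j<k. c (Suc j) < c j}.
            (\<Prod>j<k. ice_step_wgt (u k) (t * xi k) (b j) (b (Suc j)) (c j)) *
            detf k (\<lambda>i j. hsum (x i) (u i) (c j)))
        = detf k (\<lambda>i j. G i (b j) - u k ^ (b j - b (Suc j)) * G i (b (Suc j)))" .
    have "detf k (\<lambda>i j. G i (b j) - u k ^ (b j - b (Suc j)) * G i (b (Suc j))) * u k ^ b k = detf (Suc k) (\<lambda>i j. if i < k then G i (b j) else u k ^ b j)"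
      using dec by (intro detf_append_geometric_row[where h = "\<lambda>j. u k ^ b j"])
        (simp add: less_imp_le flip: power_add)
    also have "\<dots> = detf (Suc k) (\<lambda>i j. f i (b j))" by (rule detf_cong) (simp add: f_def)
    finally show ?thesis unfolding sum_eq by (simp only: mult.commute)
  qed
  have "(\<Sum>b\<in>{b\<in>tuples (Suc k) (\<lambda>j. {a (Suc j)..a j}). \<forall>j<k. b (Suc j) < b j}.
        (\<Prod>j<Suc k. ice_step_wgt (x k) (t * x k) (a j) (a (Suc j)) (b j)) *
        detf (Suc k) (\<lambda>i j. f i (b j)))
      = (\<Sum>b\<in>tuples (Suc k) (\<lambda>j. {a (Suc j)..a j}).
        (\<Prod>j<Suc k. ice_step_wgt (x k) (t * x k) (a j) (a (Suc j)) (b j)) *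
        detf (Suc k) (\<lambda>i j. f i (b j)))"
  \<comment> \<open>Only repeated parts are filled in here. A last part 0 was in the range from the
    start, and it counts: the appended row has the value 1 there.\<close>
  proof (rule sum.mono_neutral_left[OF fin])
    show "\<forall>b\<in>tuples (Suc k) (\<lambda>j. {a (Suc j)..a j})
        - {b\<in>tuples (Suc k) (\<lambda>j. {a (Suc j)..a j}). \<forall>j<k. b (Suc j) < b j}.
      (\<Prod>j<Suc k. ice_step_wgt (x k) (t * x k) (a j) (a (Suc j)) (b j)) *
        detf (Suc k) (\<lambda>i j. f i (b j)) = 0"
    proof
      fix b assume "b \<in> tuples (Suc k) (\<lambda>j. {a (Suc j)..a j})
        - {b\<in>tuples (Suc k) (\<lambda>j. {a (Suc j)..a j}). \<forall>j<k. b (Suc j) < b j}"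
      then have b: "b \<in> tuples (Suc k) (\<lambda>j. {a (Suc j)..a j})" and "\<exists>j<k. b j \<le> b (Suc j)"
        by (auto simp: not_less)
      then obtain j where j: "j < k" "b j \<le> b (Suc j)" by blast
      have "b (Suc j) \<le> a (Suc j)" "a (Suc j) \<le> b j" using b j by (auto simp: tuples_def)
      then have "b j = b (Suc j)" using j by simp
      then have "detf (Suc k) (\<lambda>i j. f i (b j)) = 0"
        using j by (intro detf_equal_columns[of j _ "Suc j"]) auto
      then show "(\<Prod>j<Suc k. ice_step_wgt (x k) (t * x k) (a j) (a (Suc j)) (b j)) *
        detf (Suc k) (\<lambda>i j. f i (b j)) = 0" by simp
    qed
  qed auto
  also have "\<dots> = detf (Suc k) (\<lambda>i j. \<Sum>y\<in>{a (Suc j)..a j}.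
      ice_step_wgt (x k) (t * x k) (a j) (a (Suc j)) y * f i y)"
    by (rule detf_sum_columns) simp
  also have "\<dots> = detf (Suc k) (\<lambda>i j. row_op (x k) 1 (t * x k) (f i) (a j)
      - x k ^ (a j - a (Suc j)) * row_op (x k) 1 (t * x k) (f i) (a (Suc j)))"
    by (rule detf_cong) (simp only: sum_row_op_ice a less_Suc_eq_le)
  also have "\<dots> = detf (Suc k) (\<lambda>i j. row_op (x k) 1 (t * x k) (f i) (a j))"
    by (rule detf_row_last_zero) (simp add: a)
  also have "\<dots> = detf (Suc k) (\<lambda>i j. if i < k then 1 * row_op (x k) 1 (t * x k) (f i) (a j)
      + 0 * hsum (x k) (u k) (a j) else (u k + t * x k) * hsum (x k) (u k) (a j))"
    by (rule detf_cong) (simp add: f_def row_op_geometric)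
  also have "\<dots> = (u k + t * x k) * detf (Suc k) (\<lambda>i j. if i < k then row_op (x k) 1 (t * x k) (G i) (a j)
      else hsum (x k) (u k) (a j))" (is "detf _ ?L = _ * detf _ ?R")
  proof -
    \<comment> \<open>A diagonal factor pulls the scalar \<open>u k + t * x k\<close> out of the
      last row.\<close>
    have "detf (Suc k) (\<lambda>i j. \<Sum>l<Suc k. (if i = l then if i < k then 1 else u k + t * x k else 0) * ?R l j)
       = detf (Suc k) (\<lambda>i l. if i = l then if i < k then 1 else u k + t * x k else 0) * detf (Suc k) ?R"
      by (rule detf_mult[symmetric])
    also have "detf (Suc k) (\<lambda>i l. if i = l then if i < k then 1 else u k + t * x k else 0) = u k + t * x k"
      by (subst det_upper_triangular[of _ "Suc k"]) (auto simp: prod_list_diag_detf upper_triangular_def)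
    also have "detf (Suc k) (\<lambda>i j. \<Sum>l<Suc k. (if i = l then if i < k then 1 else u k + t * x k else 0) * ?R l j)
       = detf (Suc k) ?L"
    proof (rule detf_cong)
      fix i j assume "i < Suc k"
      have "(\<Sum>l<Suc k. (if i = l then if i < k then 1 else u k + t * x k else 0) * ?R l j)
        = (\<Sum>l<Suc k. if l = i then (if i < k then 1 else u k + t * x k) * ?R i j else 0)"
        by (rule sum.cong) auto
      also have "\<dots> = ?L i j" using \<open>i < Suc k\<close> by (simp add: f_def)
      finally show "(\<Sum>l<Suc k. (if i = l then if i < k then 1 else u k + t * x k else 0) * ?R l j) = ?L i j" .
    qed
    finally show ?thesis .
  qed
  finally have outer: "(\<Sum>b\<in>{b\<in>tuples (Suc k) (\<lambda>j. {a (Suc j)..a j}). \<forall>j<k. b (Suc j) < b j}.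
        (\<Prod>j<Suc k. ice_step_wgt (x k) (t * x k) (a j) (a (Suc j)) (b j)) *
        detf (Suc k) (\<lambda>i j. f i (b j))) = (u k + t * x k) * detf (Suc k) ?R" .
  have resolvent: "(\<Prod>i<k. (x i + u i) - (x k + u k)) * detf (Suc k) ?R
      = (\<Prod>i<k. x i + u i + t * (x k + xi k)) * detf (Suc k) (\<lambda>i j. hsum (x i) (u i) (a j))"
  proof (rule detf_resolvent)
    fix i assume "i < k"
    have xu: "x i * u i = t\<^sup>2" if "i \<le> k" for i
      using xxi[OF that] u[OF that] by (metis mult.left_commute mult.right_neutral)
    then show "x i * u i = x k * u k" using \<open>i < k\<close> by simp
    show "row_op (x k) 1 (t * x k) (G i) 0 = 0" by simp
    fix b
    \<comment> \<open>Both sides are \<open>t^2\<close>. So the outer two forcing terms have the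
      coefficients 1 and \<open>x i * u i\<close>, and the recurrence of \<open>hsum\<close> folds
      them into the middle one; this gives the factor \<open>s_i + t (x_k + 1/x_k)\<close>.\<close>
    have c: "t * x k * (t * xi k) = x i * u i"
      using xxi[of k] xu[of i] \<open>i < k\<close> by (simp add: power2_eq_square mult_ac)
    have "hsum (x i) (u i) (Suc (Suc b)) + (t * xi k + t * x k) * hsum (x i) (u i) (Suc b) 
        + t * x k * (t * xi k) * hsum (x i) (u i) b = (x i + u i + t * (x k + xi k)) * hsum (x i) (u i) (Suc b)"
      unfolding c using hsum_rec_pair[of "x i" "u i" b] by (simp add: algebra_simps del: hsum.simps)
    then show "row_op (x k) 1 (t * x k) (G i) (Suc (Suc b)) =
         (x k + u k) * row_op (x k) 1 (t * x k) (G i) (Suc b) -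
         x k * u k * row_op (x k) 1 (t * x k) (G i) b +
         (x i + u i + t * (x k + xi k)) * hsum (x i) (u i) (Suc b)"
      unfolding G_def by (subst row_op_twice) (simp del: hsum.simps row_op.simps add: add.assoc)
  qed
  have "(\<Sum>b\<in>{b\<in>tuples (Suc k) (\<lambda>j. {a (Suc j)..a j}). \<forall>j<k. b (Suc j) < b j}.
        (\<Prod>j<Suc k. ice_step_wgt (x k) (t * x k) (a j) (a (Suc j)) (b j)) *
        (u k ^ b k *
          (\<Sum>c\<in>{c\<in>tuples k (\<lambda>j. {b (Suc j)..b j}). \<forall>j<k. c (Suc j) < c j}.
            (\<Prod>j<k. ice_step_wgt (u k) (t * xi k) (b j) (b (Suc j)) (c j)) *
            detf k (\<lambda>i j. hsum (x i) (u i) (c j))))) = (u k + t * x k) * detf (Suc k) ?R"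
    unfolding outer[symmetric] by (rule sum.cong[OF refl], subst inner) auto
  then show ?thesis by (simp only: mult.left_commute resolvent mult.assoc)
qed

section \<open>Chains\<close>

text \<open>Levels are numbered from the far end of the chain, so that unfolding
  \<open>walk_sum\<close> removes the starting level, in step with an induction on the number of
  variables.\<close>

definition walks :: "(nat \<Rightarrow> 'b \<Rightarrow> 'b \<Rightarrow> bool) \<Rightarrow> nat \<Rightarrow> 'b \<Rightarrow> (nat \<Rightarrow> 'b) set" where
  "walks step r a = {\<sigma> \<in> extensional {..r}. \<sigma> r = a \<and> (\<forall>q<r. step q (\<sigma> (Suc q)) (\<sigma> q))}"

fun walk_sum :: "(nat \<Rightarrow> 'b \<Rightarrow> 'b \<Rightarrow> bool) \<Rightarrow> (nat \<Rightarrow> 'b \<Rightarrow> 'b \<Rightarrow> 'a::comm_semiring_1) \<Rightarrow> nat \<Rightarrow> 'b \<Rightarrow> 'a" where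
  "walk_sum step w 0 a = 1"
| "walk_sum step w (Suc r) a = (\<Sum>b | step r a b. w r a b * walk_sum step w r b)"

lemma sum_walks:
  assumes fin: "\<And>q a. finite {b. step q a b}"
  shows "finite (walks step r a) \<and>
    (\<Sum>\<sigma>\<in>walks step r a. \<Prod>q<r. w q (\<sigma> (Suc q)) (\<sigma> q)) = walk_sum step w r a"
proof (induction r arbitrary: a)
  case 0
  have "walks step 0 a = {\<lambda>x\<in>{0}. a}"
    by (auto simp: walks_def extensional_def fun_eq_iff)
  then show ?case by simp
next
  case (Suc r)
  let ?S = "Sigma {b. step r a b} (walks step r)"
  let ?f = "\<lambda>(b, \<sigma>). \<sigma>(Suc r := a)"
  let ?g = "\<lambda>\<sigma>. (\<sigma> r, restrict \<sigma> {..r})"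
  have bij: "bij_betw ?f ?S (walks step (Suc r) a)"
  proof (rule bij_betw_byWitness[where f' = ?g])
    show "\<forall>p\<in>?S. ?g (?f p) = p"
      by (auto simp: walks_def extensional_def fun_eq_iff)
    show "\<forall>\<sigma>\<in>walks step (Suc r) a. ?f (?g \<sigma>) = \<sigma>"
      by (auto simp: walks_def extensional_def fun_eq_iff)
    show "?f ` ?S \<subseteq> walks step (Suc r) a"
      by (auto simp: walks_def extensional_def less_Suc_eq)
    show "?g ` walks step (Suc r) a \<subseteq> ?S"
      by (auto simp: walks_def extensional_def)
  qed
  have "finite ?S" using fin Suc by blast
  then have "finite (walks step (Suc r) a)" using bij_betw_finite[OF bij] by blast
  have "(\<Sum>\<sigma>\<in>walks step (Suc r) a. \<Prod>q<Suc r. w q (\<sigma> (Suc q)) (\<sigma> q))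
      = (\<Sum>p\<in>?S. \<Prod>q<Suc r. w q (?f p (Suc q)) (?f p q))"
    by (rule sum.reindex_bij_betw[OF bij, symmetric])
  also have "\<dots> = (\<Sum>(b, \<sigma>)\<in>?S. w r a b * (\<Prod>q<r. w q (\<sigma> (Suc q)) (\<sigma> q)))"
  proof (rule sum.cong[OF refl], clarify)
    fix b \<sigma> assume "\<sigma> \<in> walks step r b"
    then have "\<sigma> r = b" by (simp add: walks_def)
    moreover have "(\<Prod>q<r. w q ((\<sigma>(Suc r := a)) (Suc q)) ((\<sigma>(Suc r := a)) q))
        = (\<Prod>q<r. w q (\<sigma> (Suc q)) (\<sigma> q))"
      by (rule prod.cong) auto
    ultimately show "(\<Prod>q<Suc r. w q ((\<sigma>(Suc r := a)) (Suc q)) ((\<sigma>(Suc r := a)) q))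
        = w r a b * (\<Prod>q<r. w q (\<sigma> (Suc q)) (\<sigma> q))"
      by (simp add: mult.commute)
  qed
  also have "\<dots> = (\<Sum>b | step r a b. \<Sum>\<sigma>\<in>walks step r b. w r a b * (\<Prod>q<r. w q (\<sigma> (Suc q)) (\<sigma> q)))"
    by (rule sum.Sigma[symmetric]) (use fin Suc in auto)
  also have "\<dots> = walk_sum step w (Suc r) a"
    using Suc by (simp flip: sum_distrib_left)
  finally show ?case using \<open>finite (walks step (Suc r) a)\<close> by blast
qed


section \<open>Ice configurations as chains of column sets\<close>

text \<open>Counted to the right because the right boundary is the one with known horizontal edges;
  the edges of a row are recovered from there leftwards.\<close>

definition cnt :: "nat set \<Rightarrow> nat \<Rightarrow> nat" where
  "cnt A y = card {c \<in> A. y < c}"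

lemma cnt_step: "finite A \<Longrightarrow> cnt A y = cnt A (Suc y) + of_bool (Suc y \<in> A)"
proof -
  assume fin: "finite A"
  have "{c \<in> A. y < c} = {c \<in> A. Suc y < c} \<union> (if Suc y \<in> A then {Suc y} else {})"
    unfolding set_eq_iff
  proof
    fix c
    have "y < c \<longleftrightarrow> Suc y < c \<or> c = Suc y" by linarith
    then show "c \<in> {c \<in> A. y < c} \<longleftrightarrow> c \<in> {c \<in> A. Suc y < c} \<union> (if Suc y \<in> A then {Suc y} else {})"
      by auto
  qed
  moreover have "{c \<in> A. Suc y < c} \<inter> (if Suc y \<in> A then {Suc y} else {}) = {}" by auto
  ultimately show ?thesis using fin by (simp add: cnt_def card_Un_disjoint)
qed

lemma cnt_zero: "A \<subseteq> {1..m} \<Longrightarrow> cnt A 0 = card A"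
  unfolding cnt_def by (rule arg_cong[of _ _ card]) auto

lemma cnt_top: "A \<subseteq> {1..m} \<Longrightarrow> m \<le> y \<Longrightarrow> cnt A y = 0"
  unfolding cnt_def by (subst card_eq_0_iff) (auto dest!: subsetD)

(* cnt A y - cnt B y is the occupancy of the horizontal edge to the right of column y, when A and B
   are the columns of the upward edges above and below the row. *)
definition interlace :: "nat set \<Rightarrow> nat set \<Rightarrow> bool" where
  "interlace A B \<longleftrightarrow> (\<forall>y. cnt B y \<le> cnt A y \<and> cnt A y \<le> Suc (cnt B y))"

text \<open>The cardinality at even levels encodes the U-turn: of two paired rows exactly one loses
  a particle. Which one is left open, hence no such condition at odd levels.\<close>

definition ice_step :: "nat \<Rightarrow> nat \<Rightarrow> nat set \<Rightarrow> nat set \<Rightarrow> bool" where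
  "ice_step m r A B \<longleftrightarrow> A \<subseteq> {1..m} \<and> B \<subseteq> {1..m} \<and> interlace A B \<and> (even r \<longrightarrow> card B = r div 2)"

definition vertex :: "nat set \<Rightarrow> nat set \<Rightarrow> nat \<Rightarrow> ice" where
  "vertex A B j =
    (if j \<in> A then if j \<in> B then if cnt B j < cnt A j then NE else NW else WE
     else if j \<in> B then NS else if cnt B j < cnt A j then SE else SW)"

(* \<sigma> r is the set of upward vertical edges r levels above the bottom, so row i lies between
   \<sigma> (2n + 1 - i) and \<sigma> (2n - i). *)
definition chain_matrix :: "nat \<Rightarrow> nat \<Rightarrow> (nat \<Rightarrow> nat set) \<Rightarrow> ice_matrix" where
  "chain_matrix n m \<sigma> = restrict (\<lambda>(i, j). vertex (\<sigma> (2*n + 1 - i)) (\<sigma> (2*n - i)) j) ({1..2*n} \<times> {1..m})"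

lemma all_side: "(\<forall>s. P s) \<longleftrightarrow> P Up \<and> P Down \<and> P Left \<and> P Right"
  by (metis side.exhaust)

section \<open>The ice rule, and orientations as chains\<close>

lemma card_incoming:
  "card (incoming h v i j) = of_bool (v (i - 1) j = Downward) + of_bool (v i j = Upward)
    + of_bool (h i (j - 1) = Rightward) + of_bool (h i j = Leftward)"
proof -
  have "incoming h v i j = (if v (i - 1) j = Downward then {Up} else {}) \<union> (if v i j = Upward then {Down} else {})
    \<union> (if h i (j - 1) = Rightward then {Left} else {}) \<union> (if h i j = Leftward then {Right} else {})"
    by (simp add: set_eq_iff all_side incoming_def)
  then show ?thesis by simp
qed

text \<open>By the ice rule three edges determine the fourth, so the type can be read off without
  the left edge.\<close>

lemma ice_elem_incoming:
  assumes "card (incoming h v i j) = 2"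
  shows "ice_elem (incoming h v i j) =
    (if v (i - 1) j = Upward then if v i j = Upward then if h i j = Rightward then NE else NW else WE
     else if v i j = Upward then NS else if h i j = Rightward then SE else SW)"
  using assms unfolding card_incoming
  by (cases "v (i - 1) j"; cases "v i j"; cases "h i (j - 1)"; cases "h i j")
    (simp_all add: ice_elem_def set_eq_iff all_side incoming_def)

text \<open>The horizontal edges are defined by differences of counts. Passing from column
  \<open>Suc y\<close> to \<open>y\<close> changes each count by the presence of
  \<open>Suc y\<close>, and this conservation law is the ice rule.\<close>

lemma chain_matrix_in_CM_set:
  assumes n: "n \<ge> 1" and A: "A = mu ` {1..n}" "A \<subseteq> {1..mu 1}" "card A = n"
    and \<sigma>: "\<sigma> \<in> walks (ice_step (mu 1)) (2*n) A"
  shows "chain_matrix n (mu 1) \<sigma> \<in> CM_set n mu"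
proof -
  define m where "m = mu 1"
  define h where "h i j = (if cnt (\<sigma> (2*n - i)) j < cnt (\<sigma> (2*n + 1 - i)) j then Rightward else Leftward)" for i j
  define v where "v i j = (if j \<in> \<sigma> (2*n - i) then Upward else Downward)" for i j
  have step: "ice_step m q (\<sigma> (Suc q)) (\<sigma> q)" if "q < 2*n" for q
    using \<sigma> that by (simp add: walks_def m_def)
  have top: "\<sigma> (2*n) = A" using \<sigma> by (simp add: walks_def)
  have sub: "\<sigma> q \<subseteq> {1..m}" if "q \<le> 2*n" for q
    using that top A(2) step[of q] by (cases "q = 2*n") (auto simp: m_def ice_step_def)
  have fin: "finite (\<sigma> q)" if "q \<le> 2*n" for q
    using sub[OF that] finite_subset by blast
  have card: "card (\<sigma> (2*k)) = k" if "k \<le> n" for k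
    using that top A(3) step[of "2*k"] by (cases "k = n") (auto simp: ice_step_def)
  have il: "cnt (\<sigma> (2*n - i)) y \<le> cnt (\<sigma> (2*n + 1 - i)) y \<and> cnt (\<sigma> (2*n + 1 - i)) y \<le> Suc (cnt (\<sigma> (2*n - i)) y)"
    if "i \<in> {1..2*n}" for i y
  proof -
    have "Suc (2*n - i) = 2*n + 1 - i" "2*n - i < 2*n" using that by auto
    then show ?thesis using step[of "2*n - i"] by (simp add: ice_step_def interlace_def)
  qed
  have card2: "card (incoming h v i j) = 2" if i: "i \<in> {1..2*n}" and j: "j \<in> {1..m}" for i j
  proof -
    obtain y where y: "j = Suc y" using j by (cases j) auto
    have e: "2*n - (i - 1) = 2*n + 1 - i" using i by auto
    have "cnt (\<sigma> q) y = cnt (\<sigma> q) j + of_bool (j \<in> \<sigma> q)" if "q \<le> 2*n" for q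
      unfolding y by (rule cnt_step[OF fin[OF that]])
    from this[of "2*n - i"] this[of "2*n + 1 - i"] i
    have "cnt (\<sigma> (2*n - i)) y = cnt (\<sigma> (2*n - i)) j + of_bool (j \<in> \<sigma> (2*n - i))"
      "cnt (\<sigma> (2*n + 1 - i)) y = cnt (\<sigma> (2*n + 1 - i)) j + of_bool (j \<in> \<sigma> (2*n + 1 - i))" by auto
    with il[OF i, of y] il[OF i, of j] show ?thesis
      unfolding card_incoming v_def h_def e using y
      by (cases "j \<in> \<sigma> (2*n - i)"; cases "j \<in> \<sigma> (2*n + 1 - i)") auto
  qed
  have "ice_orientation n m mu h v"
    unfolding ice_orientation_def
  proof (intro conjI ballI)
    fix i j assume "i \<in> {1..2*n}" "j \<in> {1..m}"
    then show "card (incoming h v i j) = 2" by (rule card2)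
  next
    fix i assume "i \<in> {1..2*n}"
    then have "2*n + 1 - i \<le> 2*n" by auto
    then show "h i m = Leftward"
      using cnt_top[OF sub, of "2*n + 1 - i" m] by (simp add: h_def)
  next
    fix j assume "j \<in> {1..m}"
    have "\<sigma> 0 = {}" using card[of 0] fin[of 0] by simp
    then show "v (2*n) j = Downward" by (simp add: v_def)
  next
    fix i assume i: "i \<in> {1..n}"
    have e: "2*n - (2*i - 1) = 2*n + 1 - 2*i" "2*n + 1 - (2*i - 1) = 2*(n + 1 - i)" "2*n - 2*i = 2*(n - i)"
      using i by auto
    \<comment> \<open>Across the pair of rows the count at 0 drops by one in total, while each
      single row drops it by 0 or 1; so exactly one left edge points right.\<close>
    have "card (\<sigma> (2*(n + 1 - i))) = n + 1 - i" "card (\<sigma> (2*(n - i))) = n - i"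
      using card[of "n + 1 - i"] card[of "n - i"] i by auto
    moreover have "2*(n + 1 - i) \<le> 2*n" "2*(n - i) \<le> 2*n" using i by auto
    then have "cnt (\<sigma> (2*(n + 1 - i))) 0 = card (\<sigma> (2*(n + 1 - i)))"
      "cnt (\<sigma> (2*(n - i))) 0 = card (\<sigma> (2*(n - i)))"
      by (simp_all only: cnt_zero[OF sub])
    moreover have "2*i \<in> {1..2*n}" "2*i - 1 \<in> {1..2*n}" using i by auto
    ultimately show "h (2*i - 1) 0 \<noteq> h (2*i) 0"
      using il[of "2*i" 0] il[of "2*i - 1" 0] i unfolding h_def e by (auto simp: Suc_diff_le)
  next
    fix q assume "q \<in> {1..m}"
    show "v 0 q = (if q \<in> mu ` {1..n} then Upward else Downward)"
      using top A(1) by (simp add: v_def)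
  qed
  moreover have "chain_matrix n m \<sigma> = restrict (\<lambda>(i, j). ice_elem (incoming h v i j)) ({1..2*n} \<times> {1..m})"
    unfolding chain_matrix_def
  proof (rule restrict_ext, clarify)
    fix i j assume ij: "i \<in> {1..2*n}" "j \<in> {1..m}"
    have e: "2*n - (i - 1) = 2*n + 1 - i" using ij by auto
    show "vertex (\<sigma> (2*n + 1 - i)) (\<sigma> (2*n - i)) j = ice_elem (incoming h v i j)"
      unfolding ice_elem_incoming[OF card2[OF ij]] vertex_def h_def v_def e by simp
  qed
  ultimately show ?thesis unfolding CM_set_def m_def by blast
qed

lemma CM_set_chain_matrix:
  assumes n: "n \<ge> 1" and A: "A = mu ` {1..n}" "A \<subseteq> {1..mu 1}" "card A = n"
    and CM: "CM \<in> CM_set n mu"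
  shows "\<exists>\<sigma>\<in>walks (ice_step (mu 1)) (2*n) A. CM = chain_matrix n (mu 1) \<sigma>"
proof -
  define m where "m = mu 1"
  obtain h v where hv: "ice_orientation n m mu h v"
    and CM_eq: "CM = restrict (\<lambda>(i, j). ice_elem (incoming h v i j)) ({1..2*n} \<times> {1..m})"
    using CM unfolding CM_set_def m_def by blast
  define \<sigma> where "\<sigma> = restrict (\<lambda>r. {j \<in> {1..m}. v (2*n - r) j = Upward}) {..2*n}"
  have sub: "\<sigma> q \<subseteq> {1..m}" if "q \<le> 2*n" for q
    using that by (auto simp: \<sigma>_def)
  have fin: "finite (\<sigma> q)" if "q \<le> 2*n" for q
    using sub[OF that] finite_subset by blast
  have card2: "card (incoming h v i j) = 2" if "i \<in> {1..2*n}" "j \<in> {1..m}" for i j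
    using hv that unfolding ice_orientation_def by blast
  have mem: "j \<in> \<sigma> (2*n - i) \<longleftrightarrow> v i j = Upward" if "i \<le> 2*n" "j \<in> {1..m}" for i j
    using that by (simp add: \<sigma>_def)
  have edge: "cnt (\<sigma> (2*n + 1 - i)) y = cnt (\<sigma> (2*n - i)) y + of_bool (h i y = Rightward)"
    if i: "i \<in> {1..2*n}" and y: "y \<le> m" for i y
    using y
  \<comment> \<open>Starts at the right boundary, where all edges point left; the ice rule at column
    \<open>Suc y\<close> carries the identity one column further.\<close>
  proof (induction y rule: inc_induct)
    case base
    have "h i m = Leftward" using hv i unfolding ice_orientation_def by blast
    then show ?case using i cnt_top[OF sub] by auto
  next
    case (step y)
    have j: "Suc y \<in> {1..m}" using step.hyps by auto
    have e: "2*n + 1 - i = 2*n - (i - 1)" using i by auto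
    have "cnt (\<sigma> (2*n + 1 - i)) y = cnt (\<sigma> (2*n + 1 - i)) (Suc y) + of_bool (v (i - 1) (Suc y) = Upward)"
    proof -
      have "i - 1 \<le> 2*n" "2*n - (i - 1) \<le> 2*n" using i by auto
      then show ?thesis using cnt_step[OF fin, of "2*n - (i - 1)" y] mem[OF _ j, of "i - 1"] unfolding e by simp
    qed
    moreover have "cnt (\<sigma> (2*n - i)) y = cnt (\<sigma> (2*n - i)) (Suc y) + of_bool (v i (Suc y) = Upward)"
      using cnt_step[OF fin, of "2*n - i" y] mem[of i "Suc y"] i j by auto
    ultimately show ?case
      using step.IH card2[OF i j] unfolding card_incoming
      by (cases "v (i - 1) (Suc y)"; cases "v i (Suc y)"; cases "h i y"; cases "h i (Suc y)") auto
  qed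
  have il: "interlace (\<sigma> (2*n + 1 - i)) (\<sigma> (2*n - i))" if i: "i \<in> {1..2*n}" for i
    unfolding interlace_def
  proof
    fix y
    show "cnt (\<sigma> (2*n - i)) y \<le> cnt (\<sigma> (2*n + 1 - i)) y \<and> cnt (\<sigma> (2*n + 1 - i)) y \<le> Suc (cnt (\<sigma> (2*n - i)) y)"
    proof (cases "y \<le> m")
      case True
      then show ?thesis using edge[OF i True] by auto
    next
      case False
      then have "cnt (\<sigma> (2*n - i)) y = 0" "cnt (\<sigma> (2*n + 1 - i)) y = 0"
        using i by (auto intro!: cnt_top[OF sub])
      then show ?thesis by simp
    qed
  qed
  have top: "\<sigma> (2*n) = A"
    using hv A unfolding ice_orientation_def by (auto simp: \<sigma>_def m_def split: if_splits)
  have "v (2*n) j = Downward" if "j \<in> {1..m}" for j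
    using hv that unfolding ice_orientation_def by blast
  then have bot: "\<sigma> 0 = {}" by (auto simp: \<sigma>_def)
  \<comment> \<open>Upwards from the empty bottom level, each U-turn adds one particle.\<close>
  have card: "card (\<sigma> (2*k)) = k" if "k \<le> n" for k
    using that
  proof (induction k)
    case (Suc k)
    define i where "i = n - k"
    have i: "i \<in> {1..n}" using Suc.prems by (auto simp: i_def)
    have e: "2*n - (2*i - 1) = 2*k + 1" "2*n + 1 - (2*i - 1) = 2*(Suc k)" "2*n - 2*i = 2*k" "2*n + 1 - 2*i = 2*k + 1"
      using Suc.prems by (auto simp: i_def)
    have i2: "2*i \<in> {1..2*n}" "2*i - 1 \<in> {1..2*n}" using i by auto
    have "cnt (\<sigma> (2*(Suc k))) 0 = cnt (\<sigma> (2*k + 1)) 0 + of_bool (h (2*i - 1) 0 = Rightward)"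
      using edge[OF i2(2), of 0] unfolding e by simp
    moreover have "cnt (\<sigma> (2*k + 1)) 0 = cnt (\<sigma> (2*k)) 0 + of_bool (h (2*i) 0 = Rightward)"
      using edge[OF i2(1), of 0] unfolding e by simp
    moreover have "h (2*i - 1) 0 \<noteq> h (2*i) 0" using hv i unfolding ice_orientation_def by blast
    then have "of_bool (h (2*i - 1) 0 = Rightward) + of_bool (h (2*i) 0 = Rightward) = (1::nat)"
      by (cases "h (2*i - 1) 0"; cases "h (2*i) 0") auto
    ultimately have "cnt (\<sigma> (2*(Suc k))) 0 = Suc (cnt (\<sigma> (2*k)) 0)" by linarith
    then show ?case using Suc cnt_zero[OF sub] by (metis Suc_leD mult_le_mono2)
  qed (simp add: bot)
  have "\<sigma> \<in> walks (ice_step m) (2*n) A"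
    unfolding walks_def
  proof (intro CollectI conjI allI impI)
    show "\<sigma> \<in> extensional {..2*n}" by (simp add: \<sigma>_def)
    show "\<sigma> (2*n) = A" by (rule top)
    fix q assume q: "q < 2*n"
    have e: "2*n - (2*n - q) = q" "2*n + 1 - (2*n - q) = Suc q" using q by auto
    show "ice_step m q (\<sigma> (Suc q)) (\<sigma> q)"
      unfolding ice_step_def
      using il[of "2*n - q"] q sub[of q] sub[of "Suc q"] card[of "q div 2"] unfolding e by auto
  qed
  moreover have "CM = chain_matrix n m \<sigma>"
    unfolding CM_eq chain_matrix_def
  proof (rule restrict_ext, clarify)
    fix i j assume ij: "i \<in> {1..2*n}" "j \<in> {1..m}"
    have e: "2*n + 1 - i = 2*n - (i - 1)" using ij by auto
    have "cnt (\<sigma> (2*n - i)) j < cnt (\<sigma> (2*n + 1 - i)) j \<longleftrightarrow> h i j = Rightward"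
      using edge[OF ij(1), of j] ij by auto
    moreover have "j \<in> \<sigma> (2*n + 1 - i) \<longleftrightarrow> v (i - 1) j = Upward"
      unfolding e using ij by (intro mem) auto
    moreover have "j \<in> \<sigma> (2*n - i) \<longleftrightarrow> v i j = Upward"
      using ij by (intro mem) auto
    ultimately show "ice_elem (incoming h v i j) = vertex (\<sigma> (2*n + 1 - i)) (\<sigma> (2*n - i)) j"
      unfolding ice_elem_incoming[OF card2[OF ij]] vertex_def by simp
  qed
  ultimately show ?thesis unfolding m_def by blast
qed

text \<open>WE, NE and NW are the types whose upper edge points up, so row \<open>2n + 1 - r\<close>
  displays level \<open>r\<close>. Level 0 has no row beneath it, but it is empty by its
  cardinality.\<close>

lemma inj_on_chain_matrix:
  assumes n: "n \<ge> 1" and A: "A \<subseteq> {1..m}"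
  shows "inj_on (chain_matrix n m) (walks (ice_step m) (2*n) A)"
proof (rule inj_onI)
  have mem: "j \<in> \<sigma> r \<longleftrightarrow> j \<in> {1..m} \<and> chain_matrix n m \<sigma> (2*n + 1 - r, j) \<in> {WE, NE, NW}"
    if \<sigma>: "\<sigma> \<in> walks (ice_step m) (2*n) A" and r: "r \<in> {1..2*n}" for \<sigma> r j
  proof -
    have sub: "\<sigma> r \<subseteq> {1..m}"
    proof (cases "r = 2*n")
      case False
      then have "ice_step m r (\<sigma> (Suc r)) (\<sigma> r)" using \<sigma> r by (simp add: walks_def)
      then show ?thesis by (simp add: ice_step_def)
    qed (use \<sigma> A in \<open>simp add: walks_def\<close>)
    have e: "2*n + 1 - (2*n + 1 - r) = r" "2*n + 1 - r \<in> {1..2*n}" using r by auto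
    show ?thesis
    proof (cases "j \<in> {1..m}")
      case True
      then show ?thesis using e by (simp add: chain_matrix_def vertex_def)
    qed (use sub in auto)
  qed
  fix \<sigma> \<tau> assume \<sigma>: "\<sigma> \<in> walks (ice_step m) (2*n) A" and \<tau>: "\<tau> \<in> walks (ice_step m) (2*n) A"
    and eq: "chain_matrix n m \<sigma> = chain_matrix n m \<tau>"
  have empty: "\<rho> 0 = {}" if "\<rho> \<in> walks (ice_step m) (2*n) A" for \<rho>
  proof -
    have "ice_step m 0 (\<rho> (Suc 0)) (\<rho> 0)" using that n by (simp add: walks_def)
    then show ?thesis using finite_subset[of "\<rho> 0" "{1..m}"] by (auto simp: ice_step_def)
  qed
  show "\<sigma> = \<tau>"
  proof (rule extensionalityI)
    show "\<sigma> \<in> extensional {..2*n}" "\<tau> \<in> extensional {..2*n}"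
      using \<sigma> \<tau> by (simp_all add: walks_def)
    fix r assume "r \<in> {..2*n}"
    then show "\<sigma> r = \<tau> r"
      using mem[OF \<sigma>, of r] mem[OF \<tau>, of r] empty[OF \<sigma>] empty[OF \<tau>] eq by (cases "r = 0") auto
  qed
qed

lemma bij_betw_chain_matrix:
  assumes "n \<ge> 1" "A = mu ` {1..n}" "A \<subseteq> {1..mu 1}" "card A = n"
  shows "bij_betw (chain_matrix n (mu 1)) (walks (ice_step (mu 1)) (2*n) A) (CM_set n mu)"
  unfolding bij_betw_def
proof
  show "inj_on (chain_matrix n (mu 1)) (walks (ice_step (mu 1)) (2*n) A)"
    using assms by (intro inj_on_chain_matrix)
  show "chain_matrix n (mu 1) ` walks (ice_step (mu 1)) (2*n) A = CM_set n mu"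
    using chain_matrix_in_CM_set[OF assms] CM_set_chain_matrix[OF assms] by auto
qed

section \<open>Strict partitions\<close>

definition strict_part :: "(nat \<Rightarrow> nat) \<Rightarrow> bool" where
  "strict_part a \<longleftrightarrow> (\<forall>j. a (Suc j) < a j \<or> a (Suc j) = 0)"

definition parts :: "(nat \<Rightarrow> nat) \<Rightarrow> nat set" where
  "parts a = {c. 0 < c \<and> (\<exists>j. c = a j)}"

lemma strict_partD: "strict_part a \<Longrightarrow> a (Suc j) < a j \<or> a (Suc j) = 0"
  by (simp add: strict_part_def)

lemma strict_part_less: "strict_part a \<Longrightarrow> i < j \<Longrightarrow> 0 < a i \<Longrightarrow> a j < a i"
proof (induction j rule: less_induct)
  case (less j)
  show ?case
  proof (cases "j = Suc i")
    case True
    have "a (Suc i) < a i \<or> a (Suc i) = 0" using strict_partD[OF less.prems(1), of i] .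
    then show ?thesis using less.prems(3) True by auto
  next
    case False
    then obtain l where l: "j = Suc l" "i < l" using less.prems by (cases j) auto
    then have "a l < a i" using less.IH[of l] less.prems by simp
    moreover have "a j < a l \<or> a j = 0" using strict_partD[OF less.prems(1), of l] l(1) by simp
    ultimately show ?thesis using less.prems(3) by linarith
  qed
qed

lemma strict_part_le: "strict_part a \<Longrightarrow> i \<le> j \<Longrightarrow> a j \<le> a i"
proof -
  assume a: "strict_part a" and ij: "i \<le> j"
  have "a (Suc n) \<le> a n" for n using strict_partD[OF a, of n] by auto
  then show "a j \<le> a i" using ij by (rule lift_Suc_antimono_le)
qed

lemma strict_part_inj: "strict_part a \<Longrightarrow> inj_on a {j. 0 < a j}"
  using strict_part_less[of a] by (intro linorder_inj_onI) fastforce+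

text \<open>\<open>cnt\<close> is the conjugate partition: the parts exceeding \<open>y\<close> are
  those with the smallest indices. This duality converts inequalities between counts into
  inequalities between parts.\<close>

lemma less_cnt_parts:
  assumes a: "strict_part a"
  shows "j < cnt (parts a) y \<longleftrightarrow> y < a j"
proof -
  define N where "N = (LEAST j. a j \<le> y)"
  \<comment> \<open>Parts fall by at least one per index until they reach 0, so index
    \<open>a 0\<close> is certainly past the end and the least index exists.\<close>
  have "a (a 0) \<le> y"
  proof -
    have "a j \<le> a 0 - j" for j
    proof (induction j)
      case (Suc j)
      have "a (Suc j) < a j \<or> a (Suc j) = 0" using strict_partD[OF a] .
      then show ?case using Suc.IH by linarith
    qed simp
    from this[of "a 0"] show ?thesis by simp
  qed
  then have N: "a N \<le> y" unfolding N_def by (rule LeastI)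
  have "y < a j \<longleftrightarrow> j < N" for j
  proof (cases "j < N")
    case True
    then show ?thesis using not_less_Least[of j "\<lambda>j. a j \<le> y"] by (simp add: N_def not_le)
  next
    case False
    then show ?thesis using strict_part_le[OF a, of N j] N by simp
  qed
  then have set: "{j. y < a j} = {..<N}" by auto
  have "{c \<in> parts a. y < c} = a ` {j. y < a j}"
    by (auto simp: parts_def)
  moreover have "inj_on a {j. y < a j}"
    by (rule inj_on_subset[OF strict_part_inj[OF a]]) auto
  ultimately have "cnt (parts a) y = N"
    unfolding cnt_def using set by (simp add: card_image)
  then show ?thesis using set by auto
qed

lemma strict_part_eqI:
  assumes "strict_part a" "strict_part b" "parts a = parts b"
  shows "a = b"
proof
  fix j
  have "y < a j \<longleftrightarrow> y < b j" for y
    using less_cnt_parts[OF assms(1), of j y] less_cnt_parts[OF assms(2), of j y] assms(3) by simp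
  from this[of "a j"] this[of "b j"] show "a j = b j" by linarith
qed

lemma ex_strict_part:
  assumes "finite A" "0 \<notin> A"
  shows "\<exists>a. strict_part a \<and> parts a = A"
  using assms
proof (induction A rule: finite_psubset_induct)
  case (psubset A)
  show ?case
  proof (cases "A = {}")
    case True
    then show ?thesis by (intro exI[of _ "\<lambda>_. 0"]) (auto simp: strict_part_def parts_def)
  next
    case False
    let ?M = "Max A"
    have M: "?M \<in> A" using psubset False by simp
    then have "A - {?M} \<subset> A" by blast
    then obtain a where a: "strict_part a" "parts a = A - {?M}"
      using psubset.IH[of "A - {?M}"] psubset.prems by blast
    have "a 0 < ?M"
    proof (cases "a 0 = 0")
      case True
      then show ?thesis using M psubset.prems by (metis gr0I)
    next
      case False
      then have "a 0 \<in> A - {?M}" unfolding a(2)[symmetric] parts_def by auto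
      then show ?thesis using psubset.hyps by (simp add: le_neq_trans)
    qed
    then have "strict_part (case_nat ?M a)"
      using a(1) unfolding strict_part_def by (auto split: nat.split)
    moreover have "parts (case_nat ?M a) = A"
    proof -
      have "parts (case_nat ?M a) = insert ?M (parts a)"
      proof (intro equalityI subsetI)
        fix c assume "c \<in> insert ?M (parts a)"
        then consider "c = ?M" | j where "0 < c" "c = a j" by (auto simp: parts_def)
        then show "c \<in> parts (case_nat ?M a)"
        proof cases
          case 1
          then have "0 < c" using M psubset.prems by (metis gr0I)
          then show ?thesis unfolding parts_def using 1 by (auto intro!: exI[of _ 0])
        next
          case 2
          then show ?thesis unfolding parts_def by (auto intro!: exI[of _ "Suc j"])
        qed
      next
        fix c assume "c \<in> parts (case_nat ?M a)"
        then obtain j where "0 < c" "c = case_nat ?M a j" unfolding parts_def by blast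
        then show "c \<in> insert ?M (parts a)"
          by (cases j) (auto simp: parts_def)
      qed
      then show ?thesis using a(2) M by auto
    qed
    ultimately show ?thesis by blast
  qed
qed

text \<open>Through the duality, the lower bound on \<open>cnt A\<close> compares parts of equal
  index, and the \<open>Suc\<close> in the upper bound becomes a shift of the index.\<close>

lemma interlace_parts:
  assumes "strict_part a" "strict_part b"
  shows "interlace (parts a) (parts b) \<longleftrightarrow> (\<forall>j. a (Suc j) \<le> b j \<and> b j \<le> a j)"
proof -
  have le: "m \<le> n \<longleftrightarrow> (\<forall>j. j < m \<longrightarrow> j < n)" for m n :: nat
    by (metis less_le_trans not_le less_irrefl)
  have le_Suc: "m \<le> Suc n \<longleftrightarrow> (\<forall>j. Suc j < m \<longrightarrow> j < n)" for m n :: nat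
    by (metis Suc_less_eq less_irrefl less_le_trans not_le)
  have "interlace (parts a) (parts b) \<longleftrightarrow> (\<forall>y j. (y < b j \<longrightarrow> y < a j) \<and> (y < a (Suc j) \<longrightarrow> y < b j))"
    unfolding interlace_def le[of "cnt (parts b) _"] le_Suc less_cnt_parts[OF assms(1)] less_cnt_parts[OF assms(2)]
    by blast
  also have "\<dots> \<longleftrightarrow> (\<forall>j. a (Suc j) \<le> b j \<and> b j \<le> a j)"
    unfolding le[of "a (Suc _)"] le[of "b _"] by blast
  finally show ?thesis .
qed

section \<open>Levels of the ice as tuples of parts\<close>

lemma parts_subset:
  assumes "strict_part a" "a 0 \<le> m"
  shows "parts a \<subseteq> {1..m}"
proof
  fix c assume "c \<in> parts a"
  then obtain j where "0 < c" "c = a j" by (auto simp: parts_def)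
  then show "c \<in> {1..m}" using strict_part_le[OF assms(1), of 0 j] assms(2) by simp
qed

lemma bij_betw_parts:
  assumes a: "strict_part a" "a 0 \<le> m" "\<And>j. K \<le> j \<Longrightarrow> a j = 0"
  shows "bij_betw parts {b \<in> tuples K (\<lambda>j. {a (Suc j)..a j}). strict_part b}
    {B. B \<subseteq> {1..m} \<and> interlace (parts a) B}"
proof -
  have eq: "b \<in> tuples K (\<lambda>j. {a (Suc j)..a j}) \<longleftrightarrow> (\<forall>j. a (Suc j) \<le> b j \<and> b j \<le> a j)" for b
    using tuples_interlacing[of K a] a(3) by blast
  show ?thesis unfolding bij_betw_def
  proof
    show "inj_on parts {b \<in> tuples K (\<lambda>j. {a (Suc j)..a j}). strict_part b}"
      by (rule inj_onI) (auto intro: strict_part_eqI)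
    show "parts ` {b \<in> tuples K (\<lambda>j. {a (Suc j)..a j}). strict_part b} = {B. B \<subseteq> {1..m} \<and> interlace (parts a) B}"
    proof (intro equalityI subsetI)
      fix B assume "B \<in> parts ` {b \<in> tuples K (\<lambda>j. {a (Suc j)..a j}). strict_part b}"
      then obtain b where b: "B = parts b" "\<forall>j. a (Suc j) \<le> b j \<and> b j \<le> a j" "strict_part b"
        unfolding eq by blast
      then have "b 0 \<le> m" using a(2) by (meson order_trans)
      then show "B \<in> {B. B \<subseteq> {1..m} \<and> interlace (parts a) B}"
        using b interlace_parts[OF a(1) b(3)] parts_subset[OF b(3)] by blast
    next
      fix B assume B: "B \<in> {B. B \<subseteq> {1..m} \<and> interlace (parts a) B}"
      then have "finite B" "0 \<notin> B" using finite_subset[of B "{1..m}"] by auto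
      then obtain b where b: "strict_part b" "parts b = B" using ex_strict_part by blast
      then have "\<forall>j. a (Suc j) \<le> b j \<and> b j \<le> a j" using B interlace_parts[OF a(1) b(1)] by blast
      then show "B \<in> parts ` {b \<in> tuples K (\<lambda>j. {a (Suc j)..a j}). strict_part b}"
        using b eq by blast
    qed
  qed
qed

text \<open>An odd level holds \<open>k\<close> or \<open>k + 1\<close> particles. The first
  \<open>k\<close> parts are positive because \<open>a (Suc j)\<close> bounds them from below; only
  \<open>b k\<close> may be 0, and then a particle was lost in this row.\<close>

lemma bij_betw_ice_step_odd:
  assumes a: "\<And>j. j \<le> k \<Longrightarrow> a (Suc j) < a j" "\<And>j. k < j \<Longrightarrow> a j = 0" "a 0 \<le> m"
  shows "bij_betw parts {b \<in> tuples (Suc k) (\<lambda>j. {a (Suc j)..a j}). \<forall>j<k. b (Suc j) < b j}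
    {B. ice_step m (Suc (2*k)) (parts a) B}"
proof -
  have sa: "strict_part a"
    unfolding strict_part_def
  proof
    fix j
    show "a (Suc j) < a j \<or> a (Suc j) = 0" using a by (cases "j \<le> k") auto
  qed
  have "{b \<in> tuples (Suc k) (\<lambda>j. {a (Suc j)..a j}). \<forall>j<k. b (Suc j) < b j}
    = {b \<in> tuples (Suc k) (\<lambda>j. {a (Suc j)..a j}). strict_part b}"
  proof (intro Collect_cong conj_cong refl)
    fix b assume b: "b \<in> tuples (Suc k) (\<lambda>j. {a (Suc j)..a j})"
    have "0 < b j" if "j < k" for j
    proof -
      have "a (Suc j) \<le> b j" using b that by (auto simp: tuples_def)
      moreover have "0 < a (Suc j)" using a(1)[of "Suc j"] that by simp
      ultimately show ?thesis by simp
    qed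
    moreover have "b (Suc j) = 0" if "\<not> j < k" for j using b that by (auto simp: tuples_def)
    ultimately show "(\<forall>j<k. b (Suc j) < b j) \<longleftrightarrow> strict_part b"
      unfolding strict_part_def by (metis less_irrefl)
  qed
  moreover have "{B. ice_step m (Suc (2*k)) (parts a) B} = {B. B \<subseteq> {1..m} \<and> interlace (parts a) B}"
    using parts_subset[OF sa a(3)] by (auto simp: ice_step_def)
  ultimately show ?thesis using bij_betw_parts[OF sa a(3), of "Suc k"] a(2) by (simp add: Suc_le_eq)
qed

lemma card_parts: "strict_part a \<Longrightarrow> card (parts a) = k \<longleftrightarrow> (\<forall>j. j < k \<longleftrightarrow> 0 < a j)"
proof -
  assume a: "strict_part a"
  have "cnt (parts a) 0 = card (parts a)" using parts_subset[OF a order_refl] by (rule cnt_zero)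
  then have "j < card (parts a) \<longleftrightarrow> 0 < a j" for j using less_cnt_parts[OF a, of j 0] by simp
  then show "card (parts a) = k \<longleftrightarrow> (\<forall>j. j < k \<longleftrightarrow> 0 < a j)" by (metis linorder_neqE_nat less_irrefl)
qed

text \<open>The cardinality decides the fate of the last particle: \<open>c\<close> has
  \<open>k\<close> parts, whether \<open>b k\<close> is positive and lost now, or 0 since it was
  lost in the row above.\<close>

lemma bij_betw_ice_step_even:
  assumes b: "\<And>j. j < k \<Longrightarrow> b (Suc j) < b j" "\<And>j. k < j \<Longrightarrow> b j = 0" "b 0 \<le> m"
  shows "bij_betw parts {c \<in> tuples k (\<lambda>j. {b (Suc j)..b j}). \<forall>j<k. c (Suc j) < c j}
    {C. ice_step m (2*k) (parts b) C}"
proof -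
  have sb: "strict_part b"
    unfolding strict_part_def
  proof
    fix j
    show "b (Suc j) < b j \<or> b (Suc j) = 0" using b by (cases "j < k") auto
  qed
  let ?S = "{c \<in> tuples (Suc k) (\<lambda>j. {b (Suc j)..b j}). strict_part c}"
  let ?T = "{C. C \<subseteq> {1..m} \<and> interlace (parts b) C}"
  have bij: "bij_betw parts ?S ?T"
    using bij_betw_parts[OF sb b(3), of "Suc k"] b(2) by (simp add: Suc_le_eq)
  have "{c \<in> tuples k (\<lambda>j. {b (Suc j)..b j}). \<forall>j<k. c (Suc j) < c j} = {c \<in> ?S. card (parts c) = k}"
  proof (intro Collect_eqI)
    fix c
    show "(c \<in> tuples k (\<lambda>j. {b (Suc j)..b j}) \<and> (\<forall>j<k. c (Suc j) < c j)) \<longleftrightarrow> (c \<in> ?S \<and> card (parts c) = k)"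
    proof
      assume c: "c \<in> tuples k (\<lambda>j. {b (Suc j)..b j}) \<and> (\<forall>j<k. c (Suc j) < c j)"
      have "strict_part c"
        unfolding strict_part_def
      proof
        fix j
        show "c (Suc j) < c j \<or> c (Suc j) = 0" using c by (cases "j < k") (auto simp: tuples_def)
      qed
      moreover have pos: "\<forall>j. j < k \<longleftrightarrow> 0 < c j"
      proof
        fix j
        show "j < k \<longleftrightarrow> 0 < c j"
        proof (cases "j < k")
          case True
          then have "c (Suc j) < c j" using c by blast
          then show ?thesis using True by simp
        qed (use c in \<open>simp add: tuples_def\<close>)
      qed
      moreover have "c \<in> tuples (Suc k) (\<lambda>j. {b (Suc j)..b j})"
        using c b(2)[of "Suc k"] unfolding tuples_def by (auto simp: less_Suc_eq)
      ultimately show "c \<in> ?S \<and> card (parts c) = k"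
        using card_parts[of c k] by simp
    next
      assume c: "c \<in> ?S \<and> card (parts c) = k"
      then have sc: "strict_part c" by simp
      have pos: "j < k \<longleftrightarrow> 0 < c j" for j using c card_parts[OF sc, of k] by simp
      have "c (Suc j) < c j" if "j < k" for j
      proof -
        have "c (Suc j) < c j \<or> c (Suc j) = 0" using strict_partD[OF sc] .
        then show ?thesis using pos[of j] that by auto
      qed
      moreover have "c \<in> tuples k (\<lambda>j. {b (Suc j)..b j})"
      proof -
        have "c j \<le> 0" if "k \<le> j" for j using pos[of j] that by simp
        then show ?thesis using c unfolding tuples_def by auto
      qed
      ultimately show "c \<in> tuples k (\<lambda>j. {b (Suc j)..b j}) \<and> (\<forall>j<k. c (Suc j) < c j)" by blast
    qed
  qed
  moreover have "{C. ice_step m (2*k) (parts b) C} = {C \<in> ?T. card C = k}"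
    using parts_subset[OF sb b(3)] by (auto simp: ice_step_def)
  moreover have "bij_betw parts {c \<in> ?S. card (parts c) = k} {C \<in> ?T. card C = k}"
    unfolding bij_betw_def
  proof
    have im: "parts ` ?S = ?T" using bij by (simp add: bij_betw_def)
    show "inj_on parts {c \<in> ?S. card (parts c) = k}"
      by (rule inj_on_subset[OF bij_betw_imp_inj_on[OF bij]]) blast
    show "parts ` {c \<in> ?S. card (parts c) = k} = {C \<in> ?T. card C = k}"
      unfolding im[symmetric] by blast
  qed
  ultimately show ?thesis by simp
qed

section \<open>Weights of ice rows\<close>

lemma X_add: "X i (a + b) = X i a * X i b"
  by (simp add: X_def mult_single single_add)

lemma X_0 [simp]: "X i 0 = 1"
  by (simp add: X_def)

lemma X_of_nat: "X i (int n) = X i 1 ^ n"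
  by (induction n) (simp_all add: X_add)

lemma X_minus_of_nat: "X i (- int n) = X i (- 1) ^ n"
proof (induction n)
  case (Suc n)
  have "X i (- int (Suc n)) = X i (- 1 + - int n)" by simp
  then show ?case using Suc by (simp only: X_add power_Suc)
qed simp

lemma X_inverse: "X i 1 * X i (- 1) = 1"
  by (simp flip: X_add)

definition row_stat :: "nat \<Rightarrow> ice set \<Rightarrow> nat set \<Rightarrow> nat set \<Rightarrow> nat" where
  "row_stat m S A B = card {j \<in> {1..m}. vertex A B j \<in> S}"

text \<open>\<open>q\<close> is the level below the row, so the row is \<open>2n - q\<close>, with
  the same parity as \<open>q\<close>; levels \<open>2k - 2\<close> and \<open>2k - 1\<close> both
  belong to the variable with index \<open>k\<close>.\<close>

definition ice_row_wgt :: "nat \<Rightarrow> nat \<Rightarrow> nat set \<Rightarrow> nat set \<Rightarrow> laurent" where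
  "ice_row_wgt m q A B = (1 + tt) ^ row_stat m {NS} A B *
    (if odd q then tt ^ row_stat m {NE} A B * X (Suc (q div 2)) 1 ^ row_stat m {NE, SE, WE} A B
     else tt ^ (row_stat m {SE} A B + row_stat m {NE, SE, WE} A B)
       * X (Suc (q div 2)) (- 1) ^ row_stat m {NE, SE, WE} A B)"

lemma sum_pairs: "(\<Sum>q<2*n. f q) = (\<Sum>k<n. f (2*k) + f (Suc (2*k)))"
  for f :: "nat \<Rightarrow> 'a::comm_monoid_add"
  by (induction n) (simp_all add: add.assoc)

lemma prod_pairs: "(\<Prod>q<2*n. f q) = (\<Prod>k<n. f (2*k) * f (Suc (2*k)))"
  for f :: "nat \<Rightarrow> 'a::comm_monoid_mult"
  by (induction n) (simp_all add: mult.assoc)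

lemma chain_matrix_wgt:
  "tt ^ (ne_odd n m (chain_matrix n m \<sigma>) + se_even n m (chain_matrix n m \<sigma>) + wgt_even n m (chain_matrix n m \<sigma>))
      * (1 + tt) ^ ns_count n m (chain_matrix n m \<sigma>) * ice_wgt n m (chain_matrix n m \<sigma>)
    = (\<Prod>q<2*n. ice_row_wgt m q (\<sigma> (Suc q)) (\<sigma> q))"
proof -
  define R where "R S q = row_stat m S (\<sigma> (Suc q)) (\<sigma> q)" for S q
  have R: "row_count m (chain_matrix n m \<sigma>) S (2*n - q) = R S q" if "q < 2*n" for S q
  proof -
    have e: "2*n + 1 - (2*n - q) = Suc q" "2*n - (2*n - q) = q" "2*n - q \<in> {1..2*n}" using that by auto
    have "chain_matrix n m \<sigma> (2*n - q, j) = vertex (\<sigma> (Suc q)) (\<sigma> q) j" if "j \<in> {1..m}" for j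
      unfolding chain_matrix_def using that e by simp
    then show ?thesis unfolding row_count_def R_def row_stat_def
      by (intro arg_cong[of _ _ card]) auto
  qed
  have ns: "ns_count n m (chain_matrix n m \<sigma>) = (\<Sum>k<n. R {NS} (2*k) + R {NS} (Suc (2*k)))"
  proof -
    have "ns_count n m (chain_matrix n m \<sigma>) = (\<Sum>q<2*n. row_count m (chain_matrix n m \<sigma>) {NS} (2*n - q))"
      unfolding ns_count_def
      by (rule sum.reindex_bij_witness[of _ "\<lambda>q. 2*n - q" "\<lambda>i. 2*n - i"]) auto
    also have "\<dots> = (\<Sum>q<2*n. R {NS} q)" by (intro sum.cong) (auto simp: R)
    finally show ?thesis by (simp only: sum_pairs)
  qed
  have odd: "(\<Sum>i | i \<in> {1..2*n} \<and> odd i. row_count m (chain_matrix n m \<sigma>) S i) = (\<Sum>k<n. R S (Suc (2*k)))" for S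
    by (rule sum.reindex_bij_witness[of _ "\<lambda>k. 2*n - Suc (2*k)" "\<lambda>i. n - Suc (i div 2)"])
      (auto simp: R[symmetric] elim!: oddE intro!: arg_cong[of _ _ "row_count m (chain_matrix n m \<sigma>) S"])
  have even: "(\<Sum>i | i \<in> {1..2*n} \<and> even i. row_count m (chain_matrix n m \<sigma>) S i) = (\<Sum>k<n. R S (2*k))" for S
    by (rule sum.reindex_bij_witness[of _ "\<lambda>k. 2*n - 2*k" "\<lambda>i. n - i div 2"])
      (auto simp: R[symmetric] elim!: evenE intro!: arg_cong[of _ _ "row_count m (chain_matrix n m \<sigma>) S"])
  have wgt: "ice_wgt n m (chain_matrix n m \<sigma>)
      = (\<Prod>k<n. X (Suc k) 1 ^ R {NE, SE, WE} (Suc (2*k)) * X (Suc k) (- 1) ^ R {NE, SE, WE} (2*k))"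
  proof -
    have "ice_wgt n m (chain_matrix n m \<sigma>)
      = (\<Prod>k<n. X (Suc k) (int (row_count m (chain_matrix n m \<sigma>) {NE, SE, WE} (2*n + 1 - 2*Suc k))
          - int (row_count m (chain_matrix n m \<sigma>) {NE, SE, WE} (2*n + 2 - 2*Suc k))))"
      unfolding ice_wgt_def
      by (rule prod.reindex_bij_witness[of _ Suc "\<lambda>k. k - 1"]) auto
    also have "\<dots> = (\<Prod>k<n. X (Suc k) 1 ^ R {NE, SE, WE} (Suc (2*k)) * X (Suc k) (- 1) ^ R {NE, SE, WE} (2*k))"
    proof (rule prod.cong[OF refl])
      fix k assume "k \<in> {..<n}"
      then have k: "Suc (2*k) < 2*n" "2*k < 2*n" by auto
      have e: "2*n + 1 - 2*Suc k = 2*n - Suc (2*k)" "2*n + 2 - 2*Suc k = 2*n - 2*k" by auto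
      show "X (Suc k) (int (row_count m (chain_matrix n m \<sigma>) {NE, SE, WE} (2*n + 1 - 2*Suc k))
          - int (row_count m (chain_matrix n m \<sigma>) {NE, SE, WE} (2*n + 2 - 2*Suc k)))
        = X (Suc k) 1 ^ R {NE, SE, WE} (Suc (2*k)) * X (Suc k) (- 1) ^ R {NE, SE, WE} (2*k)"
        unfolding e R[OF k(1)] R[OF k(2)] diff_conv_add_uminus X_add X_of_nat X_minus_of_nat ..
    qed
    finally show ?thesis .
  qed
  have "(\<Prod>q<2*n. ice_row_wgt m q (\<sigma> (Suc q)) (\<sigma> q))
    = (\<Prod>k<n. (tt ^ R {NE} (Suc (2*k)) * tt ^ R {SE} (2*k) * tt ^ R {NE, SE, WE} (2*k))
        * ((1 + tt) ^ R {NS} (2*k) * (1 + tt) ^ R {NS} (Suc (2*k)))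
        * (X (Suc k) 1 ^ R {NE, SE, WE} (Suc (2*k)) * X (Suc k) (- 1) ^ R {NE, SE, WE} (2*k)))"
    unfolding prod_pairs ice_row_wgt_def R_def[symmetric]
    by (rule prod.cong) (simp_all add: power_add mult_ac)
  also have "\<dots> = tt ^ (ne_odd n m (chain_matrix n m \<sigma>) + se_even n m (chain_matrix n m \<sigma>) + wgt_even n m (chain_matrix n m \<sigma>))
      * (1 + tt) ^ ns_count n m (chain_matrix n m \<sigma>) * ice_wgt n m (chain_matrix n m \<sigma>)"
    unfolding ne_odd_def se_even_def wgt_even_def odd even ns wgt
    by (simp only: power_add power_sum prod.distrib)
  finally show ?thesis by simp
qed

section \<open>Vertex counts of a row from the parts above and below it\<close>

context
  fixes a b :: "nat \<Rightarrow> nat" and K m :: nat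
  assumes a: "strict_part a" and b: "strict_part b"
    and ab: "\<And>j. a (Suc j) \<le> b j" "\<And>j. b j \<le> a j"
    and a0: "a 0 \<le> m" and beyond: "\<forall>j\<ge>K. a j = 0"
begin

lemma cnt_less_iff: "cnt (parts b) y < cnt (parts a) y \<longleftrightarrow> (\<exists>j. b j \<le> y \<and> y < a j)"
proof -
  \<comment> \<open>The witness \<open>cnt (parts b) y\<close> is the first index whose part in
    \<open>b\<close> does not exceed \<open>y\<close>.\<close>
  have "cnt (parts b) y < cnt (parts a) y \<longleftrightarrow> (\<exists>j. \<not> j < cnt (parts b) y \<and> j < cnt (parts a) y)"
    by (auto intro: exI[of _ "cnt (parts b) y"])
  then show ?thesis by (simp only: less_cnt_parts[OF a] less_cnt_parts[OF b] not_less)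
qed

lemma finite_parts: "strict_part c \<Longrightarrow> finite (parts c)"
  using parts_subset[of c "c 0"] finite_subset by blast

text \<open>NE, SE and WE are the types with an incoming left edge, so the exponent of
  \<open>x\<close> counts occupied horizontal edges.\<close>

lemma vertex_left:
  "vertex (parts a) (parts b) (Suc y) \<in> {NE, SE, WE} \<longleftrightarrow> cnt (parts b) y < cnt (parts a) y"
proof -
  have "interlace (parts a) (parts b)" using interlace_parts[OF a b] ab by blast
  then have "cnt (parts b) y \<le> cnt (parts a) y" "cnt (parts a) y \<le> Suc (cnt (parts b) y)"
    "cnt (parts b) (Suc y) \<le> cnt (parts a) (Suc y)" "cnt (parts a) (Suc y) \<le> Suc (cnt (parts b) (Suc y))"
    by (auto simp: interlace_def)
  then show ?thesis
    unfolding cnt_step[OF finite_parts[OF a], of y] cnt_step[OF finite_parts[OF b], of y] vertex_def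
    by (cases "Suc y \<in> parts a"; cases "Suc y \<in> parts b") auto
qed

lemma vertex_left':
  assumes "0 < j"
  shows "vertex (parts a) (parts b) j \<in> {NE, SE, WE} \<longleftrightarrow> (\<exists>i. b i < j \<and> j \<le> a i)"
proof -
  obtain y where y: "j = Suc y" using assms by (cases j) auto
  show ?thesis unfolding y vertex_left cnt_less_iff by (simp add: less_Suc_eq_le Suc_le_eq)
qed

text \<open>Each particle occupies the edges along its way from \<open>a i\<close> to
  \<open>b i\<close>, and these ways are disjoint because
  \<open>a (Suc i) \<le> b i\<close>.\<close>

lemma row_stat_left: "row_stat m {NE, SE, WE} (parts a) (parts b) = (\<Sum>i<K. a i - b i)"
proof -
  have "{j \<in> {1..m}. vertex (parts a) (parts b) j \<in> {NE, SE, WE}} = (\<Union>i<K. {b i<..a i})"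
  proof (intro equalityI subsetI)
    fix j assume "j \<in> {j \<in> {1..m}. vertex (parts a) (parts b) j \<in> {NE, SE, WE}}"
    then obtain i where i: "b i < j" "j \<le> a i" using vertex_left'[of j] by auto
    then have "i < K" using beyond by (metis le_zero_eq not_less not_less_zero)
    then show "j \<in> (\<Union>i<K. {b i<..a i})" using i by auto
  next
    fix j assume "j \<in> (\<Union>i<K. {b i<..a i})"
    then obtain i where i: "b i < j" "j \<le> a i" by auto
    moreover have "a i \<le> m" using strict_part_le[OF a, of 0 i] a0 by simp
    ultimately show "j \<in> {j \<in> {1..m}. vertex (parts a) (parts b) j \<in> {NE, SE, WE}}"
      using vertex_left'[of j] by auto
  qed
  then have "row_stat m {NE, SE, WE} (parts a) (parts b) = card (\<Union>i<K. {b i<..a i})"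
    by (simp only: row_stat_def)
  also have "\<dots> = (\<Sum>i<K. card {b i<..a i})"
  proof (rule card_UN_disjoint)
    have "{b i<..a i} \<inter> {b j<..a j} = {}" if "i < j" for i j
    proof -
      have "a j \<le> a (Suc i)" using strict_part_le[OF a, of "Suc i" j] that by simp
      then have "a j \<le> b i" using ab(1)[of i] by linarith
      then show ?thesis by auto
    qed
    then show "\<forall>i\<in>{..<K}. \<forall>j\<in>{..<K}. i \<noteq> j \<longrightarrow> {b i<..a i} \<inter> {b j<..a j} = {}"
      by (metis Int_commute linorder_neqE_nat)
  qed auto
  finally show ?thesis by simp
qed

lemma b_pos_less_K: "0 < b i \<Longrightarrow> i < K"
  using beyond ab(2)[of i] by (metis le_zero_eq not_less not_less_zero)

lemma b_le_m: "b i \<le> m"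
  using strict_part_le[OF a, of 0 i] ab(2)[of i] a0 by simp

lemma b_in_parts_a: "0 < b i \<Longrightarrow> b i \<in> parts a \<longleftrightarrow> b i = a i \<or> b i = a (Suc i)"
proof
  assume pos: "0 < b i" and "b i \<in> parts a"
  then obtain l where l: "b i = a l" by (auto simp: parts_def)
  then have "0 < a l" using pos by simp
  have "\<not> l < i"
  proof
    assume "l < i"
    then have "a i < a l" using strict_part_less[OF a] \<open>0 < a l\<close> by blast
    then show False using ab(2)[of i] l by simp
  qed
  moreover have "\<not> Suc i < l"
  proof
    assume "Suc i < l"
    moreover have "0 < a (Suc i)" using strict_part_le[OF a, of "Suc i" l] \<open>0 < a l\<close> calculation by simp
    ultimately have "a l < a (Suc i)" using strict_part_less[OF a] by blast
    then show False using ab(1)[of i] l by simp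
  qed
  ultimately have "l = i \<or> l = Suc i" by linarith
  then show "b i = a i \<or> b i = a (Suc i)" using l by auto
qed (auto simp: parts_def)

lemma row_stat_NS:
  "row_stat m {NS} (parts a) (parts b) = card {i \<in> {..<K}. 0 < b i \<and> b i \<noteq> a i \<and> b i \<noteq> a (Suc i)}"
proof -
  have "{j \<in> {1..m}. vertex (parts a) (parts b) j \<in> {NS}}
    = b ` {i \<in> {..<K}. 0 < b i \<and> b i \<noteq> a i \<and> b i \<noteq> a (Suc i)}" (is "?L = b ` ?R")
  proof (intro equalityI subsetI)
    fix j assume "j \<in> ?L"
    then have "j \<in> parts b" "j \<notin> parts a" by (auto simp: vertex_def split: if_splits)
    then obtain i where "j = b i" "0 < b i" by (auto simp: parts_def)
    then show "j \<in> b ` ?R" using \<open>j \<notin> parts a\<close> b_in_parts_a[of i] b_pos_less_K[of i] by auto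
  next
    fix j assume "j \<in> b ` ?R"
    then obtain i where "j = b i" "0 < b i" "b i \<noteq> a i" "b i \<noteq> a (Suc i)" by auto
    moreover from this have "b i \<in> parts b" "b i \<notin> parts a" using b_in_parts_a[of i] by (auto simp: parts_def)
    ultimately show "j \<in> ?L" using b_le_m[of i] by (auto simp: vertex_def)
  qed
  moreover have "inj_on b ?R" by (rule inj_on_subset[OF strict_part_inj[OF b]]) auto
  ultimately show ?thesis unfolding row_stat_def by (simp only: card_image)
qed

lemma row_stat_NE:
  "row_stat m {NE} (parts a) (parts b) = card {i \<in> {..<K}. 0 < b i \<and> b i \<noteq> a i \<and> b i = a (Suc i)}"
proof -
  \<comment> \<open>At a position present in both levels the right edge separates NE from NW: it is
    occupied when particle \<open>i\<close> has moved, and free when it has stayed.\<close>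
  have less_iff: "cnt (parts b) (b i) < cnt (parts a) (b i) \<longleftrightarrow> b i < a i" if pos: "0 < b i" for i
  proof
    assume "cnt (parts b) (b i) < cnt (parts a) (b i)"
    then obtain l where l: "b l \<le> b i" "b i < a l" unfolding cnt_less_iff by blast
    have "\<not> l < i"
    proof
      assume "l < i"
      moreover have "0 < b l" using strict_part_le[OF b, of l i] pos calculation by simp
      ultimately show False using strict_part_less[OF b, of l i] l(1) by simp
    qed
    moreover have "\<not> i < l"
      using strict_part_le[OF a, of "Suc i" l] ab(1)[of i] l(2) by auto
    ultimately show "b i < a i" using l(2) by (metis linorder_neqE_nat)
  qed (auto simp: cnt_less_iff)
  have "{j \<in> {1..m}. vertex (parts a) (parts b) j \<in> {NE}}
    = b ` {i \<in> {..<K}. 0 < b i \<and> b i \<noteq> a i \<and> b i = a (Suc i)}" (is "?L = b ` ?R")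
  proof (intro equalityI subsetI)
    fix j assume "j \<in> ?L"
    then have j: "j \<in> parts b" "j \<in> parts a" "cnt (parts b) j < cnt (parts a) j"
      by (auto simp: vertex_def split: if_splits)
    then obtain i where i: "j = b i" "0 < b i" by (auto simp: parts_def)
    then have "b i < a i" "b i = a i \<or> b i = a (Suc i)"
      using less_iff[of i] j b_in_parts_a[of i] by auto
    then show "j \<in> b ` ?R" using i b_pos_less_K[of i] by auto
  next
    fix j assume "j \<in> b ` ?R"
    then obtain i where i: "j = b i" "0 < b i" "b i \<noteq> a i" "b i = a (Suc i)" by auto
    then have "b i < a i" using ab(2)[of i] by simp
    then have "cnt (parts b) j < cnt (parts a) j" using less_iff[of i] i by simp
    moreover have "j \<in> parts b" unfolding i(1) parts_def using i(2) by blast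
    moreover have "j \<in> parts a" using b_in_parts_a[of i] i by simp
    ultimately show "j \<in> ?L" using b_le_m[of i] i by (auto simp: vertex_def)
  qed
  moreover have "inj_on b ?R" by (rule inj_on_subset[OF strict_part_inj[OF b]]) auto
  ultimately show ?thesis unfolding row_stat_def by (simp only: card_image)
qed

text \<open>Counted by complement: among the vertices with incoming left edge, NE and WE sit at the
  starting points \<open>a i\<close>, one for each particle that moves.\<close>

lemma row_stat_SE:
  "row_stat m {SE} (parts a) (parts b) + card {i \<in> {..<K}. b i < a i} = (\<Sum>i<K. a i - b i)"
proof -
  have "{j \<in> {1..m}. vertex (parts a) (parts b) j \<in> {NE, WE}} = a ` {i \<in> {..<K}. b i < a i}" (is "?L = a ` ?R")
  proof (intro equalityI subsetI)
    fix j assume j: "j \<in> ?L"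
    then have "j \<in> parts a" by (auto simp: vertex_def split: if_splits)
    then obtain i where i: "j = a i" "0 < a i" by (auto simp: parts_def)
    obtain l where l: "b l < j" "j \<le> a l" using vertex_left'[of j] j by auto
    have "\<not> l < i"
      using ab(1)[of l] strict_part_le[OF a, of "Suc l" i] l i by auto
    moreover have "\<not> i < l" using strict_part_less[OF a, of i l] i l by auto
    ultimately have "b i < a i" using l i by (metis linorder_neqE_nat)
    moreover have "i < K" using beyond i by (metis less_irrefl not_less)
    ultimately show "j \<in> a ` ?R" using i by auto
  next
    fix j assume "j \<in> a ` ?R"
    then obtain i where i: "j = a i" "b i < a i" by auto
    then have "vertex (parts a) (parts b) j \<in> {NE, SE, WE}" using vertex_left'[of j] by auto
    moreover have "j \<in> parts a" using i by (auto simp: parts_def)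
    ultimately have "vertex (parts a) (parts b) j \<in> {NE, WE}" by (auto simp: vertex_def split: if_splits)
    moreover have "j \<in> {1..m}" using i strict_part_le[OF a, of 0 i] a0 by auto
    ultimately show "j \<in> ?L" by simp
  qed
  moreover have "inj_on a ?R" by (rule inj_on_subset[OF strict_part_inj[OF a]]) auto
  ultimately have "row_stat m {NE, WE} (parts a) (parts b) = card ?R"
    unfolding row_stat_def by (simp only: card_image)
  moreover have "row_stat m {SE} (parts a) (parts b) + row_stat m {NE, WE} (parts a) (parts b)
      = row_stat m {NE, SE, WE} (parts a) (parts b)"
    unfolding row_stat_def by (subst card_Un_disjoint[symmetric]) (auto intro: arg_cong[of _ _ card])
  ultimately show ?thesis using row_stat_left by simp
qed

end

section \<open>Row weights as products over particles, and the ice recursion\<close>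

lemma prod_if_card: "(\<Prod>i<n. if P i then t else 1) = t ^ card {i \<in> {..<n}. P i}"
  for t :: "'a::comm_monoid_mult" and n :: nat
  using prod.inter_filter[of "{..<n}" "\<lambda>_. t" P] by simp

definition xvar :: "nat \<Rightarrow> laurent" where "xvar k = X (Suc k) 1"
definition xinv :: "nat \<Rightarrow> laurent" where "xinv k = X (Suc k) (- 1)"
definition uvar :: "nat \<Rightarrow> laurent" where "uvar k = tt\<^sup>2 * xinv k"

lemma xvar_xinv: "xvar k * xinv k = 1"
  by (simp add: xvar_def xinv_def X_inverse)

text \<open>A particle that leaves through the left boundary ends at position 0, which is no vertex;
  the interval weight nevertheless charges \<open>t\<close> for reaching its left end. This is the
  correcting factor.\<close>

lemma ice_row_wgt_odd:
  assumes ab: "\<And>j. j \<le> k \<Longrightarrow> a (Suc j) < a j" "\<And>j. k < j \<Longrightarrow> a j = 0" "a 0 \<le> m"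
    and b: "b \<in> tuples (Suc k) (\<lambda>j. {a (Suc j)..a j})" "\<forall>j<k. b (Suc j) < b j"
  shows "ice_row_wgt m (Suc (2*k)) (parts a) (parts b) * (if b k = 0 then tt else 1)
    = (\<Prod>j<Suc k. ice_step_wgt (xvar k) (tt * xvar k) (a j) (a (Suc j)) (b j))"
proof -
  have sa: "strict_part a"
    unfolding strict_part_def
  proof
    fix j
    show "a (Suc j) < a j \<or> a (Suc j) = 0" using ab by (cases "j \<le> k") auto
  qed
  have sb: "strict_part b"
    unfolding strict_part_def
  proof
    fix j
    show "b (Suc j) < b j \<or> b (Suc j) = 0" using b by (cases "j < k") (auto simp: tuples_def)
  qed
  have i1: "a (Suc j) \<le> b j" for j using b ab(2)[of "Suc j"] by (cases "j < Suc k") (auto simp: tuples_def)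
  have i2: "b j \<le> a j" for j using b by (cases "j < Suc k") (auto simp: tuples_def)
  have aK: "\<forall>j\<ge>Suc k. a j = 0" using ab(2) by simp
  note stat = row_stat_left[where K = "Suc k", OF sa sb i1 i2 ab(3) aK] row_stat_NS[where K = "Suc k", OF sa sb i1 i2 ab(3) aK]
    row_stat_NE[where K = "Suc k", OF sa sb i1 i2 ab(3) aK]
  define f where "f i = xvar k ^ (a i - b i) * (if 0 < b i \<and> b i \<noteq> a i \<and> b i \<noteq> a (Suc i) then 1 + tt else 1)
    * (if 0 < b i \<and> b i \<noteq> a i \<and> b i = a (Suc i) then tt else 1)" for i
  have "ice_row_wgt m (Suc (2*k)) (parts a) (parts b) = (\<Prod>i<Suc k. f i)"
    unfolding ice_row_wgt_def stat f_def prod.distrib prod_if_card power_sum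
    by (simp add: xvar_def mult_ac)
  moreover have step: "f i = ice_step_wgt (xvar k) (tt * xvar k) (a i) (a (Suc i)) (b i)" if "0 < b i" for i
  proof (cases "b i = a i")
    case False
    then obtain d where "a i = Suc (b i + d)" using i2[of i] less_imp_Suc_add[of "b i" "a i"] by (auto simp: le_less)
    then show ?thesis using that by (simp add: f_def ice_step_wgt_def algebra_simps)
  qed (simp add: f_def ice_step_wgt_def)
  moreover have "(\<Prod>i<k. f i) = (\<Prod>i<k. ice_step_wgt (xvar k) (tt * xvar k) (a i) (a (Suc i)) (b i))"
  proof (rule prod.cong[OF refl], rule step)
    fix i assume "i \<in> {..<k}"
    then show "0 < b i" using b(2) by (metis lessThan_iff less_nat_zero_code gr0I)
  qed
  moreover have "f k * (if b k = 0 then tt else 1) = ice_step_wgt (xvar k) (tt * xvar k) (a k) (a (Suc k)) (b k)"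
  proof (cases "b k = 0")
    case True
    obtain d where "a k = Suc d" using ab(1)[of k] by (cases "a k") auto
    then show ?thesis using True ab(2)[of "Suc k"] by (simp add: f_def ice_step_wgt_def mult_ac)
  qed (simp add: step)
  ultimately show ?thesis by (simp add: mult.assoc)
qed

lemma ice_row_wgt_even:
  assumes b: "\<And>j. j < k \<Longrightarrow> b (Suc j) < b j" "\<And>j. k < j \<Longrightarrow> b j = 0" "b 0 \<le> m"
    and c: "c \<in> tuples k (\<lambda>j. {b (Suc j)..b j})" "\<forall>j<k. c (Suc j) < c j"
  shows "ice_row_wgt m (2*k) (parts b) (parts c) * (if b k = 0 then 1 else tt)
    = uvar k ^ b k * (\<Prod>j<k. ice_step_wgt (uvar k) (tt * xinv k) (b j) (b (Suc j)) (c j))"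
proof -
  have sb: "strict_part b"
    unfolding strict_part_def
  proof
    fix j
    show "b (Suc j) < b j \<or> b (Suc j) = 0" using b by (cases "j < k") auto
  qed
  have sc: "strict_part c"
    unfolding strict_part_def
  proof
    fix j
    show "c (Suc j) < c j \<or> c (Suc j) = 0" using c by (cases "j < k") (auto simp: tuples_def)
  qed
  have i1: "b (Suc j) \<le> c j" for j using c b(2)[of "Suc j"] by (cases "j < k") (auto simp: tuples_def)
  have i2: "c j \<le> b j" for j using c by (cases "j < k") (auto simp: tuples_def)
  have bK: "\<forall>j\<ge>Suc k. b j = 0" using b(2) by simp
  note stat = row_stat_left[where K = "Suc k", OF sb sc i1 i2 b(3) bK] row_stat_NS[where K = "Suc k", OF sb sc i1 i2 b(3) bK]
  note SE = row_stat_SE[where K = "Suc k", OF sb sc i1 i2 b(3) bK]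
  \<comment> \<open>The exponent of \<open>t\<close> per particle: the distance from
    \<open>wgt_even\<close>, and the distance minus one from the SE vertices if it moves.\<close>
  define e where "e i = (if c i < b i then 2 * (b i - c i) - 1 else 0)" for i
  have "(\<Sum>i<Suc k. e i) + card {i \<in> {..<Suc k}. c i < b i} = (\<Sum>i<Suc k. e i + of_bool (c i < b i))"
    unfolding sum.distrib by (simp only: sum_of_bool_eq finite_lessThan of_nat_id Int_def mem_Collect_eq)
  also have "\<dots> = (\<Sum>i<Suc k. 2 * (b i - c i))"
    by (rule sum.cong) (auto simp: e_def)
  finally have e: "row_stat m {SE} (parts b) (parts c) + (\<Sum>i<Suc k. b i - c i) = (\<Sum>i<Suc k. e i)"
    using SE by (simp only: flip: sum_distrib_left)
  define f where "f i = (if 0 < c i \<and> c i \<noteq> b i \<and> c i \<noteq> b (Suc i) then 1 + tt else 1)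
    * (tt ^ e i * xinv k ^ (b i - c i))" for i
  have "ice_row_wgt m (2*k) (parts b) (parts c) = (\<Prod>i<Suc k. f i)"
    unfolding ice_row_wgt_def stat e f_def prod.distrib prod_if_card power_sum
    by (simp add: xinv_def)
  moreover have "(\<Prod>i<k. f i) = (\<Prod>i<k. ice_step_wgt (uvar k) (tt * xinv k) (b i) (b (Suc i)) (c i))"
  proof (rule prod.cong[OF refl])
    fix i assume "i \<in> {..<k}"
    then have pos: "0 < c i" using c(2) by (metis lessThan_iff less_nat_zero_code gr0I)
    show "f i = ice_step_wgt (uvar k) (tt * xinv k) (b i) (b (Suc i)) (c i)"
    proof (cases "c i = b i")
      case False
      then obtain d where "b i = Suc (c i + d)" using i2[of i] less_imp_Suc_add[of "c i" "b i"] by (auto simp: le_less)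
      then show ?thesis using pos
        by (simp add: f_def e_def ice_step_wgt_def uvar_def power_mult_distrib algebra_simps power2_eq_square
            power_add mult_2 mult_2_right)
    qed (simp add: f_def e_def ice_step_wgt_def)
  qed
  \<comment> \<open>The lost particle has \<open>c k = 0\<close>, hence the exponent
    \<open>2 * b k - 1\<close>; one more \<open>t\<close> completes the power of
    \<open>t^2 / x\<close>.\<close>
  moreover have "f k * (if b k = 0 then 1 else tt) = uvar k ^ b k"
  proof -
    have ck: "c k = 0" using c(1) by (simp add: tuples_def)
    show ?thesis
    proof (cases "b k")
      case (Suc d)
      then show ?thesis using ck
        by (simp add: f_def e_def uvar_def power_mult_distrib algebra_simps power2_eq_square
            power_add mult_2 mult_2_right)
    qed (simp add: f_def e_def ck)
  qed
  ultimately show ?thesis by (simp add: mult_ac)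
qed

(* If the last particle is lost in the odd row (b k = 0), its weight x^(a k) falls short of the uniform
   interval weight by a factor tt; if it is lost in the even row, its weight falls short of u^(b k) by
   the same factor. This is why the recursion is stated for tt times the sum. *)
lemma walk_sum_ice_rec:
  assumes a: "\<And>j. j \<le> k \<Longrightarrow> a (Suc j) < a j" "\<And>j. k < j \<Longrightarrow> a j = 0" "a 0 \<le> m"
  shows "tt * walk_sum (ice_step m) (ice_row_wgt m) (2 * Suc k) (parts a)
    = (\<Sum>b\<in>{b\<in>tuples (Suc k) (\<lambda>j. {a (Suc j)..a j}). \<forall>j<k. b (Suc j) < b j}.
        (\<Prod>j<Suc k. ice_step_wgt (xvar k) (tt * xvar k) (a j) (a (Suc j)) (b j)) *
        (uvar k ^ b k *
          (\<Sum>c\<in>{c\<in>tuples k (\<lambda>j. {b (Suc j)..b j}). \<forall>j<k. c (Suc j) < c j}.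
            (\<Prod>j<k. ice_step_wgt (uvar k) (tt * xinv k) (b j) (b (Suc j)) (c j)) *
            walk_sum (ice_step m) (ice_row_wgt m) (2*k) (parts c))))"
proof -
  let ?F = "\<lambda>C. walk_sum (ice_step m) (ice_row_wgt m) (2*k) C"
  have "walk_sum (ice_step m) (ice_row_wgt m) (2 * Suc k) (parts a)
      = (\<Sum>B | ice_step m (Suc (2*k)) (parts a) B. ice_row_wgt m (Suc (2*k)) (parts a) B *
          (\<Sum>C | ice_step m (2*k) B C. ice_row_wgt m (2*k) B C * ?F C))"
    by simp
  also have "\<dots> = (\<Sum>b\<in>{b\<in>tuples (Suc k) (\<lambda>j. {a (Suc j)..a j}). \<forall>j<k. b (Suc j) < b j}.
      ice_row_wgt m (Suc (2*k)) (parts a) (parts b) *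
          (\<Sum>C | ice_step m (2*k) (parts b) C. ice_row_wgt m (2*k) (parts b) C * ?F C))"
    by (rule sum.reindex_bij_betw[OF bij_betw_ice_step_odd[OF a], symmetric])
  finally have *: "walk_sum (ice_step m) (ice_row_wgt m) (2 * Suc k) (parts a) = \<dots>" .
  show ?thesis
    unfolding *
  proof (subst sum_distrib_left, rule sum.cong[OF refl])
    fix b assume "b \<in> {b\<in>tuples (Suc k) (\<lambda>j. {a (Suc j)..a j}). \<forall>j<k. b (Suc j) < b j}"
    then have b: "b \<in> tuples (Suc k) (\<lambda>j. {a (Suc j)..a j})" "\<forall>j<k. b (Suc j) < b j" by auto
    have b': "\<And>j. j < k \<Longrightarrow> b (Suc j) < b j" "\<And>j. k < j \<Longrightarrow> b j = 0" using b by (auto simp: tuples_def)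
    have "b 0 \<le> a 0" using b(1) by (auto simp: tuples_def)
    then have b0: "b 0 \<le> m" using a(3) by simp
    let ?S = "{c\<in>tuples k (\<lambda>j. {b (Suc j)..b j}). \<forall>j<k. c (Suc j) < c j}"
    have sets: "(\<Sum>C | ice_step m (2*k) (parts b) C. ice_row_wgt m (2*k) (parts b) C * ?F C)
        = (\<Sum>c\<in>?S. ice_row_wgt m (2*k) (parts b) (parts c) * ?F (parts c))"
      by (rule sum.reindex_bij_betw[OF bij_betw_ice_step_even[OF b' b0], symmetric])
    have inner: "(if b k = 0 then 1 else tt) *
        (\<Sum>C | ice_step m (2*k) (parts b) C. ice_row_wgt m (2*k) (parts b) C * ?F C) = uvar k ^ b k * (\<Sum>c\<in>?S.
        (\<Prod>j<k. ice_step_wgt (uvar k) (tt * xinv k) (b j) (b (Suc j)) (c j)) * ?F (parts c))"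
      unfolding sets sum_distrib_left
    proof (rule sum.cong[OF refl])
      fix c assume "c \<in> ?S"
      then have "ice_row_wgt m (2*k) (parts b) (parts c) * (if b k = 0 then 1 else tt)
        = uvar k ^ b k * (\<Prod>j<k. ice_step_wgt (uvar k) (tt * xinv k) (b j) (b (Suc j)) (c j))"
        by (intro ice_row_wgt_even b' b0) auto
      then show "(if b k = 0 then 1 else tt) * (ice_row_wgt m (2*k) (parts b) (parts c) * ?F (parts c))
        = uvar k ^ b k * ((\<Prod>j<k. ice_step_wgt (uvar k) (tt * xinv k) (b j) (b (Suc j)) (c j)) * ?F (parts c))"
        by (simp only: mult.assoc[symmetric] mult.commute[of "if b k = 0 then 1 else tt"])
    qed
    have odd: "ice_row_wgt m (Suc (2*k)) (parts a) (parts b) * (if b k = 0 then tt else 1)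
        = (\<Prod>j<Suc k. ice_step_wgt (xvar k) (tt * xvar k) (a j) (a (Suc j)) (b j))"
      by (rule ice_row_wgt_odd[OF a b])
    \<comment> \<open>The loss happens in exactly one of the two rows, and that row takes the factor
      \<open>tt\<close>.\<close>
    have "tt * (ice_row_wgt m (Suc (2*k)) (parts a) (parts b) *
          (\<Sum>C | ice_step m (2*k) (parts b) C. ice_row_wgt m (2*k) (parts b) C * ?F C))
      = (ice_row_wgt m (Suc (2*k)) (parts a) (parts b) * (if b k = 0 then tt else 1)) *
        ((if b k = 0 then 1 else tt) * (\<Sum>C | ice_step m (2*k) (parts b) C. ice_row_wgt m (2*k) (parts b) C * ?F C))"
      by (cases "b k = 0") (simp_all add: mult_ac)
    then show "tt * (ice_row_wgt m (Suc (2*k)) (parts a) (parts b) *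
          (\<Sum>C | ice_step m (2*k) (parts b) C. ice_row_wgt m (2*k) (parts b) C * ?F C))
      = (\<Prod>j<Suc k. ice_step_wgt (xvar k) (tt * xvar k) (a j) (a (Suc j)) (b j)) * (uvar k ^ b k * (\<Sum>c\<in>?S.
          (\<Prod>j<k. ice_step_wgt (uvar k) (tt * xinv k) (b j) (b (Suc j)) (c j)) * ?F (parts c)))"
      unfolding inner odd .
  qed
qed

section \<open>The ice sum as a determinant\<close>

definition weyl_det :: "nat \<Rightarrow> (nat \<Rightarrow> nat) \<Rightarrow> laurent" where
  "weyl_det k a = detf k (\<lambda>i j. hsum (xvar i) (uvar i) (a j))"

text \<open>A Vandermonde product in \<open>x_i + t^2 / x_i\<close>, the value of
  \<open>weyl_det\<close> for the bare staircase: \<open>hsum\<close> is a monic polynomial in this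
  sum, of degree one less than the part.\<close>

definition vander :: "nat \<Rightarrow> laurent" where
  "vander n = (\<Prod>k<n. \<Prod>i<k. (xvar i + uvar i) - (xvar k + uvar k))"

text \<open>\<open>D_sp\<close> regrouped by the larger index of each pair, the form in which the
  branching step produces it.\<close>

definition deformed :: "nat \<Rightarrow> laurent" where
  "deformed n = (\<Prod>k<n. xvar k * (1 + tt * (xinv k)\<^sup>2) * (\<Prod>i<k. xvar i + uvar i + tt * (xvar k + xinv k)))"

lemma tt_nonzero: "tt \<noteq> 0"
proof
  assume "tt = 0"
  then have "Poly_Mapping.lookup tt 0 = 0" by simp
  then show False by (simp add: tt_def)
qed

text \<open>The top pair of rows carries the last variable. Passing from \<open>vander k\<close> to
  \<open>vander (Suc k)\<close> supplies exactly the differences that \<open>ice_det_step\<close>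
  consumes.\<close>

lemma ice_walk_sum:
  assumes "\<And>j. j < k \<Longrightarrow> a (Suc j) < a j" "\<And>j. k \<le> j \<Longrightarrow> a j = 0" "a 0 \<le> m"
  shows "vander k * walk_sum (ice_step m) (ice_row_wgt m) (2*k) (parts a) = deformed k * weyl_det k a"
  using assms
proof (induction k arbitrary: a)
  case 0
  then show ?case by (simp add: vander_def deformed_def weyl_det_def)
next
  case (Suc k)
  let ?F = "\<lambda>C. walk_sum (ice_step m) (ice_row_wgt m) (2*k) C"
  let ?S = "{b\<in>tuples (Suc k) (\<lambda>j. {a (Suc j)..a j}). \<forall>j<k. b (Suc j) < b j}"
  let ?T = "\<lambda>b. {c\<in>tuples k (\<lambda>j. {b (Suc j)..b j}). \<forall>j<k. c (Suc j) < c j}"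
  let ?w1 = "\<lambda>b. \<Prod>j<Suc k. ice_step_wgt (xvar k) (tt * xvar k) (a j) (a (Suc j)) (b j)"
  let ?w2 = "\<lambda>b c. \<Prod>j<k. ice_step_wgt (uvar k) (tt * xinv k) (b j) (b (Suc j)) (c j)"
  have a: "\<And>j. j \<le> k \<Longrightarrow> a (Suc j) < a j" "\<And>j. k < j \<Longrightarrow> a j = 0" "a 0 \<le> m"
    using Suc.prems by auto
  have a_last: "a (Suc k) = 0" using a(2) by simp
  have "vander k * (tt * walk_sum (ice_step m) (ice_row_wgt m) (2 * Suc k) (parts a))
      = (\<Sum>b\<in>?S. ?w1 b * (uvar k ^ b k * (\<Sum>c\<in>?T b. ?w2 b c * (vander k * ?F (parts c)))))"
    by (subst walk_sum_ice_rec[OF a]) (simp_all only: sum_distrib_left mult.left_commute[of "vander k"])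
  also have "\<dots> = (\<Sum>b\<in>?S. ?w1 b * (uvar k ^ b k * (\<Sum>c\<in>?T b. ?w2 b c * (deformed k * weyl_det k c))))"
  proof (rule sum.cong[OF refl])
    fix b assume b: "b \<in> ?S"
    have "(\<Sum>c\<in>?T b. ?w2 b c * (vander k * ?F (parts c))) = (\<Sum>c\<in>?T b. ?w2 b c * (deformed k * weyl_det k c))"
    proof (rule sum.cong[OF refl])
      fix c assume c: "c \<in> ?T b"
      have "c 0 \<le> b 0" using c by (cases k) (auto simp: tuples_def)
      moreover have "b 0 \<le> a 0" using b by (auto simp: tuples_def)
      ultimately have "vander k * ?F (parts c) = deformed k * weyl_det k c"
        using c a(3) by (intro Suc.IH) (auto simp: tuples_def)
      then show "?w2 b c * (vander k * ?F (parts c)) = ?w2 b c * (deformed k * weyl_det k c)" by simp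
    qed
    then show "?w1 b * (uvar k ^ b k * (\<Sum>c\<in>?T b. ?w2 b c * (vander k * ?F (parts c))))
      = ?w1 b * (uvar k ^ b k * (\<Sum>c\<in>?T b. ?w2 b c * (deformed k * weyl_det k c)))" by simp
  qed
  also have "\<dots> = deformed k * (\<Sum>b\<in>?S. ?w1 b * (uvar k ^ b k * (\<Sum>c\<in>?T b. ?w2 b c * weyl_det k c)))"
    by (simp only: sum_distrib_left mult.left_commute[of "deformed k"])
  finally have rec: "vander k * (tt * walk_sum (ice_step m) (ice_row_wgt m) (2 * Suc k) (parts a)) = \<dots>" .
  have det: "(\<Prod>i<k. (xvar i + uvar i) - (xvar k + uvar k)) *
      (\<Sum>b\<in>?S. ?w1 b * (uvar k ^ b k * (\<Sum>c\<in>?T b. ?w2 b c * weyl_det k c)))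
    = (uvar k + tt * xvar k) * (\<Prod>i<k. xvar i + uvar i + tt * (xvar k + xinv k)) * weyl_det (Suc k) a"
    unfolding weyl_det_def
    by (rule ice_det_step) (simp_all add: xvar_xinv uvar_def a(1) a_last)
  have van: "vander (Suc k) = vander k * (\<Prod>i<k. (xvar i + uvar i) - (xvar k + uvar k))"
    by (simp add: vander_def)
  \<comment> \<open>The scalar of the new row yields the diagonal factor of \<open>D_sp\<close>
    together with the surplus \<open>tt\<close> of the recursion.\<close>
  have "uvar k + tt * xvar k = tt * (xvar k * (1 + tt * (xinv k)\<^sup>2))"
    using xvar_xinv[of k] by (simp add: uvar_def algebra_simps power2_eq_square)
  then have def: "tt * deformed (Suc k)
      = deformed k * ((uvar k + tt * xvar k) * (\<Prod>i<k. xvar i + uvar i + tt * (xvar k + xinv k)))"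
    by (simp add: deformed_def mult_ac)
  have "tt * (vander (Suc k) * walk_sum (ice_step m) (ice_row_wgt m) (2 * Suc k) (parts a))
      = (\<Prod>i<k. (xvar i + uvar i) - (xvar k + uvar k)) *
        (vander k * (tt * walk_sum (ice_step m) (ice_row_wgt m) (2 * Suc k) (parts a)))"
    unfolding van by (simp only: mult_ac)
  also have "\<dots> = deformed k * ((\<Prod>i<k. (xvar i + uvar i) - (xvar k + uvar k)) *
      (\<Sum>b\<in>?S. ?w1 b * (uvar k ^ b k * (\<Sum>c\<in>?T b. ?w2 b c * weyl_det k c))))"
    unfolding rec by (rule mult.left_commute)
  also have "\<dots> = tt * (deformed (Suc k) * weyl_det (Suc k) a)"
    unfolding det by (simp only: mult.assoc[symmetric] def)
  finally show ?case using tt_nonzero by simp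
qed

section \<open>Symplectic tableaux\<close>

definition cells :: "(nat \<Rightarrow> nat) \<Rightarrow> (nat \<times> nat) set" where
  "cells b = young_diagram (\<lambda>i. b (i - 1))"

text \<open>Bounding the rank allows half steps: \<open>r = 2k + 1\<close> admits all letters up to
  \<open>Unbar k\<close>, and \<open>r = 2k + 2\<close> also \<open>Bar (k + 1)\<close>. The lower
  bound 2 excludes the letters with index 0.\<close>

definition tableaux :: "nat \<Rightarrow> (nat \<Rightarrow> nat) \<Rightarrow> (nat \<times> nat \<Rightarrow> sp_letter) set" where
  "tableaux r b =
    {T \<in> cells b \<rightarrow>\<^sub>E {l. 2 \<le> letter_rank l \<and> letter_rank l \<le> r}.
      (\<forall>i j j'. (i, j) \<in> cells b \<longrightarrow> (i, j') \<in> cells b \<longrightarrow> j < j' \<longrightarrow> T (i, j) \<le> T (i, j')) \<and>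
      (\<forall>i i' j. (i, j) \<in> cells b \<longrightarrow> (i', j) \<in> cells b \<longrightarrow> i < i' \<longrightarrow> T (i, j) < T (i', j)) \<and>
      (\<forall>i. (i, 1) \<in> cells b \<longrightarrow> Bar i \<le> T (i, 1))}"

fun letter_wgt :: "sp_letter \<Rightarrow> laurent" where
  "letter_wgt (Bar k) = tt\<^sup>2 * X k (- 1)"
| "letter_wgt (Unbar k) = X k 1"

definition tableau_sum :: "nat \<Rightarrow> (nat \<Rightarrow> nat) \<Rightarrow> laurent" where
  "tableau_sum r b = (\<Sum>T\<in>tableaux r b. \<Prod>p\<in>cells b. letter_wgt (T p))"

lemma cells_iff: "(i, j) \<in> cells b \<longleftrightarrow> 1 \<le> i \<and> 1 \<le> j \<and> j \<le> b (i - 1)"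
  by (simp add: cells_def young_diagram_def)

lemma cells_eq_image: "(\<And>j. K \<le> j \<Longrightarrow> b j = 0) \<Longrightarrow> cells b = (\<lambda>(i, j). (Suc i, j)) ` (SIGMA i:{..<K}. {0<..b i})"
proof (intro equalityI subsetI)
  fix p assume b: "\<And>j. K \<le> j \<Longrightarrow> b j = 0" and "p \<in> cells b"
  then obtain i j where p: "p = (i, j)" "1 \<le> i" "1 \<le> j" "j \<le> b (i - 1)" by (cases p) (auto simp: cells_iff)
  then have "i - 1 < K" using b[of "i - 1"] by (metis le_zero_eq not_less not_one_le_zero)
  then show "p \<in> (\<lambda>(i, j). (Suc i, j)) ` (SIGMA i:{..<K}. {0<..b i})"
    using p by (intro image_eqI[of _ _ "(i - 1, j)"]) auto
qed (auto simp: cells_iff)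

lemma finite_cells: "(\<And>j. K \<le> j \<Longrightarrow> b j = 0) \<Longrightarrow> finite (cells b)"
  using cells_eq_image[of K b] by simp

lemma finite_letters: "finite {l. 2 \<le> letter_rank l \<and> letter_rank l \<le> r}"
  by (rule finite_imageD[of letter_rank], rule finite_subset[of _ "{..r}"])
    (auto intro!: inj_onI letter_rank_inject)

lemma finite_tableaux: "(\<And>j. K \<le> j \<Longrightarrow> b j = 0) \<Longrightarrow> finite (tableaux r b)"
  unfolding tableaux_def using finite_cells[of K b] finite_letters[of r]
  by (auto intro!: finite_subset[OF _ finite_PiE[of "cells b" "\<lambda>_. {l. 2 \<le> letter_rank l \<and> letter_rank l \<le> r}"]])

lemma sp_letters_rank: "sp_letters n = {l. 2 \<le> letter_rank l \<and> letter_rank l \<le> 2*n + 1}"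
proof (intro equalityI subsetI)
  fix l assume "l \<in> {l. 2 \<le> letter_rank l \<and> letter_rank l \<le> 2*n + 1}"
  then show "l \<in> sp_letters n" by (cases l) (auto simp: sp_letters_def)
qed (auto simp: sp_letters_def)

lemma sp_char_tableau_sum:
  assumes lam: "partition_at_most n lam"
  shows "sp_char n lam = tableau_sum (2*n + 1) (\<lambda>j. lam (Suc j))"
proof -
  let ?b = "\<lambda>j. lam (Suc j)"
  have cells: "cells ?b = young_diagram lam"
    by (auto simp: cells_def young_diagram_def)
  have fin: "finite (cells ?b)"
    using lam by (intro finite_cells[of n]) (auto simp: partition_at_most_def)
  have tabs: "sp_tableaux n lam = tableaux (2*n + 1) ?b"
    by (simp add: sp_tableaux_def tableaux_def cells sp_letters_rank)
  have "tt ^ (2 * bar_count n lam T) * tableau_wgt n lam T = (\<Prod>p\<in>cells ?b. letter_wgt (T p))"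
    if T: "T \<in> sp_tableaux n lam" for T
  proof -
    have fl: "finite (sp_letters n)" by (simp add: sp_letters_def)
    have "T ` cells ?b \<subseteq> sp_letters n" using T by (auto simp: sp_tableaux_def cells)
    then have "(\<Prod>p\<in>cells ?b. letter_wgt (T p))
        = (\<Prod>l\<in>sp_letters n. \<Prod>p\<in>{p \<in> cells ?b. T p = l}. letter_wgt (T p))"
      by (rule prod.group[OF fin fl, symmetric])
    also have "\<dots> = (\<Prod>l\<in>sp_letters n. letter_wgt l ^ letter_count lam T l)"
      by (intro prod.cong refl) (simp add: letter_count_def cells)
    also have "\<dots> = (\<Prod>k=1..n. letter_wgt (Bar k) ^ letter_count lam T (Bar k))
        * (\<Prod>k=1..n. letter_wgt (Unbar k) ^ letter_count lam T (Unbar k))"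
      unfolding sp_letters_def
      by (subst prod.union_disjoint) (auto simp: prod.reindex inj_on_def)
    also have "\<dots> = (\<Prod>k=1..n. tt ^ (2 * letter_count lam T (Bar k)))
        * (\<Prod>k=1..n. X k 1 ^ letter_count lam T (Unbar k) * X k (- 1) ^ letter_count lam T (Bar k))"
      by (simp add: power_mult_distrib power_mult prod.distrib mult_ac)
    also have "\<dots> = tt ^ (2 * bar_count n lam T) * tableau_wgt n lam T"
      unfolding bar_count_def tableau_wgt_def diff_conv_add_uminus X_add X_of_nat X_minus_of_nat
      by (simp add: sum_distrib_left power_sum)
    finally show ?thesis by simp
  qed
  then show ?thesis unfolding sp_char_def tableau_sum_def tabs by simp
qed

section \<open>Removing the largest letter\<close>

definition glue :: "sp_letter \<Rightarrow> (nat \<Rightarrow> nat) \<Rightarrow> (nat \<Rightarrow> nat) \<times> (nat \<times> nat \<Rightarrow> sp_letter) \<Rightarrow> nat \<times> nat \<Rightarrow> sp_letter" where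
  "glue l b = (\<lambda>(c, T). restrict (\<lambda>p. if p \<in> cells c then T p else l) (cells b))"

definition cut :: "nat \<Rightarrow> (nat \<Rightarrow> nat) \<Rightarrow> (nat \<times> nat \<Rightarrow> sp_letter) \<Rightarrow> nat \<Rightarrow> nat" where
  "cut r b T j = card {q \<in> {1..b j}. letter_rank (T (Suc j, q)) \<le> r}"

text \<open>Rows increase weakly, so the entries of small rank form an initial segment of each row
  and their number determines it.\<close>

lemma cells_cut:
  assumes T: "T \<in> tableaux r' b"
  shows "p \<in> cells (cut r b T) \<longleftrightarrow> p \<in> cells b \<and> letter_rank (T p) \<le> r"
proof -
  obtain i q where p: "p = (i, q)" by (cases p)
  show ?thesis
  proof (cases i)
    case (Suc j)
    have down: "letter_rank (T (Suc j, q)) \<le> r"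
      if "letter_rank (T (Suc j, q')) \<le> r" "q < q'" "q' \<le> b j" "1 \<le> q" for q q'
    proof -
      have "T (Suc j, q) \<le> T (Suc j, q')" using T that by (auto simp: tableaux_def cells_iff)
      then show ?thesis using that(1) by (simp add: less_eq_sp_letter_def)
    qed
    define S where "S = {q \<in> {1..b j}. letter_rank (T (Suc j, q)) \<le> r}"
    have S: "S \<subseteq> {1..b j}" "finite S" by (auto simp: S_def)
    have closed: "q \<in> S" if "q' \<in> S" "1 \<le> q" "q \<le> q'" for q q'
      using that down[of q' q] by (cases "q = q'") (auto simp: S_def)
    have "S = {1..card S}"
    proof (cases "S = {}")
      case False
      then have "Max S \<in> S" using S(2) by simp
      have "S = {1..Max S}"
      proof (intro equalityI subsetI)
        fix q assume "q \<in> S"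
        then show "q \<in> {1..Max S}" using Max_ge[OF S(2)] S(1) by auto
      next
        fix q assume "q \<in> {1..Max S}"
        then show "q \<in> S" using closed[OF \<open>Max S \<in> S\<close>] by auto
      qed
      moreover from arg_cong[OF this, of card] have "card S = Max S" by simp
      ultimately show ?thesis by simp
    qed simp
    then have "q \<in> S \<longleftrightarrow> q \<in> {1..card S}" by (rule arg_cong)
    then have "q \<in> S \<longleftrightarrow> 1 \<le> q \<and> q \<le> cut r b T j"
      unfolding cut_def S_def[symmetric] by simp
    then show ?thesis unfolding p Suc by (auto simp: cells_iff S_def)
  qed (simp add: p cells_iff)
qed

text \<open>The cells with the largest letter form a horizontal strip, since columns increase
  strictly; the remaining shape therefore interlaces with \<open>b\<close>.\<close>

lemma bij_betw_glue:
  assumes l: "letter_rank l = Suc r" and r: "1 \<le> r"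
    and b: "\<And>j. b (Suc j) \<le> b j" "\<And>j. Suc r div 2 \<le> j \<Longrightarrow> b j = 0"
  shows "bij_betw (glue l b) (SIGMA c:{c. \<forall>j. b (Suc j) \<le> c j \<and> c j \<le> b j}. tableaux r c) (tableaux (Suc r) b)"
proof (rule bij_betw_byWitness[where f' = "\<lambda>T. (cut r b T, restrict T (cells (cut r b T)))"])
  let ?S = "SIGMA c:{c. \<forall>j. b (Suc j) \<le> c j \<and> c j \<le> b j}. tableaux r c"
  have sub: "p \<in> cells b" if "p \<in> cells c" "\<forall>j. b (Suc j) \<le> c j \<and> c j \<le> b j" for p c
  proof -
    obtain i j where p: "p = (i, j)" by (cases p)
    have "c (i - 1) \<le> b (i - 1)" using that(2) by blast
    then show ?thesis using that(1) unfolding p by (simp add: cells_iff)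
  qed
  have glue_in: "glue l b (c, T) \<in> tableaux (Suc r) b"
    if c: "\<forall>j. b (Suc j) \<le> c j \<and> c j \<le> b j" and T: "T \<in> tableaux r c" for c T
  proof -
    let ?G = "glue l b (c, T)"
    have G: "?G p = (if p \<in> cells c then T p else l)" if "p \<in> cells b" for p
      using that by (simp add: glue_def)
    have rank: "2 \<le> letter_rank (T p)" "letter_rank (T p) \<le> r" if "p \<in> cells c" for p
      using T that by (auto simp: tableaux_def)
    show ?thesis
      unfolding tableaux_def
    proof (intro CollectI conjI allI impI)
      show "?G \<in> cells b \<rightarrow>\<^sub>E {l. 2 \<le> letter_rank l \<and> letter_rank l \<le> Suc r}"
      proof (rule PiE_I)
        fix p assume "p \<in> cells b"
        then show "?G p \<in> {l. 2 \<le> letter_rank l \<and> letter_rank l \<le> Suc r}"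
          using G[of p] rank[of p] l r by auto
      qed (simp add: glue_def)
    next
      fix i j j' assume ij: "(i, j) \<in> cells b" "(i, j') \<in> cells b" "j < j'"
      show "?G (i, j) \<le> ?G (i, j')"
      proof (cases "(i, j') \<in> cells c")
        case True
        then have "(i, j) \<in> cells c" using ij by (auto simp: cells_iff)
        then have "T (i, j) \<le> T (i, j')" using True T ij(3) unfolding tableaux_def by blast
        then show ?thesis using G ij True \<open>(i, j) \<in> cells c\<close> by simp
      next
        case False
        then show ?thesis using G ij l rank[of "(i, j)"] by (auto simp: less_eq_sp_letter_def)
      qed
    next
      fix i i' j assume ij: "(i, j) \<in> cells b" "(i', j) \<in> cells b" "i < i'"
      \<comment> \<open>Row \<open>i\<close> has length \<open>b (i - 1)\<close>, so
        \<open>b i\<close> is the length of the row below it. A cell with another cell beneath it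
        thus lies in \<open>c\<close> and holds a letter smaller than \<open>l\<close>.\<close>
      have "b (i' - 1) \<le> b i"
        by (rule lift_Suc_antimono_le[of b, OF b(1)]) (use ij(3) in simp)
      also have "b i \<le> c (i - 1)" using c[rule_format, of "i - 1"] ij(1) by (simp add: cells_iff)
      finally have in_c: "(i, j) \<in> cells c" using ij by (auto simp: cells_iff)
      show "?G (i, j) < ?G (i', j)"
      proof (cases "(i', j) \<in> cells c")
        case True
        then have "T (i, j) < T (i', j)" using in_c T ij(3) unfolding tableaux_def by blast
        then show ?thesis using G ij True in_c by simp
      next
        case False
        then show ?thesis using G ij l rank[OF in_c] in_c by (auto simp: less_sp_letter_def)
      qed
    next
      fix i assume i: "(i, 1) \<in> cells b"
      show "Bar i \<le> ?G (i, 1)"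
      proof (cases "(i, 1) \<in> cells c")
        case True
        then show ?thesis using T G[OF i] unfolding tableaux_def by simp
      next
        case False
        \<comment> \<open>The bound on the number of rows is what lets \<open>l\<close> open row
          \<open>i\<close>: \<open>Bar i\<close> has rank \<open>2 * i\<close>.\<close>
        have "i - 1 < Suc r div 2" using b(2)[of "i - 1"] i by (auto simp: cells_iff not_less[symmetric])
        then have "2 * i \<le> Suc r" using i by (auto simp: cells_iff)
        then show ?thesis using False G[OF i] l by (simp add: less_eq_sp_letter_def)
      qed
    qed
  qed
  then show "glue l b ` ?S \<subseteq> tableaux (Suc r) b" by auto
  show "\<forall>p\<in>?S. (cut r b (glue l b p), restrict (glue l b p) (cells (cut r b (glue l b p)))) = p"
  proof
    fix p assume "p \<in> ?S"
    then obtain c T where p: "p = (c, T)" and c: "\<forall>j. b (Suc j) \<le> c j \<and> c j \<le> b j" and T: "T \<in> tableaux r c"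
      by auto
    have cut: "cut r b (glue l b (c, T)) = c"
    proof
      fix j
      have "{q \<in> {1..b j}. letter_rank (glue l b (c, T) (Suc j, q)) \<le> r} = {1..c j}"
      proof (intro equalityI subsetI)
        fix q assume "q \<in> {q \<in> {1..b j}. letter_rank (glue l b (c, T) (Suc j, q)) \<le> r}"
        then show "q \<in> {1..c j}" using l by (auto simp: glue_def cells_iff split: if_splits)
      next
        fix q assume q: "q \<in> {1..c j}"
        have "c j \<le> b j" using c by blast
        moreover have "letter_rank (T (Suc j, q)) \<le> r"
          using T q by (auto simp: tableaux_def cells_iff)
        ultimately show "q \<in> {q \<in> {1..b j}. letter_rank (glue l b (c, T) (Suc j, q)) \<le> r}"
          using q by (auto simp: glue_def cells_iff)
      qed
      then show "cut r b (glue l b (c, T)) j = c j" by (simp add: cut_def)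
    qed
    have "restrict (glue l b (c, T)) (cells c) = T"
    proof (rule extensionalityI)
      show "T \<in> extensional (cells c)" using T by (simp add: tableaux_def PiE_def)
      fix p assume "p \<in> cells c"
      then show "restrict (glue l b (c, T)) (cells c) p = T p"
        using sub[OF _ c] by (simp add: glue_def)
    qed simp
    then show "(cut r b (glue l b p), restrict (glue l b p) (cells (cut r b (glue l b p)))) = p"
      unfolding p cut by simp
  qed
  show "\<forall>T\<in>tableaux (Suc r) b. glue l b (cut r b T, restrict T (cells (cut r b T))) = T"
  proof
    fix T assume T: "T \<in> tableaux (Suc r) b"
    show "glue l b (cut r b T, restrict T (cells (cut r b T))) = T"
    proof (rule extensionalityI)
      show "glue l b (cut r b T, restrict T (cells (cut r b T))) \<in> extensional (cells b)" by (simp add: glue_def)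
      show "T \<in> extensional (cells b)" using T by (simp add: tableaux_def PiE_def)
      fix p assume p: "p \<in> cells b"
      show "glue l b (cut r b T, restrict T (cells (cut r b T))) p = T p"
      proof (cases "letter_rank (T p) \<le> r")
        case True
        then show ?thesis using p cells_cut[OF T] by (simp add: glue_def)
      next
        case False
        have "letter_rank (T p) \<le> Suc r" using T p by (auto simp: tableaux_def)
        then have "T p = l" using False l by (intro letter_rank_inject) simp
        then show ?thesis using False p cells_cut[OF T] by (simp add: glue_def)
      qed
    qed
  qed
  show "(\<lambda>T. (cut r b T, restrict T (cells (cut r b T)))) ` tableaux (Suc r) b \<subseteq> ?S"
  proof clarify
    fix T assume T: "T \<in> tableaux (Suc r) b"
    have le: "cut r b T j \<le> b j" for j
      unfolding cut_def by (rule order_trans[OF card_mono[of "{1..b j}"]]) auto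
    have ge: "b (Suc j) \<le> cut r b T j" for j
    proof (cases "b (Suc j) = 0")
      case False
      \<comment> \<open>The end of the row below: the entry above that cell is strictly smaller, so
        it survives the cut, and with it the initial segment of its row.\<close>
      let ?q = "b (Suc j)"
      have c: "(Suc j, ?q) \<in> cells b" "(Suc (Suc j), ?q) \<in> cells b"
        using False b(1)[of j] by (auto simp: cells_iff)
      then have "T (Suc j, ?q) < T (Suc (Suc j), ?q)" using T unfolding tableaux_def by blast
      moreover have "letter_rank (T (Suc (Suc j), ?q)) \<le> Suc r" using T c by (auto simp: tableaux_def)
      ultimately have "letter_rank (T (Suc j, ?q)) \<le> r" by (simp add: less_sp_letter_def)
      then have "(Suc j, ?q) \<in> cells (cut r b T)" using cells_cut[OF T] c by blast
      then show ?thesis by (simp add: cells_iff)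
    qed simp
    have sub': "cells (cut r b T) \<subseteq> cells b" using cells_cut[OF T] by blast
    have "restrict T (cells (cut r b T)) \<in> tableaux r (cut r b T)"
      unfolding tableaux_def
    proof (intro CollectI conjI allI impI)
      show "restrict T (cells (cut r b T)) \<in> cells (cut r b T) \<rightarrow>\<^sub>E {l. 2 \<le> letter_rank l \<and> letter_rank l \<le> r}"
      proof (rule PiE_I)
        fix p assume p: "p \<in> cells (cut r b T)"
        then have "2 \<le> letter_rank (T p)" using T sub' by (auto simp: tableaux_def)
        then show "restrict T (cells (cut r b T)) p \<in> {l. 2 \<le> letter_rank l \<and> letter_rank l \<le> r}"
          using p cells_cut[OF T] by simp
      qed simp
    next
      fix i j j' assume "(i, j) \<in> cells (cut r b T)" "(i, j') \<in> cells (cut r b T)" "j < j'"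
      moreover from this have "(i, j) \<in> cells b" "(i, j') \<in> cells b" using sub' by auto
      ultimately show "restrict T (cells (cut r b T)) (i, j) \<le> restrict T (cells (cut r b T)) (i, j')"
        using T unfolding tableaux_def by simp
    next
      fix i i' j assume "(i, j) \<in> cells (cut r b T)" "(i', j) \<in> cells (cut r b T)" "i < i'"
      moreover from this have "(i, j) \<in> cells b" "(i', j) \<in> cells b" using sub' by auto
      ultimately show "restrict T (cells (cut r b T)) (i, j) < restrict T (cells (cut r b T)) (i', j)"
        using T unfolding tableaux_def by simp
    next
      fix i assume "(i, 1) \<in> cells (cut r b T)"
      moreover from this have "(i, 1) \<in> cells b" using sub' by auto
      ultimately show "Bar i \<le> restrict T (cells (cut r b T)) (i, 1)"
        using T unfolding tableaux_def by simp
    qed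
    then show "cut r b T \<in> {c. \<forall>j. b (Suc j) \<le> c j \<and> c j \<le> b j} \<and>
        restrict T (cells (cut r b T)) \<in> tableaux r (cut r b T)"
      using le ge by blast
  qed
qed

lemma tableau_sum_rec:
  assumes l: "letter_rank l = Suc r" and r: "1 \<le> r"
    and b: "\<And>j. b (Suc j) \<le> b j" "\<And>j. K \<le> j \<Longrightarrow> b j = 0" and K: "K \<le> Suc r div 2"
  shows "tableau_sum (Suc r) b
    = (\<Sum>c\<in>tuples K (\<lambda>j. {b (Suc j)..b j}). (\<Prod>j<K. letter_wgt l ^ (b j - c j)) * tableau_sum r c)"
proof -
  let ?C = "{c. \<forall>j. b (Suc j) \<le> c j \<and> c j \<le> b j}"
  have C: "?C = tuples K (\<lambda>j. {b (Suc j)..b j})"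
    using tuples_interlacing[of K b] b(2) by blast
  have fin: "finite (cells b)" using finite_cells[of K b] b(2) by blast
  have finC: "finite ?C" unfolding C by (rule finite_tuples) simp
  have c0: "c j = 0" if "c \<in> ?C" "K \<le> j" for c j
  proof -
    have "c j \<le> b j" using that(1) by simp
    then show ?thesis using b(2)[OF that(2)] by simp
  qed
  have bij: "bij_betw (glue l b) (SIGMA c:?C. tableaux r c) (tableaux (Suc r) b)"
    using b K by (intro bij_betw_glue[OF l r]) auto
  have "tableau_sum (Suc r) b = (\<Sum>q\<in>(SIGMA c:?C. tableaux r c). \<Prod>p\<in>cells b. letter_wgt (glue l b q p))"
    unfolding tableau_sum_def by (rule sum.reindex_bij_betw[OF bij, symmetric])
  also have "\<dots> = (\<Sum>(c, T)\<in>(SIGMA c:?C. tableaux r c).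
      (\<Prod>j<K. letter_wgt l ^ (b j - c j)) * (\<Prod>p\<in>cells c. letter_wgt (T p)))"
  proof (rule sum.cong[OF refl], clarify)
    fix c T assume c: "\<forall>j. b (Suc j) \<le> c j \<and> c j \<le> b j"
    have sub: "cells c \<subseteq> cells b"
    proof clarify
      fix i j assume "(i, j) \<in> cells c"
      moreover have "c (i - 1) \<le> b (i - 1)" using c by blast
      ultimately show "(i, j) \<in> cells b" by (simp add: cells_iff)
    qed
    have "cells b - cells c = (\<lambda>(i, j). (Suc i, j)) ` (SIGMA i:{..<K}. {c i<..b i})"
    proof (intro equalityI subsetI)
      fix p assume p: "p \<in> cells b - cells c"
      then obtain i j where "p = (Suc i, j)" "i < K" "0 < j" "j \<le> b i"
        using cells_eq_image[of K b] b(2) by auto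
      then show "p \<in> (\<lambda>(i, j). (Suc i, j)) ` (SIGMA i:{..<K}. {c i<..b i})"
        using p by (auto simp: cells_iff)
    qed (auto simp: cells_iff)
    then have "card (cells b - cells c) = card (SIGMA i:{..<K}. {c i<..b i})"
      by (simp add: card_image inj_on_def)
    also have "\<dots> = (\<Sum>i<K. b i - c i)" by simp
    finally have card: "card (cells b - cells c) = (\<Sum>i<K. b i - c i)" .
    have "(\<Prod>p\<in>cells b. letter_wgt (glue l b (c, T) p))
        = (\<Prod>p\<in>cells b - cells c. letter_wgt (glue l b (c, T) p)) * (\<Prod>p\<in>cells c. letter_wgt (glue l b (c, T) p))"
      by (rule prod.subset_diff[OF sub fin])
    also have "(\<Prod>p\<in>cells b - cells c. letter_wgt (glue l b (c, T) p)) = letter_wgt l ^ card (cells b - cells c)"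
      by (simp add: glue_def)
    also have "(\<Prod>p\<in>cells c. letter_wgt (glue l b (c, T) p)) = (\<Prod>p\<in>cells c. letter_wgt (T p))"
      using sub by (intro prod.cong refl) (auto simp: glue_def)
    finally show "(\<Prod>p\<in>cells b. letter_wgt (glue l b (c, T) p))
        = (\<Prod>j<K. letter_wgt l ^ (b j - c j)) * (\<Prod>p\<in>cells c. letter_wgt (T p))"
      unfolding card power_sum .
  qed
  also have "\<dots> = (\<Sum>c\<in>?C. \<Sum>T\<in>tableaux r c.
      (\<Prod>j<K. letter_wgt l ^ (b j - c j)) * (\<Prod>p\<in>cells c. letter_wgt (T p)))"
  proof (rule sum.Sigma[symmetric, OF finC], rule ballI)
    fix c assume "c \<in> ?C"
    then show "finite (tableaux r c)" using finite_tableaux[of K c r] c0 by blast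
  qed
  finally show ?thesis unfolding C tableau_sum_def sum_distrib_left .
qed

text \<open>The effect of the first-column condition: together with \<open>Bar (k + 1)\<close> the
  whole row \<open>k + 1\<close> has to disappear.\<close>

lemma tableau_sum_too_long:
  assumes "r div 2 \<le> j" "0 < c j"
  shows "tableau_sum r c = 0"
proof -
  have "tableaux r c = {}"
  proof (rule ccontr)
    assume "tableaux r c \<noteq> {}"
    then obtain T where T: "T \<in> tableaux r c" by blast
    have "(Suc j, 1) \<in> cells c" using assms(2) by (simp add: cells_iff)
    then have "Bar (Suc j) \<le> T (Suc j, 1)" "letter_rank (T (Suc j, 1)) \<le> r"
      using T by (auto simp: tableaux_def)
    then have "2 * Suc j \<le> r" by (simp add: less_eq_sp_letter_def)
    then show False using assms(1) by simp
  qed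
  then show ?thesis by (simp add: tableau_sum_def)
qed

section \<open>The tableau sum as a determinant\<close>

definition shift :: "nat \<Rightarrow> (nat \<Rightarrow> nat) \<Rightarrow> nat \<Rightarrow> nat" where
  "shift k b j = (if j < k then b j + (k - j) else 0)"

lemma bij_betw_shift:
  "bij_betw (shift k) (tuples k I) (tuples k (\<lambda>j. (\<lambda>y. y + (k - j)) ` I j))"
  by (rule bij_betw_byWitness[where f' = "\<lambda>a j. if j < k then a j - (k - j) else 0"])
    (auto simp: tuples_def shift_def fun_eq_iff)

text \<open>Removing the unbarred letter keeps the staircase, removing the barred one shortens it by
  one. Hence the closed intervals \<open>{b (Suc j)..b j}\<close> become right-closed in the first
  case and left-closed in the second, as \<open>tableau_det_step\<close> expects.\<close>

lemma weyl_det_tableau_sum: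
  assumes "\<And>j. b (Suc j) \<le> b j" "\<And>j. k \<le> j \<Longrightarrow> b j = 0"
  shows "vander k * tableau_sum (2*k + 1) b = weyl_det k (shift k b)"
  using assms
proof (induction k arbitrary: b)
  case 0
  have "cells b = {}" using 0 by (auto simp: cells_iff)
  then show ?case by (simp add: vander_def weyl_det_def tableau_sum_def tableaux_def)
next
  case (Suc k)
  define a where "a = shift (Suc k) b"
  let ?B = "tuples (Suc k) (\<lambda>j. {b (Suc j)..b j})"
  have rec1: "tableau_sum (Suc (2*k + 2)) b
      = (\<Sum>c\<in>?B. (\<Prod>j<Suc k. letter_wgt (Unbar (Suc k)) ^ (b j - c j)) * tableau_sum (2*k + 2) c)"
    by (rule tableau_sum_rec) (use Suc.prems in auto)
  have rec2: "vander k * tableau_sum (2*k + 2) c = uvar k ^ (shift (Suc k) c k - 1) *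
      (\<Sum>d\<in>tuples k (\<lambda>j. {shift (Suc k) c (Suc j)..<shift (Suc k) c j}).
        (\<Prod>j<k. uvar k ^ (shift (Suc k) c j - 1 - d j)) * weyl_det k d)"
    if c: "c \<in> ?B" for c
  proof -
    have c0: "c j = 0" if "Suc k \<le> j" for j using c that by (auto simp: tuples_def)
    have anti: "c (Suc j) \<le> c j" for j
    proof (cases "Suc j < Suc k")
      case True
      then have "c (Suc j) \<le> b (Suc j)" "b (Suc j) \<le> c j" using c by (auto simp: tuples_def)
      then show ?thesis by simp
    qed (simp add: c0)
    let ?D = "tuples k (\<lambda>j. {c (Suc j)..c j})"
    have intervals: "tuples k (\<lambda>j. (\<lambda>y. y + (k - j)) ` {c (Suc j)..c j})
        = tuples k (\<lambda>j. {shift (Suc k) c (Suc j)..<shift (Suc k) c j})"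
      by (auto simp: tuples_def shift_def atLeastLessThanSuc_atLeastAtMost Suc_diff_le)
    have u: "letter_wgt (Bar (Suc k)) = uvar k" by (simp add: uvar_def xinv_def)
    have "tableau_sum (Suc (2*k + 1)) c = (\<Sum>d\<in>tuples (Suc k) (\<lambda>j. {c (Suc j)..c j}).
        (\<Prod>j<Suc k. letter_wgt (Bar (Suc k)) ^ (c j - d j)) * tableau_sum (2*k + 1) d)"
      by (rule tableau_sum_rec) (use c0 anti in auto)
    \<comment> \<open>Tuples with \<open>d k > 0\<close> have too many rows for the letters that
      remain.\<close>
    also have "\<dots> = (\<Sum>d\<in>?D. (\<Prod>j<Suc k. letter_wgt (Bar (Suc k)) ^ (c j - d j)) * tableau_sum (2*k + 1) d)"
    proof (rule sum.mono_neutral_right)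
      show "finite (tuples (Suc k) (\<lambda>j. {c (Suc j)..c j}))" by (rule finite_tuples) simp
      show "?D \<subseteq> tuples (Suc k) (\<lambda>j. {c (Suc j)..c j})"
        using c0[of "Suc k"] by (auto simp: tuples_def less_Suc_eq)
      show "\<forall>d\<in>tuples (Suc k) (\<lambda>j. {c (Suc j)..c j}) - ?D.
        (\<Prod>j<Suc k. letter_wgt (Bar (Suc k)) ^ (c j - d j)) * tableau_sum (2*k + 1) d = 0"
      proof
        fix d assume d: "d \<in> tuples (Suc k) (\<lambda>j. {c (Suc j)..c j}) - ?D"
        then have "0 < d k"
        proof (rule_tac ccontr)
          assume "\<not> 0 < d k"
          then have "d j = 0" if "k \<le> j" for j using d that by (cases "j = k") (auto simp: tuples_def)
          then show False using d by (auto simp: tuples_def)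
        qed
        then show "(\<Prod>j<Suc k. letter_wgt (Bar (Suc k)) ^ (c j - d j)) * tableau_sum (2*k + 1) d = 0"
          using tableau_sum_too_long[of "2*k + 1" k d] by simp
      qed
    qed
    \<comment> \<open>On \<open>?D\<close> the last part \<open>d k\<close> is 0, so all
      \<open>c k\<close> cells of the last row carry the barred letter.\<close>
    also have "\<dots> = (\<Sum>d\<in>?D. uvar k ^ c k * ((\<Prod>j<k. uvar k ^ (c j - d j)) * tableau_sum (2*k + 1) d))"
      unfolding u by (rule sum.cong) (auto simp: tuples_def mult_ac)
    finally have expand: "tableau_sum (2*k + 2) c
        = (\<Sum>d\<in>?D. uvar k ^ c k * ((\<Prod>j<k. uvar k ^ (c j - d j)) * tableau_sum (2*k + 1) d))"
      by simp
    have "vander k * tableau_sum (2*k + 2) c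
        = (\<Sum>d\<in>?D. uvar k ^ c k * ((\<Prod>j<k. uvar k ^ (c j - d j)) * (vander k * tableau_sum (2*k + 1) d)))"
      by (simp only: expand sum_distrib_left mult.left_commute[of "vander k"])
    also have "\<dots> = (\<Sum>d\<in>?D. uvar k ^ (shift (Suc k) c k - 1) *
        ((\<Prod>j<k. uvar k ^ (shift (Suc k) c j - 1 - shift k d j)) * weyl_det k (shift k d)))"
    proof (rule sum.cong[OF refl])
      fix d assume d: "d \<in> ?D"
      have "vander k * tableau_sum (2*k + 1) d = weyl_det k (shift k d)"
      proof (rule Suc.IH)
        show d0: "d j = 0" if "k \<le> j" for j using d that by (auto simp: tuples_def)
        show "d (Suc j) \<le> d j" for j
        proof (cases "Suc j < k")
          case True
          then have "d (Suc j) \<le> c (Suc j)" "c (Suc j) \<le> d j" using d by (auto simp: tuples_def)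
          then show ?thesis by simp
        qed (simp add: d0)
      qed
      moreover have "(\<Prod>j<k. uvar k ^ (c j - d j)) = (\<Prod>j<k. uvar k ^ (shift (Suc k) c j - 1 - shift k d j))"
        by (rule prod.cong) (auto simp: shift_def Suc_diff_le)
      moreover have "shift (Suc k) c k - 1 = c k" by (simp add: shift_def)
      ultimately show "uvar k ^ c k * ((\<Prod>j<k. uvar k ^ (c j - d j)) * (vander k * tableau_sum (2*k + 1) d))
        = uvar k ^ (shift (Suc k) c k - 1) *
        ((\<Prod>j<k. uvar k ^ (shift (Suc k) c j - 1 - shift k d j)) * weyl_det k (shift k d))" by simp
    qed
    also have "\<dots> = (\<Sum>d\<in>tuples k (\<lambda>j. {shift (Suc k) c (Suc j)..<shift (Suc k) c j}).
        uvar k ^ (shift (Suc k) c k - 1) *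
        ((\<Prod>j<k. uvar k ^ (shift (Suc k) c j - 1 - d j)) * weyl_det k d))"
      unfolding intervals[symmetric] by (rule sum.reindex_bij_betw[OF bij_betw_shift])
    finally show ?thesis by (simp only: sum_distrib_left)
  qed
  have a_dec: "a (Suc j) < a j" if "j \<le> k" for j
  proof -
    have "b (Suc j) \<le> b j" by (rule Suc.prems(1))
    then show ?thesis using that by (simp add: a_def shift_def) arith
  qed
  have intervals: "tuples (Suc k) (\<lambda>j. (\<lambda>y. y + (Suc k - j)) ` {b (Suc j)..b j}) = tuples (Suc k) (\<lambda>j. {a (Suc j)<..a j})"
  proof -
    have "(\<lambda>y. y + (Suc k - j)) ` {b (Suc j)..b j} = {a (Suc j)<..a j}" if "j < Suc k" for j
    proof -
      have "b (Suc k) = 0" using Suc.prems(2) by simp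
      \<comment> \<open>For \<open>j = k\<close> the left side is padding, and the equation holds
        because \<open>b (Suc k) = 0\<close>.\<close>
      then have "a (Suc j) + 1 = b (Suc j) + (Suc k - j)" "a j = b j + (Suc k - j)"
        using that by (cases "j = k"; simp add: a_def shift_def)+
      then show ?thesis unfolding image_add_atLeastAtMost' by auto
    qed
    then show ?thesis by (rule tuples_cong)
  qed
  have "vander k * tableau_sum (2 * Suc k + 1) b
      = (\<Sum>c\<in>?B. (\<Prod>j<Suc k. xvar k ^ (b j - c j)) * (vander k * tableau_sum (2*k + 2) c))"
    using rec1 by (simp add: xvar_def sum_distrib_left mult.left_commute)
  also have "\<dots> = (\<Sum>c\<in>?B. (\<Prod>j<Suc k. xvar k ^ (a j - shift (Suc k) c j)) *
      (uvar k ^ (shift (Suc k) c k - 1) *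
      (\<Sum>d\<in>tuples k (\<lambda>j. {shift (Suc k) c (Suc j)..<shift (Suc k) c j}).
        (\<Prod>j<k. uvar k ^ (shift (Suc k) c j - 1 - d j)) * weyl_det k d)))"
  proof (rule sum.cong[OF refl])
    fix c assume c: "c \<in> ?B"
    have "(\<Prod>j<Suc k. xvar k ^ (b j - c j)) = (\<Prod>j<Suc k. xvar k ^ (a j - shift (Suc k) c j))"
      by (rule prod.cong) (auto simp: shift_def a_def)
    then show "(\<Prod>j<Suc k. xvar k ^ (b j - c j)) * (vander k * tableau_sum (2*k + 2) c)
      = (\<Prod>j<Suc k. xvar k ^ (a j - shift (Suc k) c j)) *
      (uvar k ^ (shift (Suc k) c k - 1) *
      (\<Sum>d\<in>tuples k (\<lambda>j. {shift (Suc k) c (Suc j)..<shift (Suc k) c j}).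
        (\<Prod>j<k. uvar k ^ (shift (Suc k) c j - 1 - d j)) * weyl_det k d))"
      unfolding rec2[OF c] by simp
  qed
  also have "\<dots> = (\<Sum>c\<in>tuples (Suc k) (\<lambda>j. {a (Suc j)<..a j}).
      (\<Prod>j<Suc k. xvar k ^ (a j - c j)) * (uvar k ^ (c k - 1) *
      (\<Sum>d\<in>tuples k (\<lambda>j. {c (Suc j)..<c j}). (\<Prod>j<k. uvar k ^ (c j - 1 - d j)) * weyl_det k d)))"
    unfolding intervals[symmetric] by (rule sum.reindex_bij_betw[OF bij_betw_shift])
  finally have sum_eq: "vander k * tableau_sum (2 * Suc k + 1) b = \<dots>" .
  have "vander (Suc k) = (\<Prod>i<k. (xvar i + uvar i) - (xvar k + uvar k)) * vander k"
    by (simp add: vander_def)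
  then have "vander (Suc k) * tableau_sum (2 * Suc k + 1) b = (\<Prod>i<k. (xvar i + uvar i) - (xvar k + uvar k)) *
      (\<Sum>c\<in>tuples (Suc k) (\<lambda>j. {a (Suc j)<..a j}).
      (\<Prod>j<Suc k. xvar k ^ (a j - c j)) * (uvar k ^ (c k - 1) *
      (\<Sum>d\<in>tuples k (\<lambda>j. {c (Suc j)..<c j}). (\<Prod>j<k. uvar k ^ (c j - 1 - d j)) * weyl_det k d)))"
    by (simp only: mult.assoc sum_eq)
  also have "\<dots> = weyl_det (Suc k) a"
    unfolding weyl_det_def
  proof (rule tableau_det_step)
    have "xvar i * uvar i = tt\<^sup>2" for i
      using xvar_xinv[of i] by (simp add: uvar_def mult.left_commute)
    then show "xvar i * uvar i = xvar k * uvar k" for i by simp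
    show "a (Suc k) = 0" by (simp add: a_def shift_def)
  qed (rule a_dec)
  finally show ?case unfolding a_def .
qed

section \<open>The deformed denominator and the Vandermonde factor\<close>

text \<open>A new variable raises each exponent of the monomial by one, and the spare
  \<open>x_i\<close> turns the new pair of factors into
  \<open>x_i + t^2 / x_i + t (x_(n+1) + 1 / x_(n+1))\<close>.\<close>

lemma D_sp_deformed: "D_sp n = deformed n"
proof (induction n)
  case 0
  show ?case by (simp add: D_sp_def deformed_def)
next
  case (Suc n)
  let ?f = "\<lambda>i j. (1 + tt * X i (- 1) * X j 1) * (1 + tt * X i (- 1) * X j (- 1))"
  have monomial: "(\<Prod>i=1..Suc n. X i (int (Suc n - i + 1)))
      = (\<Prod>i=1..n. X i (int (n - i + 1))) * (\<Prod>i=1..n. X i 1) * X (Suc n) 1"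
  proof -
    have "(\<Prod>i=1..n. X i (int (Suc n - i + 1))) = (\<Prod>i=1..n. X i (int (n - i + 1)) * X i 1)"
    proof (rule prod.cong[OF refl])
      fix i assume "i \<in> {1..n}"
      then have "int (Suc n - i + 1) = int (n - i + 1) + 1" by auto
      then show "X i (int (Suc n - i + 1)) = X i (int (n - i + 1)) * X i 1" by (simp only: X_add)
    qed
    then show ?thesis by (simp add: prod.distrib)
  qed
  have pairs: "(\<Prod>i=1..Suc n. \<Prod>j=i+1..Suc n. ?f i j) = (\<Prod>i=1..n. \<Prod>j=i+1..n. ?f i j) * (\<Prod>i=1..n. ?f i (Suc n))"
  proof -
    have "(\<Prod>i=1..n. \<Prod>j=i+1..Suc n. ?f i j) = (\<Prod>i=1..n. (\<Prod>j=i+1..n. ?f i j) * ?f i (Suc n))"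
      by (rule prod.cong) auto
    then show ?thesis by (simp add: prod.distrib)
  qed
  have "X i 1 * ?f i (Suc n) = X i 1 + tt\<^sup>2 * X i (- 1) + tt * (X (Suc n) 1 + X (Suc n) (- 1))" for i
  proof -
    let ?x = "X i 1" and ?xi = "X i (- 1)" and ?y = "X (Suc n) 1" and ?yi = "X (Suc n) (- 1)"
    have "?x * ((1 + tt * ?xi * ?y) * (1 + tt * ?xi * ?yi))
        = ?x + tt * (?x * ?xi) * (?y + ?yi) + tt\<^sup>2 * (?x * ?xi) * ?xi * (?y * ?yi)"
      by (simp add: algebra_simps power2_eq_square)
    then show ?thesis by (simp add: X_inverse algebra_simps)
  qed
  then have "(\<Prod>i=1..n. X i 1) * (\<Prod>i=1..n. ?f i (Suc n))
      = (\<Prod>i=1..n. X i 1 + tt\<^sup>2 * X i (- 1) + tt * (X (Suc n) 1 + X (Suc n) (- 1)))"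
    by (simp only: flip: prod.distrib)
  also have "\<dots> = (\<Prod>i<n. xvar i + uvar i + tt * (xvar n + xinv n))"
    by (rule prod.reindex_bij_witness[of _ Suc "\<lambda>i. i - 1"]) (auto simp: xvar_def uvar_def xinv_def)
  finally have cross: "(\<Prod>i=1..n. X i 1) * (\<Prod>i=1..n. ?f i (Suc n)) = \<dots>" .
  have "X (Suc n) (- 2) = (xinv n)\<^sup>2"
    using X_minus_of_nat[of "Suc n" 2] by (simp add: xinv_def)
  then have "D_sp (Suc n) = D_sp n * (X (Suc n) 1 * (1 + tt * (xinv n)\<^sup>2)
      * ((\<Prod>i=1..n. X i 1) * (\<Prod>i=1..n. ?f i (Suc n))))"
    unfolding D_sp_def monomial pairs by (simp add: mult_ac)
  also have "\<dots> = deformed (Suc n)"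
    unfolding cross Suc.IH by (simp add: deformed_def xvar_def)
  finally show ?case .
qed

text \<open>The monomial of the variable with index \<open>i + 1\<close> has coefficient 1 in one
  sum and 0 in the other, so each factor is nonzero; Laurent polynomials have no zero
  divisors.\<close>

lemma vander_nonzero: "vander n \<noteq> 0"
proof -
  have "xvar i + uvar i \<noteq> xvar k + uvar k" if "i < k" for i k
  proof
    assume eq: "xvar i + uvar i = xvar k + uvar k"
    have u: "uvar j = Poly_Mapping.single (Poly_Mapping.single (Suc j) (- 1)) ([:0, 1:]\<^sup>2)" for j
      by (simp add: uvar_def xinv_def X_def tt_def power2_eq_square mult_single)
    define e :: "nat \<Rightarrow>\<^sub>0 int" where "e = Poly_Mapping.single (Suc i) 1"
    have e_at: "Poly_Mapping.lookup e (Suc i) = 1" by (simp add: e_def)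
    have ne: "Poly_Mapping.single (Suc j) c \<noteq> e" if "j \<noteq> i \<or> c \<noteq> 1" for j and c :: int
      using that e_at by (auto simp: lookup_single when_def split: if_splits)
    have "Poly_Mapping.lookup (xvar i + uvar i) e = 1"
      using ne[of i "- 1"] by (simp add: u lookup_add xvar_def X_def lookup_single when_def e_def)
    moreover have "Poly_Mapping.lookup (xvar k + uvar k) e = 0"
      using ne[of k 1] ne[of k "- 1"] that by (simp add: u lookup_add xvar_def X_def lookup_single when_def)
    ultimately show False using eq by simp
  qed
  then show ?thesis by (auto simp: vander_def)
qed

section \<open>Comparison of the two determinant evaluations\<close>

theorem theorem6p4:
  fixes n m :: nat and lam :: "nat \<Rightarrow> nat"
  assumes "n \<ge> 1" and "partition_at_most n lam" and "m = lam 1 + n"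
  shows "D_sp n * sp_char n lam =
    (\<Sum>CM\<in>CM_set n (add_delta n lam).
      tt ^ (ne_odd n m CM + se_even n m CM + wgt_even n m CM) * (1 + tt) ^ ns_count n m CM
        * ice_wgt n m CM)"
proof -
  \<comment> \<open>Parts are counted from 0 from here on; in this numbering \<open>a\<close> is
    \<open>add_delta n lam\<close>, with largest part \<open>m\<close>.\<close>
  define b where "b j = lam (Suc j)" for j
  define a where "a = shift n b"
  let ?mu = "add_delta n lam"
  have b: "b (Suc j) \<le> b j" "n \<le> j \<Longrightarrow> b j = 0" for j
    using assms(2) by (auto simp: b_def partition_at_most_def)
  have a_dec: "a (Suc j) < a j" if "j < n" for j
    using that b(1)[of j] by (simp add: a_def shift_def) arith
  have a_zero: "a j = 0" if "n \<le> j" for j using that by (simp add: a_def shift_def)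
  have m: "?mu 1 = m" using assms(1,3) by (simp add: add_delta_def)
  have a0: "a 0 \<le> m" using assms(1,3) by (simp add: a_def shift_def b_def)
  have strict: "strict_part a"
    unfolding strict_part_def
  proof
    fix j
    show "a (Suc j) < a j \<or> a (Suc j) = 0" using a_dec a_zero by (cases "j < n") auto
  qed
  have a_pos: "j < n \<longleftrightarrow> 0 < a j" for j
    by (simp add: a_def shift_def)
  have a_mu: "a j = ?mu (Suc j)" if "j < n" for j
    using that by (simp add: a_def shift_def b_def add_delta_def)
  have parts_a: "parts a = ?mu ` {1..n}"
  proof (intro equalityI subsetI)
    fix c assume "c \<in> parts a"
    then obtain j where j: "0 < c" "c = a j" by (auto simp: parts_def)
    then have "j < n" using a_pos by simp
    then show "c \<in> ?mu ` {1..n}" using j a_mu by (intro image_eqI[of _ _ "Suc j"]) auto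
  next
    fix c assume "c \<in> ?mu ` {1..n}"
    then obtain i where i: "i \<in> {1..n}" "c = ?mu i" by blast
    then have "i - 1 < n" "c = a (i - 1)" using a_mu[of "i - 1"] by auto
    then show "c \<in> parts a" using a_pos[of "i - 1"] unfolding parts_def by auto
  qed
  have card: "card (parts a) = n" using card_parts[OF strict, of n] a_pos by blast
  have sub: "parts a \<subseteq> {1..?mu 1}" unfolding m by (rule parts_subset[OF strict a0])
  let ?g = "\<lambda>CM. tt ^ (ne_odd n m CM + se_even n m CM + wgt_even n m CM) * (1 + tt) ^ ns_count n m CM
        * ice_wgt n m CM"
  have "(\<Sum>CM\<in>CM_set n ?mu. ?g CM) = (\<Sum>\<sigma>\<in>walks (ice_step m) (2*n) (parts a). ?g (chain_matrix n m \<sigma>))"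
    using sum.reindex_bij_betw[OF bij_betw_chain_matrix[OF assms(1) parts_a sub card], of ?g]
    unfolding m by (rule sym)
  also have "\<dots> = (\<Sum>\<sigma>\<in>walks (ice_step m) (2*n) (parts a). \<Prod>q<2*n. ice_row_wgt m q (\<sigma> (Suc q)) (\<sigma> q))"
    by (simp only: chain_matrix_wgt)
  also have "\<dots> = walk_sum (ice_step m) (ice_row_wgt m) (2*n) (parts a)"
  proof (rule sum_walks[THEN conjunct2])
    fix q A
    show "finite {B. ice_step m q A B}"
      by (rule finite_subset[of _ "Pow {1..m}"]) (auto simp: ice_step_def)
  qed
  finally have ice: "(\<Sum>CM\<in>CM_set n ?mu. ?g CM) = walk_sum (ice_step m) (ice_row_wgt m) (2*n) (parts a)" .
  have "vander n * (D_sp n * sp_char n lam) = deformed n * (vander n * tableau_sum (2*n + 1) b)"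
    unfolding D_sp_deformed sp_char_tableau_sum[OF assms(2)] b_def by (rule mult.left_commute)
  also have "\<dots> = deformed n * weyl_det n a"
    unfolding a_def using weyl_det_tableau_sum[of b n] b by simp
  also have "\<dots> = vander n * walk_sum (ice_step m) (ice_row_wgt m) (2*n) (parts a)"
    by (rule ice_walk_sum[symmetric]) (use a_dec a_zero a0 in auto)
  finally show ?thesis unfolding ice using vander_nonzero by simp
qed

end
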